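(* For $t>0$, $g\in SL(2,\mathbb C)$, $h\in SU(2)$ let $$\psi^t_g(h)=\sum_{j=0,\frac12,1,\dots}(2j+1)\,e^{-\frac t2j(j+1)}\chi_j(gh^{-1}),\qquad i^t(g,g'):=\frac{|\langle\psi^t_g,\psi^t_{g'}\rangle|^2}{\|\psi^t_g\|^2\|\psi^t_{g'}\|^2}$$ with inner product and norms in $L_2(SU(2),d\mu_H)$. Let $g=Hu$, $g'=H'u'$ be the polar decompositions of $g,g'\in SL(2,\mathbb C)$, with $u,u'\in SU(2)$, $H=\exp(-ip^j\tau_j/2)$, $H'=\exp(-ip'^j\tau_j/2)$, $p=|\vec p|$, $p'=|\vec p'|$. Let $HH'=\tilde H\tilde u$ be the polar decomposition of $HH'$, with $\tilde u\in SU(2)$, $\tilde H=\exp(-i\tilde p^j\tau_j/2)$, $\tilde p=|\vec{\tilde p}|$, and let $\tilde h:=u(u')^{-1}\tilde u^{-1}=\exp(\tilde\theta^j\tau_j)$ with $\tilde\theta=|\vec{\tilde\theta}|\in[0,\pi]$. Let $\tilde\alpha\in[0,\pi]$ satisfy $\cos\tilde\alpha=\vec{\tilde p}\cdot\vec{\tilde\theta}/(\tilde p\tilde\theta)$. Put $x=\cosh(\tilde p/2)\cos\tilde\theta+i\sinh(\tilde p/2)\sin\tilde\theta\cos\tilde\alpha$, $\operatorname{arcosh}(x):=s+i\phi$ with $s\in\mathbb R$, $\phi\in[0,\pi]$, $\cosh(s+i\phi)=x$, and $$\Delta^2:=p^2+(p')^2-\tilde p^2/2,\qquad \delta^2:=\tilde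 p^2/4-s^2+\phi^2-\tilde\theta^2 .$$ There exist positive $K_t,K'_t,K''_t$, depending only on $t$ (not on $g,g'$) and decaying exponentially fast to $0$ as $t\to0$, such that for every $t>0$ with $K_t<1$: (i) if $0\le\phi\le31\pi/32$, then $$i^t(g,g')\le\frac{\frac{|\operatorname{arcosh}(x)|^2}{|x^2-1|}e^{-\frac{\Delta^2+2\tilde\theta^2+2\delta^2}{t}}(1+K'_t)}{\frac{p}{\sinh p}(1-K_t)\,\frac{p'}{\sinh p'}(1-K_t)};$$ (ii) if $31\pi/32\le\phi\le\pi$, then $$i^t(g,g')\le\frac{\frac{|\operatorname{arcosh}(x)-i\pi|^2}{|x^2-1|}e^{-\frac{\Delta^2+\tilde\theta^2+2\delta^2}{t}}(1+K''_t)}{\frac{p}{\sinh p}(1-K_t)\,\frac{p'}{\sinh p'}(1-K_t)}.$$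
   Context: $\tau_j=-i\sigma_j$ with $\sigma_j$ the Pauli matrices; $\mu_H$ is the normalized Haar measure on $SU(2)$; the inner product is antilinear in the first argument; $\chi_j$ is the character of the spin-$j$ irreducible representation of dimension $2j+1$, extended holomorphically to $SL(2,\mathbb C)$. Polar decomposition $g=Hu$ means $H$ positive definite Hermitian (of determinant 1) on the left and $u\in SU(2)$ on the right. For every complex $x$ the pair $(s,\phi)$ exists; $\phi$ and $|s|$ are unique, and only when $x$ is real with $|x|>1$ is the sign of $s$ ambiguous, in which case one takes $s>0$. If $\tilde p=0$ or $\tilde\theta=0$ the angle $\tilde\alpha$ is arbitrary. $p/\sinh p:=1$ at $p=0$, and at $x=\pm1$ the expressions are understood by continuous extension in $x$. "Decaying exponentially fast to $0$ as $t\to0$" means: there are $C,c,t_0>0$ with $0<K_t\le Ce^{-c/t}$ for $0<t<t_0$. *)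

theory Defs
  imports "HOL-Analysis.Analysis" "HOL-Computational_Algebra.Polynomial"
begin

type_synonym cmat2 = "complex^2^2"

definition cadjoint :: "cmat2 \<Rightarrow> cmat2" where
  "cadjoint A = (\<chi> i j. cnj (A $ j $ i))"

definition SL2C :: "cmat2 set" where
  "SL2C = {g. det g = 1}"

definition SU2 :: "cmat2 set" where
  "SU2 = {u. cadjoint u ** u = mat 1 \<and> det u = 1}"

definition pos_def_hermitian :: "cmat2 \<Rightarrow> bool" where
  "pos_def_hermitian H \<longleftrightarrow>
     cadjoint H = H \<and> (\<forall>v. v \<noteq> 0 \<longrightarrow> 0 < Re (\<Sum>i\<in>UNIV. cnj (v $ i) * (H *v v) $ i))"

definition polar_decomposition :: "cmat2 \<Rightarrow> cmat2 \<Rightarrow> cmat2 \<Rightarrow> bool" where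
  "polar_decomposition g H u \<longleftrightarrow>
     pos_def_hermitian H \<and> det H = 1 \<and> u \<in> SU2 \<and> g = H ** u"

text \<open>Multiplication \<open>*\<close> on the type \<open>complex^2^2\<close> is componentwise, so the library function
  \<open>exp\<close> is not the matrix exponential.\<close>

definition mexp :: "cmat2 \<Rightarrow> cmat2" where
  "mexp A = (\<Sum>n. (1 / fact n) *\<^sub>R ((**) A ^^ n) (mat 1))"

definition cscale :: "complex \<Rightarrow> cmat2 \<Rightarrow> cmat2" where
  "cscale c A = map_matrix (\<lambda>z. c * z) A"

definition pauli :: "3 \<Rightarrow> cmat2" where
  "pauli j =
     (if j = 1 then vector [vector [0, 1], vector [1, 0]]
      else if j = 2 then vector [vector [0, - \<i>], vector [\<i>, 0]]
      else vector [vector [1, 0], vector [0, - 1]])"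

definition tau :: "3 \<Rightarrow> cmat2" where
  "tau j = cscale (- \<i>) (pauli j)"

definition tau_sum :: "real^3 \<Rightarrow> cmat2" where
  "tau_sum v = (\<Sum>j\<in>UNIV. (v $ j) *\<^sub>R tau j)"

text \<open>The measurable space is the Borel space of \<open>SU2\<close> with its subspace topology. Left invariance
  and total mass one determine the measure uniquely.\<close>

definition normalized_haar_SU2 :: "cmat2 measure \<Rightarrow> bool" where
  "normalized_haar_SU2 \<mu> \<longleftrightarrow>
     sets \<mu> = sets (restrict_space borel SU2) \<and> emeasure \<mu> SU2 = 1 \<and>
     (\<forall>u\<in>SU2. distr \<mu> \<mu> (\<lambda>h. u ** h) = \<mu>)"

text \<open>The representation of spin \<open>j = n/2\<close>: the group acts on the homogeneous polynomials
  \<open>q\<close> of degree \<open>n\<close> in \<open>(z, w)\<close> by \<open>(g q)(z, w) = q ((z, w) g)\<close>, where \<open>(z, w)\<close> is a row vector.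
  With respect to the basis \<open>z\<^sup>k w\<^sup>n\<^sup>-\<^sup>k\<close>, \<open>k \<le> n\<close>, column \<open>k\<close> of the matrix of \<open>g\<close> consists of
  the coefficients of \<open>(g\<^sub>1\<^sub>1 z + g\<^sub>2\<^sub>1 w)\<^sup>k (g\<^sub>1\<^sub>2 z + g\<^sub>2\<^sub>2 w)\<^sup>n\<^sup>-\<^sup>k\<close>, written below with \<open>w = 1\<close>.
  They are polynomials in the entries of \<open>g\<close>, so the formula is at the same time the
  holomorphic extension from \<open>SU2\<close> to \<open>SL2C\<close>.\<close>

definition spin_rep :: "nat \<Rightarrow> cmat2 \<Rightarrow> nat \<Rightarrow> nat \<Rightarrow> complex" where
  "spin_rep n g m k =
     coeff ([:g $ 2 $ 1, g $ 1 $ 1:] ^ k * [:g $ 2 $ 2, g $ 1 $ 2:] ^ (n - k)) m"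

definition spin_char :: "nat \<Rightarrow> cmat2 \<Rightarrow> complex" where
  "spin_char n g = (\<Sum>k\<le>n. spin_rep n g k k)"

text \<open>The sum over \<open>j = 0, 1/2, 1, \<dots>\<close> is indexed by \<open>n = 2 j\<close>.\<close>

definition coherent_state :: "real \<Rightarrow> cmat2 \<Rightarrow> cmat2 \<Rightarrow> complex" where
  "coherent_state t g h =
     (\<Sum>n. let j = real n / 2 in
        of_real ((2 * j + 1) * exp (- (t / 2) * j * (j + 1))) * spin_char n (g ** matrix_inv h))"

definition L2_inner :: "cmat2 measure \<Rightarrow> (cmat2 \<Rightarrow> complex) \<Rightarrow> (cmat2 \<Rightarrow> complex) \<Rightarrow> complex" where
  "L2_inner \<mu> f f' = (LINT h|\<mu>. cnj (f h) * f' h)"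

definition L2_norm :: "cmat2 measure \<Rightarrow> (cmat2 \<Rightarrow> complex) \<Rightarrow> real" where
  "L2_norm \<mu> f = sqrt (LINT h|\<mu>. (cmod (f h))\<^sup>2)"

definition overlap :: "cmat2 measure \<Rightarrow> real \<Rightarrow> cmat2 \<Rightarrow> cmat2 \<Rightarrow> real" where
  "overlap \<mu> t g g' =
     (cmod (L2_inner \<mu> (coherent_state t g) (coherent_state t g')))\<^sup>2 /
     ((L2_norm \<mu> (coherent_state t g))\<^sup>2 * (L2_norm \<mu> (coherent_state t g'))\<^sup>2)"

text \<open>The branch of the inverse hyperbolic cosine with values \<open>s + \<i> \<phi>\<close>, \<open>0 \<le> \<phi> \<le> \<pi>\<close>; it differs
  from the library function \<open>arcosh\<close>. The sign of \<open>s\<close> is a matter of choice only for real \<open>x\<close> with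
  \<open>\<bar>x\<bar> > 1\<close>.\<close>

definition is_arcosh :: "complex \<Rightarrow> complex \<Rightarrow> bool" where
  "is_arcosh x w \<longleftrightarrow> cosh w = x \<and> 0 \<le> Im w \<and> Im w \<le> pi \<and>
     (x \<in> \<real> \<and> 1 < \<bar>Re x\<bar> \<longrightarrow> 0 < Re w)"

lemma ex1_is_arcosh: "\<exists>!w. is_arcosh x w"
proof -
  define a where "a = Arccos x"
  have cosa: "cos a = x" by (simp add: a_def)
  have a_range: "(0 < Re a \<and> Re a < pi) \<or> (Re a = 0 \<and> 0 \<le> Im a) \<or> (Re a = pi \<and> Im a \<le> 0)"
    (is "?range a")
  proof -
    define b0 where "b0 = (if Re a < 0 then - a else a)"
    define b where "b = (if Re b0 = 0 \<and> Im b0 < 0 then - b0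
      else if Re b0 = pi \<and> 0 < Im b0 then 2 * of_real pi - b0 else b0)"
    have cosb0: "cos b0 = x" using cosa by (simp add: b0_def)
    have "0 \<le> Re b0" "Re b0 \<le> pi"
      using Re_Arccos_bounds[of x] by (auto simp: a_def b0_def)
    then have "?range b" by (auto simp: b_def)
    moreover have "cos b = x" using cosb0 by (auto simp: b_def cos_diff)
    ultimately have "Arccos x = b" by (intro Arccos_unique)
    with \<open>?range b\<close> show ?thesis by (simp add: a_def)
  qed
  define w where "w = (if Re a = 0 then - \<i> * a else \<i> * a)"
  have reim: "is_arcosh x v \<longleftrightarrow> v = w" for v
  proof
    assume v: "is_arcosh x v"
    have c: "cosh v = cos (\<i> * v)" "cosh v = cos (- (\<i> * v))"
      unfolding cos_minus by (rule cosh_conv_cos)+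
    have s_nonneg: "0 \<le> Re v" if "Im v = 0 \<or> Im v = pi"
    proof (rule ccontr)
      assume "\<not> 0 \<le> Re v"
      then have neg: "Re v < 0" by simp
      have sin0: "sin (Im v) = 0" and abscos: "\<bar>cos (Im v)\<bar> = 1"
        using that by auto
      have x_eq: "x = cos (\<i> * v)" using v c by (simp add: is_arcosh_def)
      have im: "Im x = 0" unfolding x_eq using sin0 by (simp add: Im_cos)
      have re: "Re x = cos (Im v) * cosh (Re v)"
        unfolding x_eq by (simp add: Re_cos cosh_def exp_minus)
      have "1 < cosh (Re v)"
        using cosh_real_ge_1[of "Re v"] cosh_real_one_iff[of "Re v"] neg by linarith
      then have "1 < \<bar>Re x\<bar>" unfolding re abs_mult abscos by simp
      then have "0 < Re v" using v im by (simp add: is_arcosh_def complex_is_Real_iff)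
      with neg show False by simp
    qed
    show "v = w"
    proof (cases "Im v = 0")
      case True
      have "Arccos x = \<i> * v"
        by (rule Arccos_unique) (use v c True s_nonneg in \<open>auto simp: is_arcosh_def\<close>)
      then show ?thesis using True by (simp add: w_def a_def)
    next
      case False
      have "Arccos x = - (\<i> * v)"
        by (rule Arccos_unique) (use v c False s_nonneg in \<open>auto simp: is_arcosh_def\<close>)
      then show ?thesis using False by (simp add: w_def a_def)
    qed
  next
    have cw: "cosh w = x"
      using cosa by (simp add: w_def cosh_conv_cos)
    have im: "0 \<le> Im w" "Im w \<le> pi" using a_range pi_ge_zero by (auto simp: w_def)
    have pos: "0 < Re w" if r: "x \<in> \<real>" "1 < \<bar>Re x\<bar>"
    proof -
      have "Im x = 0" using r by (simp add: complex_is_Real_iff)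
      then have im0: "sin (Re a) * (exp (Im a) - exp (- Im a)) = 0"
        unfolding cosa[symmetric] by (simp add: Im_cos)
      have "Im a \<noteq> 0"
      proof
        assume "Im a = 0"
        then have "Re x = cos (Re a)" unfolding cosa[symmetric] by (simp add: Re_cos)
        then show False using r(2) abs_cos_le_one[of "Re a"] by simp
      qed
      then have "sin (Re a) = 0" using im0 by auto
      then have "\<not> (0 < Re a \<and> Re a < pi)" using sin_gt_zero by force
      then show ?thesis using a_range \<open>Im a \<noteq> 0\<close> by (auto simp: w_def)
    qed
    show "is_arcosh x v" if "v = w"
      using cw im pos that by (simp add: is_arcosh_def)
  qed
  show ?thesis by (simp add: reim)
qed

definition arcosh_br :: "complex \<Rightarrow> complex" where
  "arcosh_br x = (THE w. is_arcosh x w)"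

text \<open>Continuous extension of \<open>f\<close> to the zeros of \<open>x\<^sup>2 - 1\<close>.\<close>

definition ext_pm1 :: "(complex \<Rightarrow> real) \<Rightarrow> complex \<Rightarrow> real" where
  "ext_pm1 f x = (if x = 1 \<or> x = - 1 then Lim (at x) f else f x)"

definition x_over_sinh :: "real \<Rightarrow> real" where
  "x_over_sinh p = (if p = 0 then 1 else p / sinh p)"

definition exp_decaying :: "(real \<Rightarrow> real) \<Rightarrow> bool" where
  "exp_decaying K \<longleftrightarrow> (\<forall>t>0. 0 < K t) \<and>
     (\<exists>C>0. \<exists>c>0. \<exists>t0>0. \<forall>t. 0 < t \<and> t < t0 \<longrightarrow> K t \<le> C * exp (- c / t))"

end

theory Submission
  imports Defs "HOL-Complex_Analysis.Complex_Analysis"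
begin

text \<open>By Schur orthogonality \<open>\<langle>\<psi>\<^sub>g, \<psi>\<^sub>g\<^sub>'\<rangle>\<close> is the series
  \<open>\<Sum>N\<ge>1. N exp (- t (N\<^sup>2 - 1) / 4) sinh (N z) / sinh z\<close>, where \<open>2 cosh z\<close> is the trace of \<open>g\<^sup>* g'\<close>; the
  polar decompositions show that \<open>cosh z\<close> is the complex conjugate of \<open>x\<close>, and that \<open>z = p\<close> when
  \<open>g' = g\<close>. The series is a multiple of the derivative of a theta function divided by \<open>sinh z\<close>, and the
  theta transformation turns it into a multiple of
  \<open>\<Sum>k. (z + 2 \<pi> \<i> k) exp ((z + 2 \<pi> \<i> k)\<^sup>2 / t) / sinh z\<close>. The constant factor depends on \<open>t\<close> only and
  cancels in the overlap, so only proportionality of the two theta functions is needed: both are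
  even, have period \<open>2 \<pi> \<i>\<close> and pick up the same factor under \<open>z \<mapsto> z + t / 2\<close>, and such a function
  is unique up to a scalar.

  If \<open>\<phi> \<le> 31 \<pi> / 32\<close>, the term \<open>k = 0\<close> dominates. Pairing \<open>k\<close> with \<open>- k\<close> extracts the factor \<open>z\<close>, which
  makes the estimate of the remainder uniform near \<open>z = 0\<close>. If \<open>\<phi> \<ge> 31 \<pi> / 32\<close>, the terms \<open>k\<close> and \<open>- 1 - k\<close> are
  paired, which extracts \<open>z - \<i> \<pi>\<close>; the leading pair is not small, but then
  \<open>\<theta> \<ge> \<pi> / 2\<close>, and the factor \<open>exp (\<theta>\<^sup>2 / t)\<close> in the bound of case (ii) compensates for it.\<close>

(* Otherwise the component notation for matrices is ambiguous with that for power series. *)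
no_notation fps_nth (infixl "$" 75)

section \<open>Uniqueness of theta functions\<close>

text \<open>Uniqueness of the theta functions holds because evenness and the two translation laws
  force a zero at \<open>t / 4 + \<i> * pi\<close>, hence at all its lattice translates, and
  Jacobi's product vanishes simply there and nowhere else in its strip; the quotient is then
  holomorphic and doubly periodic. The number 31/32 is tied to the remainder of the dual series.
  Relative to the leading term, the pair \<open>k\<close>, \<open>- k\<close> has exponent
  \<open>- (4 pi^2 k^2 - 4 pi k |Im z|) / t\<close>, and \<open>|Im z| <= 31 pi / 32\<close> leaves
  at least \<open>pi^2 k^2 / 8 > k^2\<close> in the bracket. The remainders thus decay like
  \<open>exp (- k^2 / t)\<close> up to a polynomial factor; half of the exponent absorbs that
  factor, and the other half is the \<open>1 / (2 t)\<close> in \<open>decay\<close>. Forcing the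
  same shape on the series beyond \<open>31 pi / 32\<close> costs a factor
  \<open>exp (1 / t)\<close>, which becomes \<open>exp (2 / t)\<close> in the squared inner product.
  On the group side, the monomial basis of the representations is orthogonal but not orthonormal, so
  elements of SU(2) do not act by unitary matrices in it. Matrix entries at the inverse
  \<open>cadjoint h\<close> therefore take the place of conjugated entries, and the characters of
  adjoints are compared through eigenvalues.\<close>

definition quot :: "(complex \<Rightarrow> complex) \<Rightarrow> (complex \<Rightarrow> complex) \<Rightarrow> complex \<Rightarrow> complex" where
  "quot f g z = (if g z = 0 then deriv f z / deriv g z else f z / g z)"

text \<open>At a zero \<open>a\<close> of \<open>g\<close> both functions are divided by
  \<open>z - a\<close>. The divided denominator is nonzero at \<open>a\<close> because the zero is
  simple, and the new quotient agrees with \<open>quot f g\<close> nearby, also at \<open>a\<close>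
  itself, where both are the ratio of the derivatives.\<close>

lemma quot_holomorphic:
  assumes S: "open S" and f: "f holomorphic_on S" and g: "g holomorphic_on S"
    and z: "\<And>z. z \<in> S \<Longrightarrow> g z = 0 \<Longrightarrow> f z = 0 \<and> deriv g z \<noteq> 0"
  shows "quot f g holomorphic_on S"
proof -
  have "quot f g field_differentiable (at a)" if a: "a \<in> S" for a
  proof (cases "g a = 0")
    case False
    have cont: "continuous_on S g" using g holomorphic_on_imp_continuous_on by blast
    define T where "T = S \<inter> g -` (- {0})"
    have T: "open T" unfolding T_def using cont S by (intro continuous_open_preimage) auto
    have aT: "a \<in> T" using a False by (simp add: T_def)
    have "(\<lambda>z. f z / g z) holomorphic_on T"
      by (intro holomorphic_on_divide holomorphic_on_subset[OF f] holomorphic_on_subset[OF g]) (auto simp: T_def)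
    then have "(\<lambda>z. f z / g z) field_differentiable at a"
      using T aT holomorphic_on_imp_differentiable_at by blast
    then show ?thesis
      unfolding field_differentiable_def
      using has_field_derivative_transform_within_open[OF _ T aT, of "\<lambda>z. f z / g z" _ "quot f g"]
      by (auto simp: T_def quot_def)
  next
    case True
    define f1 where "f1 = (\<lambda>z. if z = a then deriv f a else (f z - f a) / (z - a))"
    define g1 where "g1 = (\<lambda>z. if z = a then deriv g a else (g z - g a) / (z - a))"
    have f1: "f1 holomorphic_on S" unfolding f1_def by (rule pole_lemma_open[OF f S])
    have g1: "g1 holomorphic_on S" unfolding g1_def by (rule pole_lemma_open[OF g S])
    define T where "T = S \<inter> g1 -` (- {0})"
    have "continuous_on S g1" using g1 holomorphic_on_imp_continuous_on by blast
    then have T: "open T" unfolding T_def using S by (intro continuous_open_preimage) auto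
    have aT: "a \<in> T" using a z[OF a True] by (simp add: T_def g1_def)
    have "(\<lambda>z. f1 z / g1 z) holomorphic_on T"
      by (intro holomorphic_on_divide holomorphic_on_subset[OF f1] holomorphic_on_subset[OF g1]) (auto simp: T_def)
    then have d: "(\<lambda>z. f1 z / g1 z) field_differentiable at a"
      using T aT holomorphic_on_imp_differentiable_at by blast
    have "f1 w / g1 w = quot f g w" if w: "w \<in> T" for w
    proof (cases "w = a")
      case True then show ?thesis using \<open>g a = 0\<close> by (simp add: f1_def g1_def quot_def)
    next
      case False
      then have "g w \<noteq> 0" using w \<open>g a = 0\<close> by (auto simp: T_def g1_def)
      then show ?thesis using False z[OF a True] \<open>g a = 0\<close> by (simp add: f1_def g1_def quot_def)
    qed
    then show ?thesis using d unfolding field_differentiable_def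
      using has_field_derivative_transform_within_open[OF _ T aT, of "\<lambda>z. f1 z / g1 z" _ "quot f g"]
      by auto
  qed
  then show ?thesis by (simp add: field_differentiable_at_within holomorphic_on_def)
qed

text \<open>At a zero the product rule leaves only \<open>m z * deriv f z\<close>. Numerator and
  denominator of \<open>quot\<close> thus acquire the same factor at a common zero. The relation is
  local in \<open>w\<close> because \<open>jacobi\<close> is controlled only in a strip.\<close>

lemma deriv_shift_multiplier:
  assumes U: "open U" "z \<in> U"
    and f: "f field_differentiable at z" "f field_differentiable at (z + c)"
    and m: "m field_differentiable at z" and z: "f z = 0"
    and eq: "\<And>w. w \<in> U \<Longrightarrow> f (w + c) = m w * f w"
  shows "deriv f (z + c) = m z * deriv f z"
proof -
  have "((\<lambda>w. f (w + c)) has_field_derivative deriv f (z + c)) (at z)"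
    using f(2) field_differentiable_derivI DERIV_shift by blast
  moreover have "((\<lambda>w. m w * f w) has_field_derivative (m z * deriv f z + deriv m z * f z)) (at z)"
    using f(1) m by (intro DERIV_mult' field_differentiable_derivI)
  then have "((\<lambda>w. f (w + c)) has_field_derivative (m z * deriv f z + deriv m z * f z)) (at z)"
    using U eq by (rule_tac has_field_derivative_transform_within_open[of "\<lambda>w. m w * f w" _ _ U]) auto
  ultimately show ?thesis using z DERIV_unique by fastforce
qed

lemma quot_shift:
  assumes U: "open U" "z \<in> U"
    and f: "f field_differentiable at z" "f field_differentiable at (z + c)"
    and g: "g field_differentiable at z" "g field_differentiable at (z + c)"
    and m: "m field_differentiable at z" "m z \<noteq> 0"
    and z: "g z = 0 \<Longrightarrow> f z = 0"
    and eqf: "\<And>w. w \<in> U \<Longrightarrow> f (w + c) = m w * f w"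
    and eqg: "\<And>w. w \<in> U \<Longrightarrow> g (w + c) = m w * g w"
  shows "quot f g (z + c) = quot f g z"
proof (cases "g z = 0")
  case True
  then show ?thesis
    using deriv_shift_multiplier[where f = f and m = m and U = U and z = z and c = c, OF U f m(1) z[OF True]]
      deriv_shift_multiplier[where f = g and m = m and U = U and z = z and c = c, OF U g m(1) True]
      eqf eqg eqg[OF U(2)] m(2)
    by (simp add: quot_def)
next
  case False
  then show ?thesis using eqf[OF U(2)] eqg[OF U(2)] m(2) by (simp add: quot_def)
qed

text \<open>The laws of \<open>\<Sum>n. exp (- (t / 4) * n^2 + n * z)\<close>: adding
  \<open>t / 2\<close> to \<open>z\<close> and replacing \<open>n\<close> by \<open>n + 1\<close>
  completes the square up to the factor \<open>exp (z + t / 4)\<close>. For the lattice spanned by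
  \<open>t / 2\<close> and \<open>2 * pi * \<i>\<close> this is a multiplier of degree one, hence
  one zero per period cell.\<close>

definition theta_like :: "real \<Rightarrow> (complex \<Rightarrow> complex) \<Rightarrow> bool" where
  "theta_like t f \<longleftrightarrow> f holomorphic_on UNIV \<and> (\<forall>z. f (- z) = f z) \<and>
     (\<forall>z. f (z + 2 * of_real pi * \<i>) = f z) \<and>
     (\<forall>z. f (z + of_real (t / 2)) = exp (z + of_real (t / 4)) * f z)"

lemma theta_like_period_int:
  assumes "theta_like t f"
  shows "f (z + of_int (2 * n) * of_real pi * \<i>) = f z"
proof -
  have p: "f (z + 2 * of_real pi * \<i>) = f z" for z using assms by (simp add: theta_like_def)
  show ?thesis
  proof (induction n rule: int_induct[of _ 0])
    case base then show ?case by simp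
  next
    case (step1 i)
    then show ?case using p[of "z + of_int (2 * i) * of_real pi * \<i>"] by (simp add: algebra_simps)
  next
    case (step2 i)
    then show ?case using p[of "z + of_int (2 * (i - 1)) * of_real pi * \<i>"] by (simp add: algebra_simps)
  qed
qed

text \<open>The points concerned are \<open>t / 4 + \<i> * pi\<close> modulo
  \<open>2 * pi * \<i>\<close>. There \<open>t / 2 - z\<close> and \<open>z\<close> differ by a
  period, so evenness gives \<open>f (z - t / 2) = f z\<close>, whereas the multiplier of the shift
  by \<open>t / 2\<close> equals -1.\<close>

lemma theta_like_zero:
  assumes f: "theta_like t f" and z: "1 + exp (z - of_real (t / 4)) = 0"
  shows "f z = 0"
proof -
  have ez: "exp z = - exp (of_real (t / 4))"
    using z unfolding exp_diff add_eq_0_iff by (simp add: divide_eq_eq)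
  have "exp (of_real (t / 2) - z) = exp (of_real (t/4)) * exp (of_real (t / 4)) / exp z"
    by (simp add: exp_diff exp_add[symmetric] field_simps)
  also have "\<dots> = exp z" by (simp add: ez)
  finally obtain n :: int where n: "of_real (t / 2) - z = z + (of_int (2 * n) * pi) * \<i>"
    unfolding exp_eq by blast
  have "f (z - of_real (t / 2)) = f (of_real (t / 2) - z)"
    using f unfolding theta_like_def by (metis minus_diff_eq)
  also have "\<dots> = f z" unfolding n using theta_like_period_int[OF f, of z n] by (simp del: of_int_mult)
  finally have e: "f (z - of_real (t / 2)) = f z" .
  have "f (z - of_real (t/2) + of_real (t / 2)) = exp (z - of_real (t/2) + of_real (t / 4)) * f (z - of_real (t/2))"
    using f unfolding theta_like_def by blast
  moreover have "exp (z - of_real (t/2) + of_real (t / 4)) = exp (z - of_real (t / 4))"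
    by (rule arg_cong[of _ _ exp]) (simp add: field_simps)
  moreover have "exp (z - of_real (t / 4)) = -1" using z by (simp add: add_eq_0_iff)
  ultimately have "f z = - f z" using e by simp
  then show ?thesis by simp
qed

text \<open>\<open>jacobi t\<close> is the product of the factors \<open>1 + exp (- t / 4 - n t / 2 \<plusminus> z)\<close>, \<open>n \<ge> 0\<close>, of Jacobi's
  triple product. The factors with \<open>n \<ge> 1\<close> have no zeros for \<open>\<bar>Re z\<bar> < 3 t / 4\<close>; there the sum of their
  logarithms, expanded in powers of \<open>exp (\<plusminus> z)\<close> and summed over \<open>n\<close> first, is \<open>jacobi_log t\<close>. The
  strip is wider than a period cell, so that a doubly periodic holomorphic function on it attains its
  maximum modulus in the interior.\<close>

definition jacobi_term :: "real \<Rightarrow> nat \<Rightarrow> complex \<Rightarrow> complex" where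
  "jacobi_term t m z = - ((-1) ^ m) * of_real (exp (- (m * t / 2)) / (m * sinh (m * t / 4))) * cosh (of_nat m * z)"

definition jacobi_log :: "real \<Rightarrow> complex \<Rightarrow> complex" where
  "jacobi_log t z = (\<Sum>m. jacobi_term t m z)"

definition jacobi :: "real \<Rightarrow> complex \<Rightarrow> complex" where
  "jacobi t z = (1 + exp (z - of_real (t / 4))) * (1 + exp (- z - of_real (t / 4))) * exp (jacobi_log t z)"

definition jacobi_strip :: "real \<Rightarrow> complex set" where
  "jacobi_strip t = {z. \<bar>Re z\<bar> < 3 * t / 4}"

lemma open_jacobi_strip: "open (jacobi_strip t)"
  unfolding jacobi_strip_def by (intro open_Collect_less continuous_intros)

lemma norm_cosh_le: "norm (cosh z) \<le> exp \<bar>Re z\<bar>" for z :: complex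
proof -
  have "norm (cosh z) \<le> (norm (exp z) + norm (exp (- z))) / 2"
    using norm_triangle_ineq[of "exp z" "exp (- z)"] unfolding cosh_def by (simp add: norm_divide)
  also have "\<dots> \<le> exp \<bar>Re z\<bar>"
    by (simp add: abs_if)
  finally show ?thesis .
qed

text \<open>The explicit exponential contributes \<open>exp (- m * t / 2)\<close> and the hyperbolic
  sine another \<open>exp (- m * t / 4)\<close>; together they beat \<open>cosh (m * z)\<close> for
  \<open>\<bar>Re z\<bar> < 3 * t / 4\<close>, which is the origin of the strip.\<close>

lemma norm_jacobi_term_le:
  assumes t: "t > 0" and r: "\<bar>Re z\<bar> \<le> r"
  shows "norm (jacobi_term t m z) \<le> 2 / (1 - exp (- t / 2)) * exp (r - 3 * t / 4) ^ m"
proof (cases "m = 0")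
  case True then show ?thesis using t by (simp add: jacobi_term_def)
next
  case False
  then have m: "real m \<ge> 1" by simp
  have e1: "exp (- t / 2) < 1" using t by simp
  define y where "y = m * t / 4"
  have "exp (- y) = exp y * exp (- (2 * y))" by (simp add: exp_add[symmetric])
  also have "\<dots> \<le> exp y * exp (- t / 2)" using m t by (intro mult_left_mono) (auto simp: y_def)
  finally have sh: "sinh y \<ge> exp y * (1 - exp (- t / 2)) / 2"
    by (simp add: sinh_def field_simps)
  have pos: "0 < exp y * (1 - exp (- t / 2)) / 2" using e1 by simp
  have sh': "m * sinh y \<ge> exp y * (1 - exp (- t / 2)) / 2"
    using mult_mono[OF m sh] pos sh m by auto
  have "norm (jacobi_term t m z) = exp (- (m * t / 2)) / (m * sinh y) * norm (cosh (of_nat m * z))"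
  proof -
    have "sinh y \<ge> 0" using sh pos by linarith
    then show ?thesis unfolding jacobi_term_def y_def[symmetric]
      by (simp add: norm_mult norm_power abs_mult norm_divide)
  qed
  also have "\<dots> \<le> exp (- (m * t / 2)) / (exp y * (1 - exp (- t / 2)) / 2) * exp (m * r)"
  proof (intro mult_mono divide_left_mono)
    show "norm (cosh (of_nat m * z)) \<le> exp (m * r)"
      by (rule order.trans[OF norm_cosh_le]) (use r in \<open>simp add: abs_mult mult_left_mono\<close>)
    show "0 < m * sinh y * (exp y * (1 - exp (- t / 2)) / 2)"
      using order.strict_trans2[OF pos sh'] pos by (rule mult_pos_pos)
  qed (use sh' pos e1 in auto)
  also have "\<dots> = 2 / (1 - exp (- t / 2)) * (exp (- (m * t / 2)) / exp y * exp (m * r))"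
    by (simp add: mult.commute mult.assoc mult.left_commute)
  also have "exp (- (m * t / 2)) / exp y * exp (m * r) = exp (- (m * t / 2) - y + m * r)"
    by (simp only: exp_add exp_diff)
  also have "- (m * t / 2) - y + m * r = m * (r - 3 * t / 4)" by (simp add: y_def field_simps)
  finally show ?thesis by (simp add: exp_of_nat_mult)
qed

lemma summable_jacobi_bound:
  fixes t r :: real
  assumes t: "t > 0" and r: "r < 3 * t / 4"
  shows "summable (\<lambda>m. 2 / (1 - exp (- t / 2)) * exp (r - 3 * t / 4) ^ m)"
  using r by (intro summable_mult summable_geometric) auto

lemma summable_jacobi_term: "t > 0 \<Longrightarrow> z \<in> jacobi_strip t \<Longrightarrow> summable (\<lambda>m. jacobi_term t m z)"
  by (rule summable_comparison_test'[OF summable_jacobi_bound[of t "\<bar>Re z\<bar>"], of 0])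
     (use norm_jacobi_term_le in \<open>auto simp: jacobi_strip_def simp del: times_divide_eq_left\<close>)

lemma jacobi_log_holomorphic:
  assumes t: "t > 0"
  shows "jacobi_log t holomorphic_on jacobi_strip t"
proof -
  have "\<exists>g g'. \<forall>x\<in>jacobi_strip t. ((\<lambda>n. jacobi_term t n x) sums g x) \<and> ((\<lambda>n. deriv (jacobi_term t n) x) sums g' x)
      \<and> (g has_field_derivative g' x) (at x)"
  proof (rule series_and_derivative_comparison_complex)
    show "open (jacobi_strip t)" by (rule open_jacobi_strip)
    show "(jacobi_term t n has_field_derivative deriv (jacobi_term t n) x) (at x)" for n x
    proof (rule field_differentiable_derivI)
      have "jacobi_term t n holomorphic_on UNIV"
        unfolding jacobi_term_def[abs_def] cosh_field_def by (intro holomorphic_intros) auto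
      then show "jacobi_term t n field_differentiable at x"
        using holomorphic_on_imp_differentiable_at by blast
    qed
    fix x assume x: "x \<in> jacobi_strip t"
    define d where "d = (3 * t / 4 - \<bar>Re x\<bar>) / 2"
    have d: "d > 0" "\<bar>Re x\<bar> + d < 3 * t / 4" using x by (auto simp: d_def jacobi_strip_def field_simps)
    let ?h = "\<lambda>m. 2 / (1 - exp (- t / 2)) * exp (\<bar>Re x\<bar> + d - 3 * t / 4) ^ m"
    have hpos: "?h m \<ge> 0" for m using t by simp
    have "norm (jacobi_term t n y) \<le> ?h n" if "y \<in> ball x d" for n y
    proof (rule norm_jacobi_term_le[OF t])
      have "\<bar>Re (y - x)\<bar> \<le> norm (y - x)" by (rule abs_Re_le_cmod)
      then show "\<bar>Re y\<bar> \<le> \<bar>Re x\<bar> + d" using that by (auto simp: dist_norm norm_minus_commute)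
    qed
    then have 1: "\<forall>y\<in>ball x d \<inter> jacobi_strip t. norm (jacobi_term t n y) \<le> norm (complex_of_real (?h n))" for n
      using hpos[of n] by (simp only: norm_of_real abs_of_nonneg) blast
    have 2: "range (\<lambda>m. complex_of_real (?h m)) \<subseteq> \<real>\<^sub>\<ge>\<^sub>0"
      using hpos by (simp only: image_subset_iff nonneg_Reals_of_real_iff) blast
    show "\<exists>d (h :: nat \<Rightarrow> complex). 0 < d \<and> summable h \<and> range h \<subseteq> \<real>\<^sub>\<ge>\<^sub>0 \<and>
        (\<forall>\<^sub>F n in sequentially. \<forall>y\<in>ball x d \<inter> jacobi_strip t. norm (jacobi_term t n y) \<le> norm (h n))"
    proof (intro exI conjI)
      show "0 < d" by (rule d(1))
      show "summable (\<lambda>m. complex_of_real (?h m))" by (intro summable_of_real summable_jacobi_bound t d(2))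
      show "range (\<lambda>m. complex_of_real (?h m)) \<subseteq> \<real>\<^sub>\<ge>\<^sub>0" by (rule 2)
      show "\<forall>\<^sub>F n in sequentially. \<forall>y\<in>ball x d \<inter> jacobi_strip t. norm (jacobi_term t n y) \<le> norm (complex_of_real (?h n))"
        by (intro always_eventually allI 1)
    qed
  qed
  then obtain g g' where g: "\<And>x. x \<in> jacobi_strip t \<Longrightarrow> (\<lambda>n. jacobi_term t n x) sums g x \<and> (g has_field_derivative g' x) (at x)"
    by metis
  have "g holomorphic_on jacobi_strip t"
    using g open_jacobi_strip by (auto simp: holomorphic_on_open)
  then show ?thesis
    by (rule holomorphic_transform) (use g in \<open>auto simp: jacobi_log_def sums_iff\<close>)
qed

lemma jacobi_holomorphic: "t > 0 \<Longrightarrow> jacobi t holomorphic_on jacobi_strip t"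
  unfolding jacobi_def[abs_def] by (intro holomorphic_intros jacobi_log_holomorphic)

text \<open>The shift by \<open>t / 2\<close> moves the factors of the product by one index, so only
  two boundary factors remain. The hypotheses say that both points lie in the strip, and they make
  the logarithmic series of both factors converge; exponentiating removes the choice of
  branch.\<close>

lemma jacobi_log_shift:
  assumes t: "t > 0" and z: "- (3 * t / 4) < Re z" "Re z < t / 4"
  shows "exp (jacobi_log t (z + of_real (t / 2))) * (1 + exp (- z - of_real (3 * t / 4))) =
         exp (jacobi_log t z) * (1 + exp (z - of_real (t / 4)))"
proof -
  let ?a = "exp (z - of_real (t / 4))" and ?b = "exp (- z - of_real (3 * t / 4))"
  have "\<bar>Re z\<bar> < 3 * t / 4" "\<bar>Re z + t / 2\<bar> < 3 * t / 4" using z t by linarith+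
  then have zs: "z \<in> jacobi_strip t" "z + of_real (t / 2) \<in> jacobi_strip t" by (auto simp: jacobi_strip_def)
  have a: "norm ?a < 1" and b: "norm ?b < 1" using z by auto
  have an: "1 + ?a \<noteq> 0" "1 + ?b \<noteq> 0" using a b
    by (metis add_eq_0_iff norm_minus_cancel norm_one less_irrefl)+
  \<comment> \<open>With \<open>E = exp (m * z)\<close> and \<open>q = exp (m * t / 4)\<close>, the
    difference of the two hyperbolic cosines contains the factor \<open>q^2 - 1\<close>, which
    cancels against \<open>sinh (m * t / 4)\<close> and leaves coefficients of logarithmic
    series.\<close>
  have key: "jacobi_term t m (z + of_real (t / 2)) - jacobi_term t m z =
       - ((- ?a) ^ m) / of_nat m - (- ((- ?b) ^ m) / of_nat m)" for m
  proof (cases "m = 0")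
    case True then show ?thesis by (simp add: jacobi_term_def)
  next
    case False
    define E where "E = exp (of_nat m * z)"
    define q where "q = exp (m * t / 4)"
    have q: "q > 1" unfolding q_def using False t by simp
    have En: "E \<noteq> 0" by (simp add: E_def)
    have e1: "exp (of_nat m * (z + of_real (t / 2))) = E * of_real q ^ 2"
      by (simp add: E_def q_def exp_of_real[symmetric] exp_add[symmetric] power2_eq_square field_simps)
    have e2: "exp (- (m * t / 2)) = 1 / q ^ 2"
      by (simp add: q_def power2_eq_square exp_add[symmetric] exp_minus field_simps)
    define X Y where "X = exp z" and "Y = exp (complex_of_real (t / 4))"
    have XY: "?a = X / Y" "?b = 1 / (X * Y ^ 3)" "E = X ^ m" "of_real q = Y ^ m"
    proof -
      show "?a = X / Y" by (simp add: X_def Y_def exp_diff)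
      have "Y ^ 3 = exp (of_nat 3 * of_real (t / 4))" unfolding Y_def by (rule exp_of_nat_mult[symmetric])
      then have "Y ^ 3 = exp (of_real (3 * t / 4))" by simp
      then show "?b = 1 / (X * Y ^ 3)" unfolding X_def by (simp only: exp_diff exp_minus) (simp add: divide_simps)
      show "E = X ^ m" unfolding E_def X_def by (rule exp_of_nat_mult)
      show "of_real q = Y ^ m" unfolding Y_def exp_of_nat_mult[symmetric] q_def
        by (simp add: exp_of_real[symmetric])
    qed
    have e3: "?a ^ m = E / of_real q" unfolding XY by (rule power_divide)
    have e4: "?b ^ m = 1 / (E * of_real q ^ 3)" unfolding XY
      by (simp add: power_divide power_mult_distrib power_mult[symmetric] mult.commute)
    have e5: "sinh (m * t / 4) = (q - 1 / q) / 2"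
      by (simp add: q_def sinh_def exp_minus field_simps)
    have c1: "cosh (of_nat m * (z + of_real (t / 2))) = (E * of_real q ^ 2 + 1 / (E * of_real q ^ 2)) / 2"
      by (simp only: cosh_field_def exp_minus e1 inverse_eq_divide)
    have c2: "cosh (of_nat m * z) = (E + 1 / E) / 2"
      by (simp only: cosh_field_def exp_minus E_def inverse_eq_divide)
    have "q ^ 2 - 1 \<noteq> 0" using q by (simp add: power2_eq_1_iff)
    then have "complex_of_real (q ^ 2 - 1) \<noteq> 0" unfolding of_real_eq_0_iff .
    then have qn: "of_real q \<noteq> (0::complex)" "(of_real q)^2 - 1 \<noteq> (0::complex)"
      using q unfolding of_real_diff of_real_power of_real_1 by simp_all
    have mn: "of_nat m \<noteq> (0::complex)" using False by simp
    have "jacobi_term t m (z + of_real (t / 2)) - jacobi_term t m z =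
       - ((-1) ^ m) * (1 / of_real q ^ 2 / (of_nat m * ((of_real q - 1 / of_real q) / 2))) *
        ((E * of_real q ^ 2 + 1 / (E * of_real q ^ 2)) / 2 - (E + 1 / E) / 2)"
      unfolding jacobi_term_def c1 c2 e5 e2
      by (simp only: of_real_divide of_real_mult of_real_diff of_real_power of_real_1 of_real_of_nat_eq
            of_real_numeral right_diff_distrib mult.assoc)
    also have "\<dots> = - ((-1) ^ m) * (E / of_real q - 1 / (E * of_real q ^ 3)) / of_nat m"
    proof -
      define Q where "Q = complex_of_real q"
      have Q: "Q \<noteq> 0" "Q^2 - 1 \<noteq> 0" "Q * Q - 1 \<noteq> 0" "Q * Q \<noteq> 1" using qn by (auto simp: Q_def power2_eq_square)
      have "1 / Q ^ 2 / (of_nat m * ((Q - 1 / Q) / 2)) * ((E * Q ^ 2 + 1 / (E * Q ^ 2)) / 2 - (E + 1 / E) / 2)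
         = (E / Q - 1 / (E * Q ^ 3)) / of_nat m"
        using Q En mn by (simp add: divide_simps power2_eq_square power3_eq_cube) (simp add: algebra_simps)
      moreover have "a * b = c / d \<Longrightarrow> - s * a * b = - s * c / d" for a b c d s :: complex
        by (simp only: mult.assoc times_divide_eq_right[symmetric])
      ultimately show ?thesis unfolding Q_def by blast
    qed
    also have "\<dots> = - ((- ?a) ^ m) / of_nat m - (- ((- ?b) ^ m) / of_nat m)"
      unfolding power_minus[of ?a] power_minus[of ?b] e3 e4 by (simp add: diff_divide_distrib algebra_simps)
    finally show ?thesis .
  qed
  have "(\<lambda>m. jacobi_term t m (z + of_real (t / 2)) - jacobi_term t m z) sums (jacobi_log t (z + of_real (t / 2)) - jacobi_log t z)"
    unfolding jacobi_log_def using summable_jacobi_term[OF t] zs by (intro sums_diff summable_sums) auto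
  moreover have "(\<lambda>m. jacobi_term t m (z + of_real (t / 2)) - jacobi_term t m z) sums (ln (1 + ?a) - ln (1 + ?b))"
    unfolding key by (intro sums_diff Ln_series' a b)
  ultimately have "jacobi_log t (z + of_real (t / 2)) - jacobi_log t z = ln (1 + ?a) - ln (1 + ?b)"
    by (rule sums_unique2)
  then have "jacobi_log t (z + of_real (t / 2)) = jacobi_log t z + ln (1 + ?a) - ln (1 + ?b)" by (simp add: algebra_simps)
  then show ?thesis using an by (simp add: exp_add exp_diff)
qed


lemma jacobi_shift:
  assumes t: "t > 0" and z: "- (3 * t / 4) < Re z" "Re z < t / 4"
  shows "jacobi t (z + of_real (t / 2)) = exp (z + of_real (t / 4)) * jacobi t z"
proof -
  define a where "a = exp (z - of_real (t / 4))"
  define b where "b = exp (- z - of_real (3 * t / 4))"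
  define c where "c = exp (z + of_real (t / 4))"
  define d where "d = exp (- z - of_real (t / 4))"
  \<comment> \<open>Hence \<open>1 + c = c * (1 + d)\<close>: the new factor \<open>1 + c\<close>
    supplies both the multiplier and the old factor \<open>1 + d\<close>.\<close>
  have cd: "c * d = 1" by (simp add: c_def d_def exp_add[symmetric])
  have 1: "exp (z + of_real (t / 2) - of_real (t / 4)) = c" "exp (- (z + of_real (t / 2)) - of_real (t / 4)) = b"
    unfolding c_def b_def by (rule arg_cong[of _ _ exp]; simp add: field_simps)+
  show ?thesis
    unfolding jacobi_def 1 using jacobi_log_shift[OF assms] cd
    unfolding a_def[symmetric] b_def[symmetric] c_def[symmetric] d_def[symmetric] by algebra
qed

text \<open>A zero comes from one of the two explicit factors \<open>A\<close>, \<open>B\<close>,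
  each with a simple zero. They cannot vanish together, since
  \<open>(A - 1) * (B - 1) = exp (- t / 2)\<close> is not 1.\<close>

lemma jacobi_zero_deriv:
  assumes t: "t > 0" and z: "z \<in> jacobi_strip t" "jacobi t z = 0"
  shows "deriv (jacobi t) z \<noteq> 0"
proof -
  define A where "A = 1 + exp (z - of_real (t / 4))"
  define B where "B = 1 + exp (- z - of_real (t / 4))"
  have L: "(jacobi_log t has_field_derivative deriv (jacobi_log t) z) (at z)"
    using jacobi_log_holomorphic[OF t] open_jacobi_strip z(1) by (rule holomorphic_derivI)
  have "(jacobi t has_field_derivative
      ((A - 1) * B - A * (B - 1) + A * B * deriv (jacobi_log t) z) * exp (jacobi_log t z)) (at z)"
    unfolding jacobi_def[abs_def] A_def B_def
    by (rule derivative_eq_intros L refl | simp add: algebra_simps)+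
  then have d: "deriv (jacobi t) z = ((A - 1) * B - A * (B - 1) + A * B * deriv (jacobi_log t) z) * exp (jacobi_log t z)"
    by (rule DERIV_imp_deriv)
  have "(A - 1) * (B - 1) = exp (of_real (- (t / 2)))"
    unfolding A_def B_def add_diff_cancel_left' exp_add[symmetric] by (rule arg_cong[of _ _ exp]) simp
  then have AB: "(A - 1) * (B - 1) = of_real (exp (- (t / 2)))" unfolding exp_of_real .
  have ne: "complex_of_real (exp (- (t / 2))) \<noteq> 1" using t
    by (metis exp_eq_one_iff less_irrefl neg_0_equal_iff_equal half_gt_zero of_real_eq_1_iff)
  have "A * B = 0" using z(2) by (simp add: jacobi_def A_def B_def)
  then consider "A = 0" | "B = 0" by auto
  then show ?thesis
  proof cases
    case 1
    then have "B \<noteq> 0" using AB ne by auto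
    then show ?thesis using 1 by (simp add: d)
  next
    case 2
    then have "A \<noteq> 0" using AB ne by auto
    then show ?thesis using 2 by (simp add: d)
  qed
qed

lemma theta_like_jacobi_zero:
  assumes "theta_like t f" "jacobi t z = 0"
  shows "f z = 0"
proof -
  have "1 + exp (z - of_real (t / 4)) = 0 \<or> 1 + exp (- z - of_real (t / 4)) = 0"
    using assms(2) by (simp add: jacobi_def)
  then have "f z = 0 \<or> f (- z) = 0" using theta_like_zero[OF assms(1)] by blast
  then show ?thesis using assms(1) by (auto simp: theta_like_def)
qed

text \<open>\<open>jacobi\<close> serves as a fixed comparison function: its zeros are zeros of
  every \<open>f\<close>, so the quotient extends holomorphically and inherits trivial multipliers,
  and the maximum modulus principle applies.\<close>

lemma theta_like_eq_jacobi:
  assumes t: "t > 0" and f: "theta_like t f"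
  obtains c where "\<And>z. \<bar>Re z\<bar> < t / 2 \<Longrightarrow> f z = c * jacobi t z"
proof -
  define S where "S = jacobi_strip t"
  define Q where "Q = quot f (jacobi t)"
  have fd: "f field_differentiable at z" for z
    using f unfolding theta_like_def using holomorphic_on_imp_differentiable_at by blast
  have jd: "jacobi t field_differentiable at z" if "z \<in> S" for z
    using jacobi_holomorphic[OF t] open_jacobi_strip that unfolding S_def by (rule holomorphic_on_imp_differentiable_at)
  have Q: "Q holomorphic_on S"
    unfolding Q_def S_def
  proof (rule quot_holomorphic[OF open_jacobi_strip _ jacobi_holomorphic[OF t]])
    show "f holomorphic_on jacobi_strip t" using f unfolding theta_like_def using holomorphic_on_subset by blast
  qed (use theta_like_jacobi_zero[OF f] jacobi_zero_deriv[OF t] in auto)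
  have e: "exp (z + 2 * of_real pi * \<i> - w) = exp (z - w)" "exp (- (z + 2 * of_real pi * \<i>) - w) = exp (- z - w)" for z w
    by (simp_all add: exp_add exp_diff exp_minus)
  have Lper: "jacobi_log t (z + 2 * of_real pi * \<i>) = jacobi_log t z" for z
  proof -
    have "exp (of_nat m * (z + 2 * of_real pi * \<i>)) = exp (of_nat m * z)" for m
      by (simp add: exp_of_nat_mult exp_add)
    then have "jacobi_term t m (z + 2 * of_real pi * \<i>) = jacobi_term t m z" for m
      unfolding jacobi_term_def cosh_field_def exp_minus by simp
    then show ?thesis by (simp add: jacobi_log_def)
  qed
  have per: "Q (z + 2 * of_real pi * \<i>) = Q z" if z: "z \<in> S" for z
    unfolding Q_def
  proof (rule quot_shift[where m = "\<lambda>_. 1" and U = S])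
    show "open S" unfolding S_def by (rule open_jacobi_strip)
    show "jacobi t (w + 2 * of_real pi * \<i>) = 1 * jacobi t w" for w
      unfolding jacobi_def e Lper by simp
    show "f (w + 2 * of_real pi * \<i>) = 1 * f w" for w
      using f by (simp add: theta_like_def)
    show "jacobi t field_differentiable at (z + 2 * of_real pi * \<i>)" using z by (intro jd) (simp add: S_def jacobi_strip_def)
  qed (use z fd jd theta_like_jacobi_zero[OF f] in \<open>auto\<close>)
  have perk: "Q (z + of_int k * (2 * of_real pi * \<i>)) = Q z" if z: "z \<in> S" for z k
  proof (induction k rule: int_induct[of _ 0])
    case base then show ?case by simp
  next
    case (step1 i)
    then show ?case using per[of "z + of_int i * (2 * of_real pi * \<i>)"] z
      by (simp add: S_def jacobi_strip_def algebra_simps)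
  next
    case (step2 i)
    then show ?case using per[of "z + of_int (i - 1) * (2 * of_real pi * \<i>)"] z
      by (simp add: S_def jacobi_strip_def algebra_simps)
  qed
  have shift: "Q (z + of_real (t / 2)) = Q z" if z: "- (3 * t / 4) < Re z" "Re z < t / 4" for z
    unfolding Q_def
  proof (rule quot_shift[where m = "\<lambda>w. exp (w + of_real (t / 4))" and U = "{w. - (3 * t / 4) < Re w} \<inter> {w. Re w < t / 4}"])
    show "open ({w. - (3 * t / 4) < Re w} \<inter> {w. Re w < t / 4})"
      by (intro open_Int open_Collect_less continuous_intros)
    show "jacobi t (w + of_real (t / 2)) = exp (w + of_real (t / 4)) * jacobi t w"
      if "w \<in> {w. - (3 * t / 4) < Re w} \<inter> {w. Re w < t / 4}" for w
      using that by (intro jacobi_shift t) auto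
    show "f (w + of_real (t / 2)) = exp (w + of_real (t / 4)) * f w" for w
      using f by (simp add: theta_like_def)
    show "(\<lambda>w. exp (w + of_real (t / 4))) field_differentiable at z"
      by (rule holomorphic_on_imp_differentiable_at[of _ UNIV]) (auto intro!: holomorphic_intros)
    have "\<bar>Re z\<bar> < 3 * t / 4" "\<bar>Re z + t / 2\<bar> < 3 * t / 4" using z t by linarith+
    then show "jacobi t field_differentiable at z" "jacobi t field_differentiable at (z + of_real (t / 2))"
      by (intro jd; simp add: S_def jacobi_strip_def)+
  qed (use z fd theta_like_jacobi_zero[OF f] in \<open>auto\<close>)
  define C where "C = cbox (Complex (- (t / 4)) 0) (Complex (t / 4) (2 * pi))"
  have CS: "C \<subseteq> S" using t by (auto simp: C_def S_def jacobi_strip_def in_cbox_complex_iff)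
  have "0 \<in> C" using t by (auto simp: C_def in_cbox_complex_iff)
  moreover have "continuous_on C (\<lambda>z. norm (Q z))"
    using holomorphic_on_imp_continuous_on[OF Q] CS by (intro continuous_on_norm) (rule continuous_on_subset)
  moreover have "compact C" by (simp add: C_def)
  ultimately obtain z0 where z0: "z0 \<in> C" "\<And>z. z \<in> C \<Longrightarrow> norm (Q z) \<le> norm (Q z0)"
    using continuous_attains_sup[of C "\<lambda>z. norm (Q z)"] by blast
  have bound1: "norm (Q z) \<le> norm (Q z0)" if z: "\<bar>Re z\<bar> \<le> t / 4" for z
  proof -
    have zS: "z \<in> S" using z t by (simp add: S_def jacobi_strip_def)
    define n where "n = \<lfloor>Im z / (2 * pi)\<rfloor>"
    define k where "k = - n"
    have "real_of_int n \<le> Im z / (2 * pi)" "Im z / (2 * pi) \<le> real_of_int n + 1" unfolding n_def by linarith+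
    then have "0 \<le> Im z + real_of_int k * (2 * pi)" "Im z + real_of_int k * (2 * pi) \<le> 2 * pi"
      by (simp_all add: k_def field_simps)
    then have "z + of_int k * (2 * of_real pi * \<i>) \<in> C" using z by (auto simp: C_def in_cbox_complex_iff)
    from z0(2)[OF this] show ?thesis unfolding perk[OF zS] .
  qed
  \<comment> \<open>An open set between the cell and the strip: at most one shift by
    \<open>t / 2\<close> carries each of its points to \<open>\<bar>Re z\<bar> \<le> t / 4\<close>,
    and the maximum point \<open>z0\<close> of the closed cell is interior to it.\<close>
  define T where "T = {z. \<bar>Re z\<bar> < t / 2}"
  have bound: "norm (Q z) \<le> norm (Q z0)" if z: "z \<in> T" for z
  proof -
    consider "\<bar>Re z\<bar> \<le> t / 4" | "Re z > t / 4" | "Re z < - (t / 4)" by linarith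
    then show ?thesis
    proof cases
      case 2
      then have "norm (Q (z - of_real (t / 2))) \<le> norm (Q z0)" using z t by (intro bound1) (auto simp: T_def)
      moreover have "Q (z - of_real (t / 2) + of_real (t / 2)) = Q (z - of_real (t / 2))"
        using z 2 t by (intro shift) (auto simp: T_def)
      ultimately show ?thesis by simp
    next
      case 3
      then have "norm (Q (z + of_real (t / 2))) \<le> norm (Q z0)" using z t by (intro bound1) (auto simp: T_def)
      moreover have "Q (z + of_real (t / 2)) = Q z"
        using z 3 t by (intro shift) (auto simp: T_def)
      ultimately show ?thesis by simp
    qed (rule bound1)
  qed
  have "Q constant_on T"
  proof (rule maximum_modulus_principle[where U = T and \<xi> = z0])
    have "T \<subseteq> S" using t by (auto simp: T_def S_def jacobi_strip_def)
    then show "Q holomorphic_on T" using Q holomorphic_on_subset by blast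
    show T: "open T" unfolding T_def by (intro open_Collect_less continuous_intros)
    have "T = {z. Re z < t / 2} \<inter> {z. Re z > - (t / 2)}" by (auto simp: T_def abs_less_iff)
    then show "connected T"
      by (metis convex_Int convex_connected convex_halfspace_Re_gt convex_halfspace_Re_lt)
    show "open T" by (rule T)
    show "z0 \<in> T" using z0(1) t by (auto simp: C_def T_def in_cbox_complex_iff)
  qed (use bound in auto)
  then obtain c where c: "\<And>z. z \<in> T \<Longrightarrow> Q z = c" by (auto simp: constant_on_def)
  have "f z = c * jacobi t z" if "\<bar>Re z\<bar> < t / 2" for z
  proof (cases "jacobi t z = 0")
    case True then show ?thesis using theta_like_jacobi_zero[OF f] by simp
  next
    case False then show ?thesis using c[of z] that by (auto simp: T_def Q_def quot_def)
  qed
  then show ?thesis using that by blast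
qed

text \<open>Both functions are multiples of \<open>jacobi\<close> near 0, and
  \<open>g 0 \<noteq> 0\<close> makes the second multiple nonzero. Unlike the comparison function,
  \<open>f\<close> and \<open>g\<close> are entire, so the proportionality spreads to the whole
  plane.\<close>

lemma theta_like_proportional:
  assumes t: "t > 0" and f: "theta_like t f" and g: "theta_like t g" and g0: "g 0 \<noteq> 0"
  shows "\<exists>c. \<forall>z. f z = c * g z"
proof -
  obtain a where a: "\<And>z. \<bar>Re z\<bar> < t / 2 \<Longrightarrow> f z = a * jacobi t z" using theta_like_eq_jacobi[OF t f] by blast
  obtain b where b: "\<And>z. \<bar>Re z\<bar> < t / 2 \<Longrightarrow> g z = b * jacobi t z" using theta_like_eq_jacobi[OF t g] by blast
  have b0: "b \<noteq> 0" using b[of 0] g0 t by auto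
  have "f z - a / b * g z = 0" for z
  proof (rule analytic_continuation_open[where f = "\<lambda>z. f z - a / b * g z" and g = "\<lambda>_. 0" and s = "ball 0 (t/2)" and s' = UNIV])
    show "f w - a / b * g w = 0" if "w \<in> ball 0 (t/2)" for w
    proof -
      have "\<bar>Re w\<bar> < t / 2" using that abs_Re_le_cmod[of w] by auto
      then show ?thesis using a b b0 by simp
    qed
  qed (use t f g in \<open>auto simp: theta_like_def intro!: holomorphic_intros\<close>)
  then have "\<forall>z. f z = a / b * g z" by simp
  then show ?thesis by blast
qed

section \<open>The theta transformation\<close>

lemma summable_gauss:
  fixes t R :: real
  assumes "t > 0"
  shows "summable (\<lambda>n. exp (- (t / 4) * (real n)\<^sup>2 + R * real n))"
proof (rule summable_comparison_test')
  show "summable (\<lambda>n. exp (- 1 :: real) ^ n)" by (intro summable_geometric) simp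
  fix n assume n: "n \<ge> nat \<lceil>4 * (R + 1) / t\<rceil>"
  then have "4 * (R + 1) / t \<le> real n" by linarith
  then have "R + 1 \<le> t / 4 * real n" using assms by (simp add: field_simps)
  then have "(R + 1) * real n \<le> t / 4 * real n * real n" by (intro mult_right_mono) auto
  then show "norm (exp (- (t / 4) * (real n)\<^sup>2 + R * real n)) \<le> exp (- 1) ^ n"
    by (simp add: exp_of_nat_mult[symmetric] power2_eq_square algebra_simps)
qed

text \<open>Weierstrass' theorem with majorants that depend on \<open>Re z\<close> only, the form in
  which both the theta series and the character series are bounded.\<close>

lemma holomorphic_series_deriv:
  fixes f :: "nat \<Rightarrow> complex \<Rightarrow> complex"
  assumes hol: "\<And>n. f n holomorphic_on UNIV" and M: "\<And>R. summable (M R)"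
    and le: "\<And>R n z. \<bar>Re z\<bar> \<le> R \<Longrightarrow> norm (f n z) \<le> M R n"
  shows "((\<lambda>z. \<Sum>n. f n z) has_field_derivative (\<Sum>n. deriv (f n) z)) (at z)"
proof -
  have "\<exists>g g'. \<forall>x\<in>UNIV. ((\<lambda>n. f n x) sums g x) \<and> ((\<lambda>n. deriv (f n) x) sums g' x)
      \<and> (g has_field_derivative g' x) (at x)"
  proof (rule series_and_derivative_comparison_complex)
    show "(f n has_field_derivative deriv (f n) x) (at x)" for n x
      using hol holomorphic_derivI by blast
    fix x :: complex
    have bd: "norm (f n y) \<le> M (\<bar>Re x\<bar> + 1) n" if "y \<in> ball x 1" for n y
    proof (rule le)
      have "\<bar>Re (y - x)\<bar> \<le> norm (y - x)" by (rule abs_Re_le_cmod)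
      then show "\<bar>Re y\<bar> \<le> \<bar>Re x\<bar> + 1" using that by (auto simp: dist_norm norm_minus_commute)
    qed
    have pos: "M (\<bar>Re x\<bar> + 1) n \<ge> 0" for n
      by (rule order.trans[OF norm_ge_zero le[of x]]) simp
    have "norm (f n y) \<le> norm (complex_of_real (M (\<bar>Re x\<bar> + 1) n))" if "y \<in> ball x 1" for n y
      using bd[OF that, of n] pos[of n] by simp
    then show "\<exists>d (h :: nat \<Rightarrow> complex). 0 < d \<and> summable h \<and> range h \<subseteq> \<real>\<^sub>\<ge>\<^sub>0 \<and>
        (\<forall>\<^sub>F n in sequentially. \<forall>y\<in>ball x d \<inter> UNIV. norm (f n y) \<le> norm (h n))"
      using pos by (intro exI[of _ 1] exI[of _ "\<lambda>n. complex_of_real (M (\<bar>Re x\<bar> + 1) n)"] conjI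
          always_eventually summable_of_real M) auto
  qed auto
  then obtain g g' where g: "\<And>x. (\<lambda>n. f n x) sums g x" "\<And>x. (\<lambda>n. deriv (f n) x) sums g' x"
    "\<And>x. (g has_field_derivative g' x) (at x)" by auto
  have "(\<lambda>z. \<Sum>n. f n z) = g" using g(1) by (auto simp: sums_iff)
  then show "((\<lambda>z. \<Sum>n. f n z) has_field_derivative (\<Sum>n. deriv (f n) z)) (at z)"
    using g(2,3) by (simp add: sums_iff)
qed

section \<open>The theta series, its derivative and its translation laws\<close>

definition theta_term :: "real \<Rightarrow> complex \<Rightarrow> int \<Rightarrow> complex" where
  "theta_term t z n = exp (of_real (- (t / 4) * (real_of_int n)\<^sup>2) + of_int n * z)"

definition theta :: "real \<Rightarrow> complex \<Rightarrow> complex" where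
  "theta t z = (\<Sum>\<^sub>\<infinity>n. theta_term t z n)"

lemma norm_theta_term_le:
  assumes "\<bar>Re z\<bar> \<le> R"
  shows "norm (theta_term t z n) \<le> exp (- (t / 4) * (real (nat \<bar>n\<bar>))\<^sup>2 + R * real (nat \<bar>n\<bar>))"
proof -
  have "real_of_int n * Re z \<le> \<bar>real_of_int n\<bar> * \<bar>Re z\<bar>" by (metis abs_ge_self abs_mult)
  also have "\<dots> \<le> \<bar>real_of_int n\<bar> * R" using assms by (intro mult_left_mono) auto
  finally show ?thesis by (simp add: theta_term_def mult.commute)
qed

text \<open>The weight covers the series and its termwise derivative at once. It is absorbed by
  \<open>1 + n \<le> exp n\<close>, which only raises the linear coefficient
  \<open>\<bar>Re z\<bar>\<close> by one.\<close>

lemma summable_theta_weighted: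
  assumes "t > 0"
  shows "summable (\<lambda>n. (1 + real n) * norm (theta_term t z (int n)))"
    and "summable (\<lambda>n. (1 + real n) * norm (theta_term t z (- int n)))"
proof -
  have *: "norm ((1 + real n) * norm (theta_term t z m)) \<le> exp (- (t / 4) * (real n)\<^sup>2 + (\<bar>Re z\<bar> + 1) * real n)"
    if "nat \<bar>m\<bar> = n" for n m
  proof -
    have "(1 + real n) * norm (theta_term t z m) \<le> exp (real n) * exp (- (t / 4) * (real n)\<^sup>2 + \<bar>Re z\<bar> * real n)"
      using norm_theta_term_le[of z "\<bar>Re z\<bar>" t m] that exp_ge_add_one_self[of "real n"]
      by (intro mult_mono) auto
    then show ?thesis by (simp add: exp_add[symmetric] algebra_simps)
  qed
  show "summable (\<lambda>n. (1 + real n) * norm (theta_term t z (int n)))"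
    "summable (\<lambda>n. (1 + real n) * norm (theta_term t z (- int n)))"
    by (rule summable_comparison_test'[OF summable_gauss[OF assms, of "\<bar>Re z\<bar> + 1"], of 0 "\<lambda>n. (1 + real n) * norm (theta_term t z (int n))"], rule *, simp)
      (rule summable_comparison_test'[OF summable_gauss[OF assms, of "\<bar>Re z\<bar> + 1"], of 0 "\<lambda>n. (1 + real n) * norm (theta_term t z (- int n))"], rule *, simp)
qed

lemma summable_weighted_imp:
  fixes f :: "nat \<Rightarrow> complex"
  assumes "summable (\<lambda>n. (1 + real n) * norm (f n))"
  shows "summable (\<lambda>n. norm (f n))" "summable (\<lambda>n. norm (of_nat n * f n))"
  by (rule summable_comparison_test'[OF assms, of 0]; simp add: norm_mult algebra_simps)+

text \<open>The bridge between unordered sums over the integers, in which reindexing is immediate,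
  and series over \<open>nat\<close>, which can be differentiated termwise. Pairing \<open>n\<close>
  with \<open>- (n + 1)\<close> counts 0 once.\<close>

lemma has_sum_int_pairs:
  fixes f :: "int \<Rightarrow> complex"
  assumes "summable (\<lambda>n. norm (f (int n)))" "summable (\<lambda>n. norm (f (- int n)))"
  shows "(f has_sum (\<Sum>n. f (int n) + f (- int (Suc n)))) UNIV"
proof -
  have s2: "summable (\<lambda>n. norm (f (- int (Suc n))))"
    using assms(2) summable_Suc_iff[of "\<lambda>n. norm (f (- int n))"] by simp
  have "(f \<circ> int has_sum (\<Sum>n. f (int n))) UNIV"
    using norm_summable_imp_has_sum[OF assms(1)] summable_norm_cancel[OF assms(1)] by (simp add: summable_sums o_def)
  then have a: "(f has_sum (\<Sum>n. f (int n))) (range int)" by (subst has_sum_reindex) auto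
  have "(f \<circ> (\<lambda>n. - int (Suc n)) has_sum (\<Sum>n. f (- int (Suc n)))) UNIV"
    using norm_summable_imp_has_sum[OF s2] summable_norm_cancel[OF s2] by (simp add: summable_sums o_def)
  then have b: "(f has_sum (\<Sum>n. f (- int (Suc n)))) (range (\<lambda>n. - int (Suc n)))"
    by (subst has_sum_reindex) (auto simp: inj_on_def)
  have "range int \<union> range (\<lambda>n. - int (Suc n)) = UNIV"
  proof -
    have "k \<in> range int \<union> range (\<lambda>n. - int (Suc n))" for k by (cases k rule: int_cases) auto
    then show ?thesis by blast
  qed
  moreover have "range int \<inter> range (\<lambda>n. - int (Suc n)) = {}" by auto
  ultimately show ?thesis
    using has_sum_Un_disjoint[OF a b] suminf_add[OF summable_norm_cancel[OF assms(1)] summable_norm_cancel[OF s2]] by simp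
qed

lemma theta_term_has_sum:
  assumes t: "t > 0"
  shows "(theta_term t z has_sum (\<Sum>n. theta_term t z (int n) + theta_term t z (- int (Suc n)))) UNIV"
  by (rule has_sum_int_pairs; rule summable_weighted_imp(1), rule summable_theta_weighted[OF t])

lemma theta_eq_suminf:
  "t > 0 \<Longrightarrow> theta t z = (\<Sum>n. theta_term t z (int n) + theta_term t z (- int (Suc n)))"
  unfolding theta_def by (rule infsumI[OF theta_term_has_sum])

lemma theta_has_sum: "t > 0 \<Longrightarrow> (theta_term t z has_sum theta t z) UNIV"
  using theta_term_has_sum theta_eq_suminf by simp

lemma theta_has_field_derivative:
  assumes t: "t > 0"
  shows "(theta t has_field_derivative
    (\<Sum>n. of_nat n * theta_term t z (int n)) - (\<Sum>n. of_nat n * theta_term t z (- int n))) (at z)"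
proof -
  define f where "f n z = theta_term t z (int n) + theta_term t z (- int (Suc n))" for n z
  define f' where "f' n z = of_nat n * theta_term t z (int n) - of_nat (Suc n) * theta_term t z (- int (Suc n))" for n z
  have d: "(f n has_field_derivative f' n z) (at z)" for n z
  proof -
    have "((\<lambda>z. theta_term t z m) has_field_derivative of_int m * theta_term t z m) (at z)" for m
      unfolding theta_term_def by (auto intro!: derivative_eq_intros)
    from DERIV_add[OF this[of "int n"] this[of "- int (Suc n)"]] show ?thesis
      by (simp only: f_def[abs_def] f'_def of_int_of_nat_eq of_int_minus mult_minus_left diff_conv_add_uminus)
  qed
  define M where "M R n = exp (- (t / 4) * (real n)\<^sup>2 + R * real n) + exp (- (t / 4) * (real (Suc n))\<^sup>2 + R * real (Suc n))" for R n
  have M: "summable (M R)" for R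
    unfolding M_def using summable_gauss[OF t, of R] summable_Suc_iff[of "\<lambda>n. exp (- (t / 4) * (real n)\<^sup>2 + R * real n)"]
    by (intro summable_add) auto
  have le: "norm (f n z) \<le> M R n" if "\<bar>Re z\<bar> \<le> R" for R n z
  proof -
    have "nat \<bar>int n\<bar> = n" "nat \<bar>- int (Suc n)\<bar> = Suc n" by simp_all
    then show ?thesis unfolding f_def M_def
      using norm_theta_term_le[OF that, of t "int n"] norm_theta_term_le[OF that, of t "- int (Suc n)"]
      by (intro norm_triangle_mono) (simp_all only:)
  qed
  have "(\<lambda>z. \<Sum>n. f n z) = theta t" using theta_eq_suminf[OF t] by (auto simp: f_def)
  moreover have "deriv (f n) z = f' n z" for n z using d DERIV_imp_deriv by blast
  moreover have "f n holomorphic_on UNIV" for n using d by (auto simp: holomorphic_on_open)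
  ultimately have "(theta t has_field_derivative (\<Sum>n. f' n z)) (at z)"
    using holomorphic_series_deriv[of f M z] M le by simp
  moreover have "(\<Sum>n. f' n z) = (\<Sum>n. of_nat n * theta_term t z (int n)) - (\<Sum>n. of_nat n * theta_term t z (- int n))"
  proof -
    have s: "summable (\<lambda>n. of_nat n * theta_term t z (int n))" "summable (\<lambda>n. of_nat n * theta_term t z (- int n))"
      by (rule summable_norm_cancel, rule summable_weighted_imp(2), rule summable_theta_weighted[OF t])+
    \<comment> \<open>The term with index 0 vanishes because of its weight, so starting at 1 does
      not change the sum.\<close>
    have s': "(\<lambda>n. of_nat (Suc n) * theta_term t z (- int (Suc n))) sums (\<Sum>n. of_nat n * theta_term t z (- int n))"
      using summable_sums[OF s(2)] sums_Suc_iff[of "\<lambda>n. of_nat n * theta_term t z (- int n)"] by simp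
    show ?thesis unfolding f'_def
      using sums_diff[OF summable_sums[OF s(1)] s'] by (simp add: sums_iff)
  qed
  ultimately show ?thesis by simp
qed

lemma theta_minus: "t > 0 \<Longrightarrow> theta t (- z) = theta t z"
proof -
  assume t: "t > 0"
  have "bij_betw uminus (UNIV :: int set) UNIV" by (rule bij_betwI[where g = uminus]) auto
  from has_sum_reindex_bij_betw[OF this, of "theta_term t (- z)" "theta t (- z)"]
  have "((\<lambda>n. theta_term t (- z) (- n)) has_sum theta t (- z)) UNIV" using theta_has_sum[OF t] by simp
  moreover have "theta_term t (- z) (- n) = theta_term t z n" for n by (simp add: theta_term_def)
  ultimately have "(theta_term t z has_sum theta t (- z)) UNIV" by simp
  then show ?thesis using theta_has_sum[OF t] has_sum_unique by blast
qed

lemma theta_shift: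
  assumes t: "t > 0"
  shows "theta t (z + of_real (t / 2)) = exp (z + of_real (t / 4)) * theta t z"
proof -
  have "bij_betw (\<lambda>n. n + 1) (UNIV :: int set) UNIV" by (rule bij_betwI[where g = "\<lambda>n. n - 1"]) auto
  from has_sum_reindex_bij_betw[OF this, of "theta_term t (z + of_real (t / 2))" "theta t (z + of_real (t / 2))"]
  have "((\<lambda>n. theta_term t (z + of_real (t / 2)) (n + 1)) has_sum theta t (z + of_real (t / 2))) UNIV"
    using theta_has_sum[OF t] by simp
  moreover have "theta_term t (z + of_real (t / 2)) (n + 1) = exp (z + of_real (t / 4)) * theta_term t z n" for n
    unfolding theta_term_def exp_add[symmetric]
    by (rule arg_cong[of _ _ exp]) (simp add: power2_eq_square field_simps)
  moreover have "((\<lambda>n. exp (z + of_real (t / 4)) * theta_term t z n) has_sum exp (z + of_real (t / 4)) * theta t z) UNIV"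
    using theta_has_sum[OF t] by (intro has_sum_cmult_right) auto
  ultimately show ?thesis by (simp only: has_sum_unique)
qed

lemma theta_period: "theta t (z + 2 * of_real pi * \<i>) = theta t z"
proof -
  have "theta_term t (z + 2 * of_real pi * \<i>) n = theta_term t z n" for n
    unfolding theta_term_def exp_eq by (rule exI[of _ n]) (simp add: algebra_simps)
  then show ?thesis by (simp add: theta_def)
qed

lemma theta_holomorphic: "t > 0 \<Longrightarrow> theta t holomorphic_on UNIV"
  unfolding holomorphic_on_open[OF open_UNIV] using theta_has_field_derivative by blast

lemma theta_like_theta: "t > 0 \<Longrightarrow> theta_like t (theta t)"
  unfolding theta_like_def using theta_minus[of t] theta_shift[of t] theta_period[of t] theta_holomorphic[of t] by metis

text \<open>This is \<open>\<Sum>k. exp ((z + 2 \<pi> \<i> k)\<^sup>2 / t)\<close>, the result of Poisson summation up to a constant; the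
  square is expanded in order to exhibit a theta function again.\<close>

definition theta_dual :: "real \<Rightarrow> complex \<Rightarrow> complex" where
  "theta_dual t z = exp (z\<^sup>2 / of_real t) * theta (16 * pi\<^sup>2 / t) (4 * of_real pi * \<i> * z / of_real t)"

text \<open>The Gaussian factor and the rotation of the argument exchange the two laws:
  \<open>2 * pi * \<i>\<close> becomes a shift by \<open>- t' / 2\<close> with
  \<open>t' = 16 * pi^2 / t\<close>, whose multiplier cancels against the Gaussian, and
  \<open>t / 2\<close> becomes the period \<open>2 * pi * \<i>\<close>.\<close>

lemma theta_like_dual: assumes t: "t > 0" shows "theta_like t (theta_dual t)"
proof -
  define t' where "t' = 16 * pi\<^sup>2 / t"
  have t': "t' > 0" using t by (simp add: t'_def)
  let ?w = "\<lambda>z. 4 * of_real pi * \<i> * z / of_real t"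
  have tn: "complex_of_real t \<noteq> 0" using t by simp
  have "theta_dual t holomorphic_on UNIV"
  proof -
    have "(\<lambda>z. theta t' (?w z)) holomorphic_on UNIV"
      using tn by (intro holomorphic_on_compose_gen[of ?w UNIV "theta t'" UNIV, unfolded o_def] theta_holomorphic[OF t'])
        (auto intro!: holomorphic_intros)
    then show ?thesis unfolding theta_dual_def[abs_def] t'_def[symmetric] using tn by (intro holomorphic_intros) auto
  qed
  moreover have "theta_dual t (- z) = theta_dual t z" for z
    using theta_minus[OF t', of "?w z"] by (simp add: theta_dual_def t'_def)
  moreover have "theta_dual t (z + 2 * of_real pi * \<i>) = theta_dual t z" for z
  proof -
    define w where "w = ?w z"
    have w1: "?w (z + 2 * of_real pi * \<i>) = w - of_real (t' / 2)"
      using tn by (simp add: w_def t'_def field_simps power2_eq_square)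
    have e1: "w - of_real (t' / 2) + of_real (t' / 2) = w" by simp
    have e2: "w - of_real (t' / 2) + of_real (t' / 4) = w - of_real (t' / 4)" by (simp add: field_simps)
    have *: "theta t' w = exp (w - of_real (t' / 4)) * theta t' (w - of_real (t' / 2))"
      using theta_shift[OF t', of "w - of_real (t' / 2)"] unfolding e1 e2 .
    have e: "(z + 2 * of_real pi * \<i>)\<^sup>2 / of_real t = z\<^sup>2 / of_real t + (w - of_real (t' / 4))"
      using tn by (simp add: w_def t'_def field_simps power2_eq_square)
    show ?thesis
      unfolding theta_dual_def t'_def[symmetric] w1 e w_def[symmetric] * by (simp add: exp_add)
  qed
  moreover have "theta_dual t (z + of_real (t / 2)) = exp (z + of_real (t / 4)) * theta_dual t z" for z
  proof -
    have w1: "?w (z + of_real (t / 2)) = ?w z + 2 * of_real pi * \<i>"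
      using tn by (simp add: field_simps)
    have e: "(z + of_real (t / 2))\<^sup>2 / of_real t = (z + of_real (t / 4)) + z\<^sup>2 / of_real t"
      using tn by (simp add: field_simps power2_eq_square)
    show ?thesis unfolding theta_dual_def w1 e theta_period by (simp add: exp_add)
  qed
  ultimately show ?thesis unfolding theta_like_def by blast
qed

lemma theta_0_nonzero: assumes "t > 0" shows "theta t 0 \<noteq> 0"
proof -
  let ?f = "\<lambda>n. exp (- (t / 4) * (real n)\<^sup>2) + exp (- (t / 4) * (real (Suc n))\<^sup>2)"
  have s: "summable ?f"
    using summable_gauss[OF assms, of 0] summable_Suc_iff[of "\<lambda>n. exp (- (t / 4) * (real n)\<^sup>2)"]
    by (intro summable_add) auto
  have "theta_term t 0 (int n) + theta_term t 0 (- int (Suc n)) = of_real (?f n)" for n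
    by (simp add: theta_term_def exp_of_real[symmetric] power2_eq_square algebra_simps)
  then have "theta t 0 = (\<Sum>n. complex_of_real (?f n))" using theta_eq_suminf[OF assms] by simp
  also have "\<dots> = of_real (\<Sum>n. ?f n)" using sums_of_real[OF summable_sums[OF s], where 'a = complex] by (simp only: sums_iff)
  finally have "theta t 0 = of_real (\<Sum>n. ?f n)" .
  moreover have "(\<Sum>n. ?f n) > 0" by (intro suminf_pos s add_pos_pos) auto
  ultimately show ?thesis by simp
qed

lemma theta_transformation:
  assumes "t > 0"
  shows "\<exists>c. \<forall>z. theta t z = c * theta_dual t z"
proof (rule theta_like_proportional[OF assms theta_like_theta[OF assms] theta_like_dual[OF assms]])
  show "theta_dual t 0 \<noteq> 0"
    using assms theta_0_nonzero[of "16 * pi\<^sup>2 / t"] by (simp add: theta_dual_def)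
qed

text \<open>Up to the factor \<open>2 / t\<close>, the derivative of
  \<open>exp ((z + \<i> * pi * m)^2 / t)\<close>. The index is counted in units of \<open>pi\<close>
  so that even \<open>m\<close> serve the series itself and odd \<open>m\<close> the series
  recentred at \<open>\<i> * pi\<close>.\<close>

definition gauss_term :: "real \<Rightarrow> complex \<Rightarrow> real \<Rightarrow> complex" where
  "gauss_term t z m = (z + \<i> * of_real (pi * m)) * exp ((z + \<i> * of_real (pi * m))\<^sup>2 / of_real t)"

lemma gauss_term_theta:
  assumes t: "t > 0"
  shows "gauss_term t z (2 * real_of_int n) = exp (z\<^sup>2 / of_real t) * (z + 2 * of_real pi * \<i> * of_int n) *
    theta_term (16 * pi\<^sup>2 / t) (4 * of_real pi * \<i> * z / of_real t) n"
proof -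
  have e0: "z + \<i> * of_real (pi * (2 * real_of_int n)) = z + 2 * of_real pi * \<i> * of_int n" by simp
  have e: "(z + \<i> * of_real (pi * (2 * real_of_int n)))\<^sup>2 / of_real t =
    z\<^sup>2 / of_real t + (of_real (- ((16 * pi\<^sup>2 / t) / 4) * (real_of_int n)\<^sup>2) + of_int n * (4 * of_real pi * \<i> * z / of_real t))"
    using t by (simp add: power2_eq_square field_simps)
  show ?thesis unfolding gauss_term_def e unfolding e0 theta_term_def unfolding exp_add by (simp only: mult_ac)
qed

definition gauss_series :: "real \<Rightarrow> complex \<Rightarrow> complex" where
  "gauss_series t z = (\<Sum>n. gauss_term t z (2 * real n)) + (\<Sum>n. gauss_term t z (- 2 * real (Suc n)))"

lemma summable_gauss_term:
  assumes t: "t > 0"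
  shows "summable (\<lambda>n. gauss_term t z (2 * real n))" "summable (\<lambda>n. gauss_term t z (- 2 * real n))"
    and "summable (\<lambda>n. gauss_term t z (- 2 * real (Suc n)))"
proof -
  define t' where "t' = 16 * pi\<^sup>2 / t"
  have t': "t' > 0" using t by (simp add: t'_def)
  let ?w = "4 * of_real pi * \<i> * z / of_real t"
  have le: "norm (gauss_term t z (2 * real_of_int m)) \<le>
      norm (exp (z\<^sup>2 / of_real t)) * (norm z + 2 * pi) * ((1 + real n) * norm (theta_term t' ?w m))"
    if "nat \<bar>m\<bar> = n" for m n
  proof -
    have "norm (z + 2 * of_real pi * \<i> * of_int m) \<le> norm z + 2 * pi * real n"
      by (rule order.trans[OF norm_triangle_ineq]) (use that in \<open>simp add: norm_mult\<close>)
    also have "\<dots> \<le> (norm z + 2 * pi) * (1 + real n)" by (simp add: algebra_simps)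
    finally have "norm (z + 2 * of_real pi * \<i> * of_int m) \<le> (norm z + 2 * pi) * (1 + real n)" .
    from mult_right_mono[OF mult_left_mono[OF this norm_ge_zero] norm_ge_zero] show ?thesis
      unfolding gauss_term_theta[OF t] norm_mult t'_def[symmetric] by (simp only: mult.assoc)
  qed
  show "summable (\<lambda>n. gauss_term t z (2 * real n))"
    using le[of "int _"]
    by (intro summable_comparison_test'[OF summable_mult[OF summable_theta_weighted(1)[OF t']], of 0]) auto
  show s: "summable (\<lambda>n. gauss_term t z (- 2 * real n))"
    using le[of "- int _"]
    by (intro summable_comparison_test'[OF summable_mult[OF summable_theta_weighted(2)[OF t']], of 0]) auto
  show "summable (\<lambda>n. gauss_term t z (- 2 * real (Suc n)))"
    using s summable_Suc_iff[of "\<lambda>n. gauss_term t z (- 2 * real n)"] by simp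
qed

text \<open>The product rule yields \<open>z * theta\<close> plus \<open>2 * pi * \<i>\<close> times
  the derivative of the dual theta function; in the term of index \<open>n\<close> the two parts
  combine to the prefactor \<open>z + 2 * pi * \<i> * n\<close>.\<close>

lemma deriv_theta_dual:
  assumes t: "t > 0"
  shows "deriv (theta_dual t) z = 2 / of_real t * gauss_series t z"
proof -
  define t' where "t' = 16 * pi\<^sup>2 / t"
  have t': "t' > 0" using t by (simp add: t'_def)
  define w where "w = 4 * of_real pi * \<i> * z / of_real t"
  have tn: "complex_of_real t \<noteq> 0" using t by simp
  define A where "A = (\<Sum>n. of_nat n * theta_term t' w (int n))"
  define B where "B = (\<Sum>n. of_nat n * theta_term t' w (- int n))"
  define A0 where "A0 = (\<Sum>n. theta_term t' w (int n))"
  define B0 where "B0 = (\<Sum>n. theta_term t' w (- int (Suc n)))"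
  have sA: "(\<lambda>n. of_nat n * theta_term t' w (int n)) sums A"
    unfolding A_def by (rule summable_sums, rule summable_norm_cancel, rule summable_weighted_imp(2), rule summable_theta_weighted[OF t'])
  have sB: "(\<lambda>n. of_nat n * theta_term t' w (- int n)) sums B"
    unfolding B_def by (rule summable_sums, rule summable_norm_cancel, rule summable_weighted_imp(2), rule summable_theta_weighted[OF t'])
  have sB': "(\<lambda>n. of_nat (Suc n) * theta_term t' w (- int (Suc n))) sums B"
    using sB sums_Suc_iff[of "\<lambda>n. of_nat n * theta_term t' w (- int n)"] by simp
  have sA0: "(\<lambda>n. theta_term t' w (int n)) sums A0"
    unfolding A0_def by (rule summable_sums, rule summable_norm_cancel, rule summable_weighted_imp(1), rule summable_theta_weighted[OF t'])
  have "summable (\<lambda>n. theta_term t' w (- int n))"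
    by (rule summable_norm_cancel, rule summable_weighted_imp(1), rule summable_theta_weighted[OF t'])
  then have sB0: "(\<lambda>n. theta_term t' w (- int (Suc n))) sums B0"
    unfolding B0_def using summable_Suc_iff[of "\<lambda>n. theta_term t' w (- int n)"] by (intro summable_sums) simp
  have th: "theta t' w = A0 + B0"
    unfolding theta_eq_suminf[OF t'] using sums_add[OF sA0 sB0] by (simp add: sums_iff)
  have dth: "(theta t' has_field_derivative A - B) (at w)"
    unfolding A_def B_def by (rule theta_has_field_derivative[OF t'])
  have "((\<lambda>z. theta t' (4 * of_real pi * \<i> * z / of_real t)) has_field_derivative (A - B) * (4 * of_real pi * \<i> / of_real t)) (at z)"
    by (rule DERIV_chain2[where g = "\<lambda>z. 4 * of_real pi * \<i> * z / of_real t" and f = "theta t'"])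
      (use dth tn in \<open>auto simp: w_def intro!: derivative_eq_intros\<close>)
  then have d: "(theta_dual t has_field_derivative
      exp (z\<^sup>2 / of_real t) * (2 * z / of_real t) * theta t' w + exp (z\<^sup>2 / of_real t) * ((A - B) * (4 * of_real pi * \<i> / of_real t))) (at z)"
    unfolding theta_dual_def[abs_def] t'_def[symmetric] w_def
    using tn by (auto intro!: derivative_eq_intros simp: field_simps)
  have "(\<lambda>n. exp (z\<^sup>2 / of_real t) * (z * theta_term t' w (int n) + 2 * of_real pi * \<i> * (of_nat n * theta_term t' w (int n))))
     sums (exp (z\<^sup>2 / of_real t) * (z * A0 + 2 * of_real pi * \<i> * A))"
    by (intro sums_mult sums_add sA0 sA)
  moreover have "exp (z\<^sup>2 / of_real t) * (z * theta_term t' w (int n) + 2 * of_real pi * \<i> * (of_nat n * theta_term t' w (int n)))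
     = gauss_term t z (2 * real n)" for n
    using gauss_term_theta[OF t, of z "int n"] unfolding t'_def w_def by (simp add: algebra_simps)
  ultimately have 1: "(\<lambda>n. gauss_term t z (2 * real n)) sums (exp (z\<^sup>2 / of_real t) * (z * A0 + 2 * of_real pi * \<i> * A))" by simp
  have "(\<lambda>n. exp (z\<^sup>2 / of_real t) * (z * theta_term t' w (- int (Suc n)) - 2 * of_real pi * \<i> * (of_nat (Suc n) * theta_term t' w (- int (Suc n)))))
     sums (exp (z\<^sup>2 / of_real t) * (z * B0 - 2 * of_real pi * \<i> * B))"
    by (intro sums_mult sums_diff sB0 sB')
  moreover have "exp (z\<^sup>2 / of_real t) * (z * theta_term t' w (- int (Suc n)) - 2 * of_real pi * \<i> * (of_nat (Suc n) * theta_term t' w (- int (Suc n))))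
     = gauss_term t z (- 2 * real (Suc n))" for n
    using gauss_term_theta[OF t, of z "- int (Suc n)"] unfolding t'_def w_def by (simp add: algebra_simps)
  ultimately have 2: "(\<lambda>n. gauss_term t z (- 2 * real (Suc n))) sums (exp (z\<^sup>2 / of_real t) * (z * B0 - 2 * of_real pi * \<i> * B))" by simp
  have gs: "gauss_series t z = exp (z\<^sup>2 / of_real t) * (z * A0 + 2 * of_real pi * \<i> * A) + exp (z\<^sup>2 / of_real t) * (z * B0 - 2 * of_real pi * \<i> * B)"
    using 1 2 by (simp add: gauss_series_def sums_iff)
  show ?thesis unfolding DERIV_imp_deriv[OF d] th gs by (simp add: algebra_simps add_divide_distrib diff_divide_distrib)
qed

lemma deriv_theta_eq_gauss_series:
  assumes t: "t > 0"
  shows "\<exists>c. \<forall>z. deriv (theta t) z = c * gauss_series t z"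
proof -
  obtain c where c: "\<And>z. theta t z = c * theta_dual t z" using theta_transformation[OF t] by blast
  have "deriv (theta t) z = c * (2 / of_real t) * gauss_series t z" for z
  proof -
    have "theta_dual t field_differentiable at z"
      using theta_like_dual[OF t] holomorphic_on_imp_differentiable_at[of _ UNIV] by (auto simp: theta_like_def)
    moreover have "theta t = (\<lambda>z. c * theta_dual t z)" using c by auto
    ultimately show ?thesis using deriv_theta_dual[OF t] by (simp add: deriv_cmult)
  qed
  then show ?thesis by blast
qed

text \<open>The trace of the spin \<open>n / 2\<close> representation at eigenvalues
  \<open>exp z\<close> and \<open>exp (- z)\<close>. The sum, in contrast to the quotient of
  hyperbolic sines, is meaningful at the zeros of \<open>sinh\<close>.\<close>

definition char_value :: "nat \<Rightarrow> complex \<Rightarrow> complex" where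
  "char_value n z = (\<Sum>k\<le>n. exp ((2 * of_nat k - of_nat n) * z))"

text \<open>The weight is the square of the coefficient in the coherent state, divided by the
  dimension \<open>n + 1\<close> that orthogonality contributes;
  \<open>j * (j + 1) = n * (n + 2) / 4\<close> for \<open>j = n / 2\<close>.\<close>

definition char_series :: "real \<Rightarrow> complex \<Rightarrow> complex" where
  "char_series t z = (\<Sum>n. of_real (real (n + 1) * exp (- (t / 4) * (real n * real (n + 2)))) * char_value n z)"

lemma norm_char_value_le:
  assumes "\<bar>Re z\<bar> \<le> R"
  shows "norm (char_value n z) \<le> real (n + 1) * exp (R * real n)"
proof -
  have "norm (exp ((2 * of_nat k - of_nat n) * z)) \<le> exp (R * real n)" if "k \<le> n" for k
  proof -
    have "Re ((2 * of_nat k - of_nat n) * z) = (2 * real k - real n) * Re z" by simp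
    also have "\<dots> \<le> \<bar>2 * real k - real n\<bar> * \<bar>Re z\<bar>" by (metis abs_ge_self abs_mult)
    also have "\<dots> \<le> real n * R" using that assms by (intro mult_mono) auto
    finally show ?thesis by (simp add: mult.commute)
  qed
  then have "norm (char_value n z) \<le> of_nat (card {..n}) * exp (R * real n)"
    unfolding char_value_def by (intro sum_norm_bound) auto
  then show ?thesis by (simp add: add.commute)
qed

text \<open>The coefficient and the number of weights each contribute
  \<open>n + 1 \<le> exp n\<close>, hence the summand 2 next to \<open>R\<close>.\<close>

lemma norm_char_series_term_le:
  assumes t: "t > 0" and R: "\<bar>Re z\<bar> \<le> R"
  shows "norm (of_real (real (n + 1) * exp (- (t / 4) * (real n * real (n + 2)))) * char_value n z)
    \<le> exp (- (t / 4) * (real n)\<^sup>2 + (R + 2) * real n)"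
proof -
  have "norm (of_real (real (n + 1) * exp (- (t / 4) * (real n * real (n + 2)))) * char_value n z)
      = real (n + 1) * exp (- (t / 4) * (real n * real (n + 2))) * norm (char_value n z)"
    by (simp only: norm_mult norm_of_real abs_mult abs_of_nat abs_exp_cancel)
  also have "\<dots> \<le> exp (real n) * exp (- (t / 4) * (real n)\<^sup>2) * (exp (real n) * exp (R * real n))"
  proof (intro mult_mono order.trans[OF norm_char_value_le[OF R]])
    show "real (n + 1) \<le> exp (real n)" "real (n + 1) \<le> exp (real n)"
      using exp_ge_add_one_self[of "real n"] by (simp_all add: add.commute)
    show "exp (- (t / 4) * (real n * real (n + 2))) \<le> exp (- (t / 4) * (real n)\<^sup>2)"
      using t by (simp add: power2_eq_square algebra_simps)
  qed auto
  also have "\<dots> = exp (- (t / 4) * (real n)\<^sup>2 + (R + 2) * real n)"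
    by (simp add: exp_add[symmetric] algebra_simps)
  finally show ?thesis .
qed

lemma summable_char_series:
  "t > 0 \<Longrightarrow> summable (\<lambda>n. of_real (real (n + 1) * exp (- (t / 4) * (real n * real (n + 2)))) * char_value n z)"
  by (rule summable_comparison_test'[OF summable_gauss[of t "\<bar>Re z\<bar> + 2"], of 0])
     (use norm_char_series_term_le[of t z "\<bar>Re z\<bar>"] in auto)

lemma isCont_char_series:
  assumes t: "t > 0" shows "isCont (char_series t) z"
proof -
  have "(char_series t has_field_derivative (\<Sum>n. deriv (\<lambda>z. of_real (real (n + 1) * exp (- (t / 4) * (real n * real (n + 2)))) * char_value n z) z)) (at z)"
    unfolding char_series_def[abs_def]
  proof (rule holomorphic_series_deriv)
    show "(\<lambda>z. of_real (real (n + 1) * exp (- (t / 4) * (real n * real (n + 2)))) * char_value n z) holomorphic_on UNIV" for n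
      unfolding char_value_def by (intro holomorphic_intros)
    show "summable (\<lambda>n. exp (- (t / 4) * (real n)\<^sup>2 + (R + 2) * real n))" for R by (rule summable_gauss[OF t])
  qed (rule norm_char_series_term_le[OF t])
  then show ?thesis by (rule DERIV_isCont)
qed

lemma char_value_sinh: "char_value n z * (2 * sinh z) = exp (of_nat (n + 1) * z) - exp (- (of_nat (n + 1) * z))"
proof -
  define f where "f k = exp ((2 * of_nat k - of_nat n - 1) * z)" for k
  have "char_value n z * (2 * sinh z) = (\<Sum>k\<le>n. f (Suc k) - f k)"
    unfolding char_value_def sum_distrib_right
    by (intro sum.cong refl)
      (simp add: f_def sinh_field_def right_diff_distrib exp_add[symmetric] exp_diff algebra_simps,
       simp add: exp_add exp_diff exp_minus field_simps)
  also have "\<dots> = f (Suc n) - f 0" by (simp only: lessThan_Suc_atMost[symmetric] sum_lessThan_telescope)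
  also have "f (Suc n) = exp (of_nat (n + 1) * z)"
    unfolding f_def by (rule arg_cong[of _ _ exp]) (simp add: algebra_simps)
  also have "f 0 = exp (- (of_nat (n + 1) * z))"
    unfolding f_def by (rule arg_cong[of _ _ exp]) (simp add: algebra_simps)
  finally show ?thesis .
qed

text \<open>With \<open>N = n + 1\<close> one has \<open>n * (n + 2) = N^2 - 1\<close>: the weights
  are Gaussian up to the factor \<open>exp (t / 4)\<close>, and
  \<open>exp (N * z) - exp (- N * z)\<close> collects the terms \<open>N\<close> and
  \<open>- N\<close> of the differentiated theta series.\<close>

lemma char_series_sinh:
  assumes t: "t > 0"
  shows "char_series t z * (2 * sinh z) = of_real (exp (t / 4)) * deriv (theta t) z"
proof -
  let ?c = "\<lambda>n. complex_of_real (real (n + 1) * exp (- (t / 4) * (real n * real (n + 2))))"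
  have "(\<lambda>n. ?c n * char_value n z * (2 * sinh z)) sums (char_series t z * (2 * sinh z))"
    unfolding char_series_def by (intro sums_mult2 summable_sums summable_char_series t)
  moreover
  have sA: "(\<lambda>n. of_nat n * theta_term t z (int n)) sums (\<Sum>n. of_nat n * theta_term t z (int n))"
    by (rule summable_sums, rule summable_norm_cancel, rule summable_weighted_imp(2), rule summable_theta_weighted[OF t])
  have sB: "(\<lambda>n. of_nat n * theta_term t z (- int n)) sums (\<Sum>n. of_nat n * theta_term t z (- int n))"
    by (rule summable_sums, rule summable_norm_cancel, rule summable_weighted_imp(2), rule summable_theta_weighted[OF t])
  have "(\<lambda>n. of_nat n * theta_term t z (int n) - of_nat n * theta_term t z (- int n)) sums deriv (theta t) z"
    unfolding DERIV_imp_deriv[OF theta_has_field_derivative[OF t]] by (intro sums_diff sA sB)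
  then have "(\<lambda>n. of_nat (Suc n) * theta_term t z (int (Suc n)) - of_nat (Suc n) * theta_term t z (- int (Suc n))) sums deriv (theta t) z"
    by (subst sums_Suc_iff) simp
  then have "(\<lambda>n. of_real (exp (t / 4)) * (of_nat (Suc n) * theta_term t z (int (Suc n)) - of_nat (Suc n) * theta_term t z (- int (Suc n))))
      sums (of_real (exp (t / 4)) * deriv (theta t) z)" by (rule sums_mult)
  moreover have "of_real (exp (t / 4)) * (of_nat (Suc n) * theta_term t z (int (Suc n)) - of_nat (Suc n) * theta_term t z (- int (Suc n)))
      = ?c n * char_value n z * (2 * sinh z)" for n
  proof -
    have e: "- (t / 4) * (real n * real (n + 2)) = t / 4 + - (t / 4) * (real (Suc n))\<^sup>2"
      by (simp add: power2_eq_square algebra_simps)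
    show ?thesis
      unfolding mult.assoc char_value_sinh e exp_add of_real_mult theta_term_def
      by (simp add: exp_of_real[symmetric] algebra_simps power2_eq_square)
  qed
  ultimately show ?thesis using sums_unique2 by force
qed

section \<open>Estimates for the dual series\<close>

text \<open>The constant is generous: \<open>decay t < 1\<close> forces \<open>exp (- 1 / (2 t)) < 1 / 500\<close>, so that the geometric
  tails below are at most twice their first term.\<close>

definition decay :: "real \<Rightarrow> real" where
  "decay t = 500 * exp (- 1 / (2 * t))"

text \<open>Half of the exponent pays for the linear factor:
  \<open>y \<le> (1 + y / 4)^2 \<le> exp (y / 2)\<close>, the first step because
  \<open>(1 - y / 4)^2 \<ge> 0\<close>. The numbers 2 and 160 majorize the coefficients in
  \<open>norm_gauss_term_pair_le\<close>, since \<open>16 * pi^2 \<le> 160\<close>.\<close>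

lemma gauss_tail_term_le:
  fixes t y :: real
  assumes t: "t > 0" and y: "(real n + 1) / t \<le> y"
  shows "exp (- y) * (2 + 160 * y) \<le> 162 * exp (- 1 / (2 * t)) ^ Suc n"
proof -
  have y0: "y \<ge> 0" using y t by (meson divide_nonneg_pos le_add_same_cancel2 of_nat_0_le_iff order_trans zero_le_one add_nonneg_nonneg)
  have "(1 + y / 4)\<^sup>2 \<le> (exp (y / 4))\<^sup>2"
    using y0 by (intro power_mono exp_ge_add_one_self) auto
  also have "\<dots> = exp (y / 2)" by (simp add: exp_of_nat_mult[symmetric])
  finally have "y \<le> exp (y / 2)" using sum_squares_ge_zero[of "1 - y / 4" 0] by (simp add: power2_eq_square algebra_simps)
  moreover have "1 \<le> exp (y / 2)" using y0 by simp
  ultimately have "2 + 160 * y \<le> 162 * exp (y / 2)" by linarith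
  then have "exp (- y) * (2 + 160 * y) \<le> exp (- y) * (162 * exp (y / 2))" by (intro mult_left_mono) auto
  also have "\<dots> = 162 * exp (- y / 2)" by (simp add: exp_add[symmetric])
  also have "exp (- y / 2) \<le> exp (- (((real n + 1) / t) / 2))" using divide_right_mono[OF y, of 2] by simp
  also have "\<dots> = exp (- 1 / (2 * t)) ^ Suc n"
    unfolding exp_of_nat_mult[symmetric] using t by (simp add: field_simps)
  finally show ?thesis by simp
qed

lemma norm_suminf_decay_le:
  fixes f :: "nat \<Rightarrow> complex"
  assumes t: "decay t < 1" and A: "A \<ge> 0"
    and le: "\<And>n. norm (f n) \<le> A * (162 * exp (- 1 / (2 * t)) ^ Suc n)"
  shows "norm (suminf f) \<le> A * decay t"
proof -
  define r where "r = exp (- 1 / (2 * t))"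
  have r: "0 < r" "r < 1 / 500" using t by (auto simp: r_def decay_def)
  have s: "summable (\<lambda>n. r ^ n)" using r by (intro summable_geometric) auto
  have sums: "(\<lambda>n. A * (162 * r ^ Suc n)) sums (A * (162 * (r * (1 / (1 - r)))))"
    unfolding power_Suc using r by (intro sums_mult geometric_sums) auto
  have "norm (suminf f) \<le> (\<Sum>n. A * (162 * r ^ Suc n))"
    using sums le by (intro norm_suminf_le) (auto simp: r_def sums_iff)
  also have "\<dots> = A * (162 * (r * (1 / (1 - r))))" using sums by (simp add: sums_iff)
  also have "\<dots> \<le> A * (500 * r)"
  proof (intro mult_left_mono A)
    have "1 / (1 - r) \<le> 2" using r by (simp add: field_simps)
    then have "r * (1 / (1 - r)) \<le> r * 2" using r by (intro mult_left_mono) auto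
    then show "162 * (r * (1 / (1 - r))) \<le> 500 * r" using r by linarith
  qed
  finally show ?thesis by (simp add: decay_def r_def)
qed

lemma norm_cos_le: "norm (cos z) \<le> exp \<bar>Im z\<bar>" for z :: complex
  using norm_cosh_le[of "\<i> * z"] by (simp add: cosh_conv_cos)

text \<open>Mean value estimate on the convex strip
  \<open>\<bar>Im w\<bar> \<le> \<bar>Im z\<bar>\<close>. The factor \<open>norm z\<close> is what
  allows a pair of Gaussian terms to be compared with the leading term near
  \<open>z = 0\<close>.\<close>

lemma norm_sin_le: "norm (sin z) \<le> exp \<bar>Im z\<bar> * norm z" for z :: complex
proof -
  let ?S = "{w. \<bar>Im w\<bar> \<le> \<bar>Im z\<bar>}"
  have "?S = {w. Im w \<le> \<bar>Im z\<bar>} \<inter> {w. Im w \<ge> - \<bar>Im z\<bar>}" by auto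
  then have "convex ?S" by (metis convex_Int convex_halfspace_Im_ge convex_halfspace_Im_le)
  then have "norm (sin z - sin 0) \<le> exp \<bar>Im z\<bar> * norm (z - 0)"
  proof (rule field_differentiable_bound[where f' = cos])
    show "(sin has_field_derivative cos w) (at w within ?S)" for w :: complex
      by (rule has_field_derivative_at_within[OF DERIV_sin])
    show "norm (cos w) \<le> exp \<bar>Im z\<bar>" if "w \<in> ?S" for w
      using norm_cos_le[of w] that by (auto intro: order.trans)
  qed auto
  then show ?thesis by simp
qed

text \<open>The two squares differ only in the sign of the cross term
  \<open>2 * pi * \<i> * m * z\<close>, so Euler's formula applies to both; the result is odd in
  \<open>z\<close>.\<close>

lemma gauss_term_pair:
  assumes t: "t > 0"
  shows "gauss_term t z m + gauss_term t z (- m) =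
    exp ((z\<^sup>2 - of_real ((pi * m)\<^sup>2)) / of_real t) *
      (2 * z * cos (of_real (2 * pi * m / t) * z) - of_real (2 * pi * m) * sin (of_real (2 * pi * m / t) * z))"
proof -
  define a where "a = of_real (2 * pi * m / t) * z"
  define E where "E = exp ((z\<^sup>2 - of_real ((pi * m)\<^sup>2)) / of_real t)"
  have "(z + \<i> * of_real (pi * m))\<^sup>2 / of_real t = (z\<^sup>2 - of_real ((pi * m)\<^sup>2)) / of_real t + \<i> * a"
    using t by (simp add: a_def power2_eq_square field_simps)
  then have 1: "gauss_term t z m = (z + \<i> * of_real (pi * m)) * (E * (cos a + \<i> * sin a))"
    unfolding gauss_term_def E_def by (simp only: exp_add exp_Euler)
  have "(z + \<i> * of_real (pi * (- m)))\<^sup>2 / of_real t = (z\<^sup>2 - of_real ((pi * m)\<^sup>2)) / of_real t + \<i> * (- a)"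
    using t by (simp add: a_def power2_eq_square field_simps)
  then have 2: "gauss_term t z (- m) = (z + \<i> * of_real (pi * (- m))) * (E * (cos (- a) + \<i> * sin (- a)))"
    unfolding gauss_term_def E_def by (simp only: exp_add exp_Euler)
  show ?thesis unfolding 1 2 a_def[symmetric] E_def[symmetric]
    by (simp add: algebra_simps)
qed

text \<open>The cross term costs at most \<open>exp (2 * pi * m * \<bar>Im z\<bar> / t)\<close>, and
  \<open>norm_sin_le\<close> turns the sine into the summand
  \<open>4 * (pi * m)^2 / t\<close>.\<close>

lemma norm_gauss_term_pair_le:
  assumes t: "t > 0" and m: "m \<ge> 0"
  shows "norm (gauss_term t z m + gauss_term t z (- m)) \<le>
    norm z * exp (((Re z)\<^sup>2 - (Im z)\<^sup>2) / t) *
      (exp (- ((pi * m)\<^sup>2 - 2 * (pi * m) * \<bar>Im z\<bar>) / t) * (2 + 4 * (pi * m)\<^sup>2 / t))"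
proof -
  define a where "a = of_real (2 * pi * m / t) * z"
  have Ia: "\<bar>Im a\<bar> = 2 * (pi * m) * \<bar>Im z\<bar> / t" using t m by (simp add: a_def abs_mult)
  have na: "norm a = 2 * pi * m / t * norm z" using t m by (simp add: a_def norm_mult norm_divide)
  have "norm (2 * z * cos a - of_real (2 * pi * m) * sin a) \<le> norm (2 * z * cos a) + norm (of_real (2 * pi * m) * sin a)"
    by (rule norm_triangle_ineq4)
  also have "\<dots> \<le> 2 * norm z * exp \<bar>Im a\<bar> + 2 * pi * m * (exp \<bar>Im a\<bar> * norm a)"
    unfolding norm_mult norm_of_real using m
    by (intro add_mono mult_mono mult_left_mono norm_cos_le norm_sin_le mult_nonneg_nonneg) auto
  also have "\<dots> = norm z * exp \<bar>Im a\<bar> * (2 + 4 * (pi * m)\<^sup>2 / t)"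
    unfolding na using t by (simp add: field_simps power2_eq_square)
  finally have le: "norm (2 * z * cos a - of_real (2 * pi * m) * sin a) \<le> norm z * exp \<bar>Im a\<bar> * (2 + 4 * (pi * m)\<^sup>2 / t)" .
  have "norm (exp ((z\<^sup>2 - of_real ((pi * m)\<^sup>2)) / of_real t)) = exp (((Re z)\<^sup>2 - (Im z)\<^sup>2 - (pi * m)\<^sup>2) / t)"
    by (simp add: Re_power2 del: of_real_power of_real_mult)
  then have "norm (gauss_term t z m + gauss_term t z (- m)) \<le>
      exp (((Re z)\<^sup>2 - (Im z)\<^sup>2 - (pi * m)\<^sup>2) / t) * (norm z * exp \<bar>Im a\<bar> * (2 + 4 * (pi * m)\<^sup>2 / t))"
    unfolding gauss_term_pair[OF t] norm_mult[of "exp _"] a_def[symmetric]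
    using le by (intro mult_mono) auto
  also have "\<dots> = norm z * (exp (((Re z)\<^sup>2 - (Im z)\<^sup>2 - (pi * m)\<^sup>2) / t) * exp \<bar>Im a\<bar>) * (2 + 4 * (pi * m)\<^sup>2 / t)"
    by (simp only: mult_ac)
  also have "exp (((Re z)\<^sup>2 - (Im z)\<^sup>2 - (pi * m)\<^sup>2) / t) * exp \<bar>Im a\<bar> =
      exp (((Re z)\<^sup>2 - (Im z)\<^sup>2) / t) * exp (- ((pi * m)\<^sup>2 - 2 * (pi * m) * \<bar>Im z\<bar>) / t)"
    unfolding Ia exp_add[symmetric] by (rule arg_cong[of _ _ exp]) (simp add: diff_divide_distrib add_divide_distrib)
  finally show ?thesis by (simp only: mult.assoc)
qed

lemma pi_bounds: "9 \<le> pi * pi" "pi * pi \<le> 10"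
proof -
  have "3 * 3 \<le> pi * pi" using pi_gt3 by (intro mult_mono) auto
  then show "9 \<le> pi * pi" by simp
  have "pi \<le> 3.15" using pi_approx by simp
  then have "pi * pi \<le> 3.15 * 3.15" by (intro mult_mono) auto
  then show "pi * pi \<le> 10" by simp
qed

lemma gauss_series_near:
  assumes t: "t > 0" "decay t < 1" and z: "\<bar>Im z\<bar> \<le> 31 * pi / 32"
  shows "norm (gauss_series t z - z * exp (z\<^sup>2 / of_real t)) \<le>
    norm z * exp (((Re z)\<^sup>2 - (Im z)\<^sup>2) / t) * decay t"
proof -
  define f where "f n = gauss_term t z (2 * real (Suc n)) + gauss_term t z (- (2 * real (Suc n)))" for n
  have s1: "(\<lambda>n. gauss_term t z (2 * real (Suc n))) sums ((\<Sum>n. gauss_term t z (2 * real n)) - gauss_term t z 0)"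
    using summable_sums[OF summable_gauss_term(1)[OF t(1), of z]] by (subst sums_Suc_iff) simp
  have s2: "(\<lambda>n. gauss_term t z (- (2 * real (Suc n)))) sums (\<Sum>n. gauss_term t z (- 2 * real (Suc n)))"
    using summable_sums[OF summable_gauss_term(3)[OF t(1), of z]] by simp
  have "f sums (gauss_series t z - gauss_term t z 0)"
    unfolding f_def gauss_series_def using sums_add[OF s1 s2] by (simp add: algebra_simps)
  then have eq: "gauss_series t z - z * exp (z\<^sup>2 / of_real t) = suminf f"
    by (simp add: sums_iff gauss_term_def)
  show ?thesis unfolding eq
  proof (rule norm_suminf_decay_le[OF t(2)])
    fix n
    define k where "k = real (Suc n)"
    have k: "k \<ge> 1" by (simp add: k_def)
    have kk: "k \<le> k * k" using k by simp
    define P where "P = (pi * pi) * (k * k)"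
    define Q where "Q = pi * (k * \<bar>Im z\<bar>)"
    have "k * \<bar>Im z\<bar> \<le> k * (31 * pi / 32)" using z k by (intro mult_left_mono) auto
    then have "Q \<le> pi * (k * (31 * pi / 32))" unfolding Q_def by (rule mult_left_mono) simp
    also have "\<dots> = 31 / 32 * (pi * pi) * k" by simp
    also have "\<dots> \<le> 31 / 32 * (pi * pi) * (k * k)" using kk by (intro mult_left_mono) auto
    finally have 1: "Q \<le> 31 / 32 * P" by (simp add: P_def mult.assoc)
    have 2: "9 * (k * k) \<le> P" unfolding P_def using pi_bounds by (intro mult_right_mono) auto
    have 3: "P \<le> 10 * (k * k)" unfolding P_def using pi_bounds by (intro mult_right_mono) auto
    have e: "(pi * (2 * k))\<^sup>2 = 4 * P" "2 * (pi * (2 * k)) * \<bar>Im z\<bar> = 4 * Q"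
      by (simp_all add: power2_eq_square P_def Q_def)
    \<comment> \<open>Here 31/32 is used:
      \<open>4 * P - 4 * Q \<ge> P / 8 \<ge> 9 / 8 * (k * k)\<close>.\<close>
    have "k * k \<le> 4 * P - 4 * Q" using 1 2 k kk by linarith
    then have a: "- ((pi * (2 * k))\<^sup>2 - 2 * (pi * (2 * k)) * \<bar>Im z\<bar>) / t \<le> - (k * k / t)"
      unfolding minus_divide_left[symmetric] neg_le_iff_le e using t by (intro divide_right_mono) auto
    have "4 * (pi * (2 * k))\<^sup>2 / t \<le> 160 * (k * k) / t" unfolding e using 3 t by (intro divide_right_mono) auto
    then have b: "2 + 4 * (pi * (2 * k))\<^sup>2 / t \<le> 2 + 160 * (k * k / t)" by simp
    have c: "exp (- ((pi * (2 * k))\<^sup>2 - 2 * (pi * (2 * k)) * \<bar>Im z\<bar>) / t) * (2 + 4 * (pi * (2 * k))\<^sup>2 / t)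
        \<le> exp (- (k * k / t)) * (2 + 160 * (k * k / t))"
      using a b t by (intro mult_mono) (auto intro!: add_nonneg_nonneg)
    also have "\<dots> \<le> 162 * exp (- 1 / (2 * t)) ^ Suc n"
      by (rule gauss_tail_term_le[OF t(1)]) (use kk t in \<open>simp add: k_def divide_right_mono add.commute\<close>)
    finally have d: "exp (- ((pi * (2 * k))\<^sup>2 - 2 * (pi * (2 * k)) * \<bar>Im z\<bar>) / t) * (2 + 4 * (pi * (2 * k))\<^sup>2 / t)
        \<le> 162 * exp (- 1 / (2 * t)) ^ Suc n" .
    have "norm (f n) \<le> norm z * exp (((Re z)\<^sup>2 - (Im z)\<^sup>2) / t) *
      (exp (- ((pi * (2 * k))\<^sup>2 - 2 * (pi * (2 * k)) * \<bar>Im z\<bar>) / t) * (2 + 4 * (pi * (2 * k))\<^sup>2 / t))"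
      unfolding f_def k_def[symmetric] using k by (intro norm_gauss_term_pair_le t) auto
    also have "\<dots> \<le> norm z * exp (((Re z)\<^sup>2 - (Im z)\<^sup>2) / t) * (162 * exp (- 1 / (2 * t)) ^ Suc n)"
      by (intro mult_left_mono d) auto
    finally show "norm (f n) \<le> norm z * exp (((Re z)\<^sup>2 - (Im z)\<^sup>2) / t) * (162 * exp (- 1 / (2 * t)) ^ Suc n)" .
  qed auto
qed

text \<open>The factor \<open>exp (1 / t)\<close> gives the leading pair, which has no decay of its
  own, the same form as the term \<open>m = 1\<close> of a sequence \<open>exp (- m^2 / t)\<close>,
  so that the tail estimate of the other case applies.\<close>

lemma gauss_series_far:
  assumes t: "t > 0" "decay t < 1" and z: "31 * pi / 32 \<le> Im z" "Im z \<le> pi"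
  shows "norm (gauss_series t z) \<le>
    norm (z - \<i> * of_real pi) * exp (((Re z)\<^sup>2 - (Im z)\<^sup>2) / t) * exp (1 / t) * decay t"
proof -
  define w where "w = z - \<i> * of_real pi"
  define f where "f n = gauss_term t w (2 * real n + 1) + gauss_term t w (- (2 * real n + 1))" for n
  have "gauss_term t z (2 * real n) = gauss_term t w (2 * real n + 1)" for n
    by (simp add: gauss_term_def w_def algebra_simps)
  moreover have "gauss_term t z (- 2 * real (Suc n)) = gauss_term t w (- (2 * real n + 1))" for n
    by (simp add: gauss_term_def w_def algebra_simps)
  ultimately have eq: "gauss_series t z = suminf f"
    unfolding gauss_series_def f_def
    using suminf_add[OF summable_gauss_term(1)[OF t(1), of z] summable_gauss_term(3)[OF t(1), of z]] by simp
  show ?thesis unfolding eq w_def[symmetric]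
  proof (rule norm_suminf_decay_le[OF t(2)])
    fix n
    define m where "m = 2 * real n + 1"
    define h where "h = pi - Im z"
    have h: "0 \<le> h" "h \<le> pi / 32" "\<bar>Im w\<bar> = h" "Re w = Re z" "Im w = - h" "Im z = pi - h"
      using z by (auto simp: h_def w_def)
    have m: "m \<ge> 1" by (simp add: m_def)
    have mm: "real n + 1 \<le> m * m" by (simp add: m_def algebra_simps)
    have 3: "(pi * pi) * (m * m) \<le> 10 * (m * m)" using pi_bounds by (intro mult_right_mono) auto
    have "2 * pi * h \<le> 2 * pi * (pi / 32)" using h by (intro mult_left_mono) auto
    then have ph: "2 * pi * h \<le> pi * pi / 16" by simp
    define X P Q where "X = (pi * pi) * (m + 1)" and "P = pi * pi" and "Q = 2 * pi * h"
    have "P * 2 \<le> X" unfolding X_def P_def using m by (intro mult_left_mono) auto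
    moreover have "9 * (m + 1) \<le> X" unfolding X_def using pi_bounds m by (intro mult_right_mono) auto
    moreover have "Q \<le> P / 16" using ph by (simp add: P_def Q_def)
    moreover have "P \<le> 10" using pi_bounds by (simp add: P_def)
    moreover from calculation have "Q \<le> X / 32" by simp
    moreover from calculation have "m + 1 \<le> X / 9" "0 \<le> X" using m by simp_all
    ultimately have "0 \<le> X - Q - (m + 1)" by linarith
    then have "0 \<le> (pi * pi) * (m + 1) - 2 * pi * h - (m + 1)" by (simp add: X_def Q_def)
    \<comment> \<open>Measured against \<open>(Re z)^2 - (Im z)^2\<close>, the exponent of the pair
      \<open>m\<close> is \<open>- (m - 1) * (pi^2 * (m + 1) - 2 * pi * h)\<close>. It has to lie
      below \<open>1 - m^2 = - (m - 1) * (m + 1)\<close>, with equality for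
      \<open>m = 1\<close>.\<close>
    then have "0 \<le> (m - 1) * ((pi * pi) * (m + 1) - 2 * pi * h - (m + 1))" using m by (intro mult_nonneg_nonneg) auto
    then have i: "(Re w)\<^sup>2 - (Im w)\<^sup>2 - ((pi * m)\<^sup>2 - 2 * (pi * m) * \<bar>Im w\<bar>) \<le> (Re z)\<^sup>2 - (Im z)\<^sup>2 + 1 - m * m"
      unfolding h(3) unfolding h(4-6) by (simp add: power2_eq_square algebra_simps)
    have "exp (((Re w)\<^sup>2 - (Im w)\<^sup>2) / t) * exp (- ((pi * m)\<^sup>2 - 2 * (pi * m) * \<bar>Im w\<bar>) / t)
       = exp (((Re w)\<^sup>2 - (Im w)\<^sup>2 - ((pi * m)\<^sup>2 - 2 * (pi * m) * \<bar>Im w\<bar>)) / t)"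
      unfolding exp_add[symmetric] by (rule arg_cong[of _ _ exp]) (simp add: diff_divide_distrib add_divide_distrib)
    also have "\<dots> \<le> exp (((Re z)\<^sup>2 - (Im z)\<^sup>2 + 1 - m * m) / t)"
      unfolding exp_le_cancel_iff using i t by (intro divide_right_mono) auto
    also have "\<dots> = exp (((Re z)\<^sup>2 - (Im z)\<^sup>2) / t) * exp (1 / t) * exp (- (m * m / t))"
      unfolding exp_add[symmetric] by (rule arg_cong[of _ _ exp]) (simp add: diff_divide_distrib add_divide_distrib)
    finally have a: "exp (((Re w)\<^sup>2 - (Im w)\<^sup>2) / t) * exp (- ((pi * m)\<^sup>2 - 2 * (pi * m) * \<bar>Im w\<bar>) / t) \<le> \<dots>" .
    have "4 * (pi * m)\<^sup>2 / t = 4 * ((pi * pi) * (m * m)) / t" by (simp add: power2_eq_square)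
    also have "\<dots> \<le> 160 * (m * m) / t" using 3 t m by (intro divide_right_mono) auto
    finally have b: "2 + 4 * (pi * m)\<^sup>2 / t \<le> 2 + 160 * (m * m / t)" by simp
    have c: "exp (- (m * m / t)) * (2 + 160 * (m * m / t)) \<le> 162 * exp (- 1 / (2 * t)) ^ Suc n"
      by (rule gauss_tail_term_le[OF t(1)]) (use mm t in \<open>simp add: divide_right_mono\<close>)
    have "norm (f n) \<le> norm w * exp (((Re w)\<^sup>2 - (Im w)\<^sup>2) / t) *
      (exp (- ((pi * m)\<^sup>2 - 2 * (pi * m) * \<bar>Im w\<bar>) / t) * (2 + 4 * (pi * m)\<^sup>2 / t))"
      unfolding f_def m_def[symmetric] using m by (intro norm_gauss_term_pair_le t) auto
    also have "\<dots> = norm w * ((exp (((Re w)\<^sup>2 - (Im w)\<^sup>2) / t) * exp (- ((pi * m)\<^sup>2 - 2 * (pi * m) * \<bar>Im w\<bar>) / t)) * (2 + 4 * (pi * m)\<^sup>2 / t))"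
      by (simp only: mult.assoc)
    also have "\<dots> \<le> norm w * ((exp (((Re z)\<^sup>2 - (Im z)\<^sup>2) / t) * exp (1 / t) * exp (- (m * m / t))) * (2 + 160 * (m * m / t)))"
      using t by (intro mult_left_mono mult_mono a b) (auto intro!: add_nonneg_nonneg)
    also have "\<dots> = norm w * exp (((Re z)\<^sup>2 - (Im z)\<^sup>2) / t) * exp (1 / t) * (exp (- (m * m / t)) * (2 + 160 * (m * m / t)))"
      by (simp only: mult.assoc)
    also have "\<dots> \<le> norm w * exp (((Re z)\<^sup>2 - (Im z)\<^sup>2) / t) * exp (1 / t) * (162 * exp (- 1 / (2 * t)) ^ Suc n)"
      by (intro mult_left_mono c) auto
    finally show "norm (f n) \<le> norm w * exp (((Re z)\<^sup>2 - (Im z)\<^sup>2) / t) * exp (1 / t) * (162 * exp (- 1 / (2 * t)) ^ Suc n)" .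
  qed auto
qed

text \<open>The undetermined constant of the theta transformation goes into \<kappa>, which is the
  same for all \<open>z\<close>. The product with \<open>sinh z\<close> keeps the relation valid at
  the zeros of \<open>sinh\<close>.\<close>

lemma char_series_gauss_series:
  assumes t: "t > 0"
  obtains \<kappa> where "\<kappa> \<ge> 0" "\<And>z. norm (char_series t z) * norm (sinh z) = \<kappa> * norm (gauss_series t z)"
proof -
  obtain c where c: "\<And>z. deriv (theta t) z = c * gauss_series t z" using deriv_theta_eq_gauss_series[OF t] by blast
  have "norm (char_series t z) * norm (sinh z) = exp (t / 4) * norm c / 2 * norm (gauss_series t z)" for z
  proof -
    have "norm (char_series t z * (2 * sinh z)) = exp (t / 4) * (norm c * norm (gauss_series t z))"
      unfolding char_series_sinh[OF t] c by (simp add: norm_mult)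
    then show ?thesis by (simp add: norm_mult)
  qed
  then show ?thesis using that[of "exp (t / 4) * norm c / 2"] by simp
qed

lemma tendsto_norm_over_sinh: "((\<lambda>z :: complex. norm z / norm (sinh z)) \<longlongrightarrow> 1) (at 0)"
proof -
  have "(sinh has_field_derivative cosh (0 :: complex)) (at 0)" by (auto intro!: derivative_eq_intros)
  then have "((\<lambda>z :: complex. sinh z / z) \<longlongrightarrow> 1) (at 0)"
    by (simp add: has_field_derivative_iff)
  then have "((\<lambda>z :: complex. inverse (norm (sinh z / z))) \<longlongrightarrow> inverse (norm (1 :: complex))) (at 0)"
    by (intro tendsto_inverse tendsto_norm) auto
  then show ?thesis by (simp add: norm_divide)
qed

lemma tendsto_real_over_sinh: "((\<lambda>r :: real. r / sinh r) \<longlongrightarrow> 1) (at_right 0)"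
proof -
  have "(sinh has_field_derivative cosh (0 :: real)) (at 0)" by (auto intro!: derivative_eq_intros)
  then have "((\<lambda>z :: real. sinh z / z) \<longlongrightarrow> 1) (at 0)"
    by (simp add: has_field_derivative_iff)
  then have "((\<lambda>z :: real. inverse (sinh z / z)) \<longlongrightarrow> inverse 1) (at 0)"
    by (intro tendsto_inverse) auto
  then have "((\<lambda>z :: real. z / sinh z) \<longlongrightarrow> 1) (at 0)" by simp
  then show ?thesis by (rule tendsto_mono[OF at_le[OF subset_UNIV]])
qed

lemma char_series_tendsto:
  assumes t: "t > 0"
  shows "((\<lambda>r :: real. norm (char_series t (z + of_real r))) \<longlongrightarrow> norm (char_series t z)) (at_right 0)"
proof -
  have "((\<lambda>r :: real. z + of_real r) \<longlongrightarrow> z + of_real 0) (at_right 0)" by (intro tendsto_intros)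
  then have "((\<lambda>r :: real. z + of_real r) \<longlongrightarrow> z) (at_right 0)" by simp
  then show ?thesis using isCont_char_series[OF t, of z] by (intro tendsto_norm) (rule isCont_tendsto_compose)
qed

text \<open>The value 1 is the limit in the two situations that occur: \<open>w = z\<close> at the
  zero 0, and \<open>w = z - \<i> * pi\<close> at the zero \<open>\<i> * pi\<close>.\<close>

definition ratio_sinh :: "complex \<Rightarrow> complex \<Rightarrow> real" where
  "ratio_sinh w z = (if sinh z = 0 then 1 else norm w / norm (sinh z))"

lemma sinh_of_real_nonzero: "r > 0 \<Longrightarrow> sinh (complex_of_real r) \<noteq> 0" "norm (sinh (complex_of_real r)) = \<bar>sinh r\<bar>"
proof -
  have e: "sinh (complex_of_real r) = of_real (sinh r)"
    by (simp add: sinh_def sinh_field_def exp_of_real[symmetric] scaleR_conv_of_real)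
  show "r > 0 \<Longrightarrow> sinh (complex_of_real r) \<noteq> 0" unfolding e by simp
  show "norm (sinh (complex_of_real r)) = \<bar>sinh r\<bar>" unfolding e by simp
qed

lemma sinh_eq_0_imp:
  assumes "sinh (z :: complex) = 0"
  obtains n :: int where "Re z = 0" "Im z = of_int n * pi"
proof -
  have "exp z = exp (- z)" using assms by (simp add: sinh_field_def)
  then have "exp z * exp z = exp (- z) * exp z" by simp
  then have "exp (z + z) = 1" unfolding exp_add[symmetric] by simp
  then show ?thesis using that unfolding exp_eq_1 by auto
qed

lemma sinh_eq_0_near:
  assumes "sinh (z :: complex) = 0" "0 \<le> Im z" "Im z < pi"
  shows "z = 0"
proof -
  obtain n :: int where n: "Re z = 0" "Im z = of_int n * pi" using sinh_eq_0_imp[OF assms(1)] .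
  have "0 \<le> real_of_int n" "real_of_int n < 1"
    using assms(2,3) n(2) pi_gt_zero by (simp_all add: zero_le_mult_iff)
  then have "n = 0" by linarith
  then show ?thesis using n by (simp add: complex_eq_iff)
qed

lemma sinh_eq_0_far:
  assumes "sinh (z :: complex) = 0" "0 < Im z" "Im z \<le> pi"
  shows "z = \<i> * of_real pi"
proof -
  obtain n :: int where n: "Re z = 0" "Im z = of_int n * pi" using sinh_eq_0_imp[OF assms(1)] .
  have "0 < real_of_int n" "real_of_int n \<le> 1"
    using assms(2,3) n(2) pi_gt_zero by (simp_all add: zero_less_mult_iff)
  then have "n = 1" by linarith
  then show ?thesis using n by (simp add: complex_eq_iff)
qed

text \<open>A single \<kappa> occurs in all three bounds, so that it cancels in the overlap. The
  lower bound is a reverse triangle inequality at real points, where the norms of the states are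
  evaluated.\<close>

lemma char_series_bounds:
  assumes t: "t > 0" "decay t < 1"
  obtains \<kappa> where "\<kappa> \<ge> 0"
    and "\<And>p. p \<ge> 0 \<Longrightarrow> \<kappa> * x_over_sinh p * exp (p\<^sup>2 / t) * (1 - decay t) \<le> norm (char_series t (of_real p))"
    and "\<And>z. 0 \<le> Im z \<Longrightarrow> Im z \<le> 31 * pi / 32 \<Longrightarrow>
      norm (char_series t z) \<le> \<kappa> * ratio_sinh z z * exp (((Re z)\<^sup>2 - (Im z)\<^sup>2) / t) * (1 + decay t)"
    and "\<And>z. 31 * pi / 32 \<le> Im z \<Longrightarrow> Im z \<le> pi \<Longrightarrow>
      norm (char_series t z) \<le> \<kappa> * ratio_sinh (z - \<i> * of_real pi) z *
        exp (((Re z)\<^sup>2 - (Im z)\<^sup>2) / t) * exp (1 / t) * decay t"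
proof -
  obtain \<kappa> where k: "\<kappa> \<ge> 0" "\<And>z. norm (char_series t z) * norm (sinh z) = \<kappa> * norm (gauss_series t z)"
    using char_series_gauss_series[OF t(1)] by blast
  have cs: "norm (char_series t z) = \<kappa> * norm (gauss_series t z) / norm (sinh z)" if "sinh z \<noteq> 0" for z
    using k(2)[of z] that by (simp add: field_simps)
  have nz: "norm (z * exp (z\<^sup>2 / of_real t)) = norm z * exp (((Re z)\<^sup>2 - (Im z)\<^sup>2) / t)" for z
    by (simp add: norm_mult Re_power2)
  have low: "\<kappa> * (p / sinh p) * exp (p\<^sup>2 / t) * (1 - decay t) \<le> norm (char_series t (of_real p))" if p: "p > 0" for p
  proof -
    have "norm (gauss_series t (of_real p)) \<ge> p * exp (p\<^sup>2 / t) * (1 - decay t)"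
      using gauss_series_near[OF t, of "of_real p"] nz[of "of_real p"] p
        norm_triangle_ineq2[of "of_real p * exp ((of_real p)\<^sup>2 / complex_of_real t)" "gauss_series t (of_real p)"]
      by (simp add: norm_minus_commute algebra_simps)
    then have "\<kappa> * (p * exp (p\<^sup>2 / t) * (1 - decay t)) / sinh p \<le> \<kappa> * norm (gauss_series t (of_real p)) / sinh p"
      using k(1) p by (intro divide_right_mono mult_left_mono) auto
    then show ?thesis using cs[OF sinh_of_real_nonzero(1)[OF p]] sinh_of_real_nonzero(2)[of p] p by (simp add: mult.assoc)
  qed
  have up1: "norm (char_series t z) \<le> \<kappa> * (norm z / norm (sinh z)) * exp (((Re z)\<^sup>2 - (Im z)\<^sup>2) / t) * (1 + decay t)"
    if z: "0 \<le> Im z" "Im z \<le> 31 * pi / 32" "sinh z \<noteq> 0" for z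
  proof -
    have "norm (gauss_series t z) \<le> norm z * exp (((Re z)\<^sup>2 - (Im z)\<^sup>2) / t) * (1 + decay t)"
      using gauss_series_near[OF t, of z] nz[of z] z
        norm_triangle_sub[of "gauss_series t z" "z * exp (z\<^sup>2 / of_real t)"]
      by (simp add: algebra_simps)
    then have "\<kappa> * norm (gauss_series t z) / norm (sinh z) \<le> \<kappa> * (norm z * exp (((Re z)\<^sup>2 - (Im z)\<^sup>2) / t) * (1 + decay t)) / norm (sinh z)"
      using k(1) by (intro divide_right_mono mult_left_mono) auto
    then show ?thesis using cs[OF z(3)] by (simp add: mult.assoc)
  qed
  have up2: "norm (char_series t z) \<le> \<kappa> * (norm (z - \<i> * of_real pi) / norm (sinh z)) * exp (((Re z)\<^sup>2 - (Im z)\<^sup>2) / t) * exp (1 / t) * decay t"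
    if z: "31 * pi / 32 \<le> Im z" "Im z \<le> pi" "sinh z \<noteq> 0" for z
  proof -
    have "\<kappa> * norm (gauss_series t z) / norm (sinh z) \<le> \<kappa> * (norm (z - \<i> * of_real pi) * exp (((Re z)\<^sup>2 - (Im z)\<^sup>2) / t) * exp (1 / t) * decay t) / norm (sinh z)"
      using k(1) gauss_series_far[OF t z(1,2)] by (intro divide_right_mono mult_left_mono) auto
    then show ?thesis using cs[OF z(3)] by (simp add: mult.assoc)
  qed
  txt \<open>At the zeros of \<open>sinh\<close> the bounds extend by continuity along \<open>z + r\<close>, \<open>r \<rightarrow> 0\<close>, which keeps
    the imaginary part fixed.\<close>
  have pos: "\<forall>\<^sub>F r :: real in at_right 0. r > 0" by (rule eventually_at_right_less)
  have low0: "\<kappa> * (1 - decay t) \<le> norm (char_series t 0)"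
  proof (rule tendsto_le[OF trivial_limit_at_right_real])
    show "((\<lambda>r. norm (char_series t (0 + of_real r))) \<longlongrightarrow> norm (char_series t 0)) (at_right 0)"
      by (rule char_series_tendsto[OF t(1)])
    have "((\<lambda>r :: real. \<kappa> * (r / sinh r) * exp (r\<^sup>2 / t) * (1 - decay t)) \<longlongrightarrow> \<kappa> * 1 * exp (0\<^sup>2 / t) * (1 - decay t)) (at_right 0)"
      using t by (intro tendsto_intros tendsto_real_over_sinh) auto
    then show "((\<lambda>r :: real. \<kappa> * (r / sinh r) * exp (r\<^sup>2 / t) * (1 - decay t)) \<longlongrightarrow> \<kappa> * (1 - decay t)) (at_right 0)" by simp
    show "\<forall>\<^sub>F r in at_right 0. \<kappa> * (r / sinh r) * exp (r\<^sup>2 / t) * (1 - decay t) \<le> norm (char_series t (0 + of_real r))"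
      using pos by eventually_elim (use low in simp)
  qed
  have up10: "norm (char_series t 0) \<le> \<kappa> * (1 + decay t)"
  proof (rule tendsto_le[OF trivial_limit_at_right_real])
    show "((\<lambda>r. norm (char_series t (0 + of_real r))) \<longlongrightarrow> norm (char_series t 0)) (at_right 0)"
      by (rule char_series_tendsto[OF t(1)])
    have "((\<lambda>r :: real. \<kappa> * (r / sinh r) * exp (r\<^sup>2 / t) * (1 + decay t)) \<longlongrightarrow> \<kappa> * 1 * exp (0\<^sup>2 / t) * (1 + decay t)) (at_right 0)"
      using t by (intro tendsto_intros tendsto_real_over_sinh) auto
    then show "((\<lambda>r :: real. \<kappa> * (r / sinh r) * exp (r\<^sup>2 / t) * (1 + decay t)) \<longlongrightarrow> \<kappa> * (1 + decay t)) (at_right 0)" by simp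
    show "\<forall>\<^sub>F r in at_right 0. norm (char_series t (0 + of_real r)) \<le> \<kappa> * (r / sinh r) * exp (r\<^sup>2 / t) * (1 + decay t)"
      using pos
    proof eventually_elim
      case (elim r)
      then show ?case using up1[of "of_real r"] sinh_of_real_nonzero[of r] by simp
    qed
  qed
  define D where "D = exp ((- (pi\<^sup>2)) / t) * exp (1 / t) * decay t"
  have up20: "norm (char_series t (\<i> * of_real pi)) \<le> \<kappa> * D"
  proof (rule tendsto_le[OF trivial_limit_at_right_real])
    show "((\<lambda>r. norm (char_series t (\<i> * of_real pi + of_real r))) \<longlongrightarrow> norm (char_series t (\<i> * of_real pi))) (at_right 0)"
      by (rule char_series_tendsto[OF t(1)])
    have "((\<lambda>r :: real. \<kappa> * (r / sinh r) * exp ((r\<^sup>2 - pi\<^sup>2) / t) * exp (1 / t) * decay t) \<longlongrightarrow> \<kappa> * 1 * exp ((0\<^sup>2 - pi\<^sup>2) / t) * exp (1 / t) * decay t) (at_right 0)"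
      using t by (intro tendsto_intros tendsto_real_over_sinh) auto
    then show "((\<lambda>r :: real. \<kappa> * (r / sinh r) * exp ((r\<^sup>2 - pi\<^sup>2) / t) * exp (1 / t) * decay t) \<longlongrightarrow> \<kappa> * D) (at_right 0)" by (simp add: D_def mult.assoc)
    show "\<forall>\<^sub>F r in at_right 0. norm (char_series t (\<i> * of_real pi + of_real r)) \<le> \<kappa> * (r / sinh r) * exp ((r\<^sup>2 - pi\<^sup>2) / t) * exp (1 / t) * decay t"
      using pos
    proof eventually_elim
      case (elim r)
      have "sinh (\<i> * of_real pi + of_real r) = - sinh (complex_of_real r)"
        by (simp add: sinh_field_def exp_add exp_diff exp_minus inverse_eq_divide diff_divide_distrib)
      then show ?case using up2[of "\<i> * of_real pi + of_real r"] sinh_of_real_nonzero[of r] elim by simp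
    qed
  qed
  have A: "\<kappa> * x_over_sinh p * exp (p\<^sup>2 / t) * (1 - decay t) \<le> norm (char_series t (of_real p))" if p: "p \<ge> 0" for p
  proof (cases "p = 0")
    case True
    then show ?thesis using low0 by (simp add: x_over_sinh_def)
  next
    case False
    then show ?thesis using low[of p] p unfolding x_over_sinh_def by simp
  qed
  have B: "norm (char_series t z) \<le> \<kappa> * ratio_sinh z z * exp (((Re z)\<^sup>2 - (Im z)\<^sup>2) / t) * (1 + decay t)"
    if z: "0 \<le> Im z" "Im z \<le> 31 * pi / 32" for z
  proof (cases "sinh z = 0")
    case True
    have "z = 0" by (rule sinh_eq_0_near[OF True]) (use z pi_gt_zero in linarith)+
    then show ?thesis using up10 by (simp add: ratio_sinh_def)
  next
    case False
    then show ?thesis using up1[OF z False] by (simp add: ratio_sinh_def)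
  qed
  have C: "norm (char_series t z) \<le> \<kappa> * ratio_sinh (z - \<i> * of_real pi) z * exp (((Re z)\<^sup>2 - (Im z)\<^sup>2) / t) * exp (1 / t) * decay t"
    if z: "31 * pi / 32 \<le> Im z" "Im z \<le> pi" for z
  proof (cases "sinh z = 0")
    case True
    have "z = \<i> * of_real pi" by (rule sinh_eq_0_far[OF True]) (use z pi_gt_zero in linarith)+
    then show ?thesis using up20 True by (simp add: ratio_sinh_def D_def mult.assoc)
  next
    case False
    then show ?thesis using up2[OF z False] by (simp add: ratio_sinh_def)
  qed
  show ?thesis by (rule that[OF k(1) A B C])
qed

section \<open>Representations of SL(2,C) and Schur orthogonality\<close>

lemma cmat2_mult_nth: "(A ** B) $ i $ j = A $ i $ 1 * B $ 1 $ j + A $ i $ 2 * B $ 2 $ j" for A B :: cmat2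
  by (simp add: matrix_matrix_mult_def sum_2)

lemma cmat2_eq_iff: "A = B \<longleftrightarrow> A $ 1 $ 1 = B $ 1 $ 1 \<and> A $ 1 $ 2 = B $ 1 $ 2 \<and> A $ 2 $ 1 = B $ 2 $ 1 \<and> A $ 2 $ 2 = B $ 2 $ 2"
  for A B :: cmat2
  by (simp only: vec_eq_iff forall_2 conj_assoc)

definition mat2 :: "complex \<Rightarrow> complex \<Rightarrow> complex \<Rightarrow> complex \<Rightarrow> cmat2" where
  "mat2 a b c d = vector [vector [a, b], vector [c, d]]"

lemma mat2_nth [simp]: "mat2 a b c d $ 1 $ 1 = a" "mat2 a b c d $ 1 $ 2 = b"
  "mat2 a b c d $ 2 $ 1 = c" "mat2 a b c d $ 2 $ 2 = d"
  by (simp_all only: mat2_def vector_2)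

lemma cmat2_one_nth [simp]: "(mat 1 :: cmat2) $ 1 $ 1 = 1" "(mat 1 :: cmat2) $ 1 $ 2 = 0"
  "(mat 1 :: cmat2) $ 2 $ 1 = 0" "(mat 1 :: cmat2) $ 2 $ 2 = 1"
  by (simp_all add: mat_def)

lemma cadjoint_nth [simp]: "cadjoint A $ i $ j = cnj (A $ j $ i)"
  by (simp add: cadjoint_def)

lemma cadjoint_mult: "cadjoint (A ** B) = cadjoint B ** cadjoint A"
  by (simp add: cmat2_eq_iff cmat2_mult_nth mult.commute)

lemma cadjoint_cadjoint [simp]: "cadjoint (cadjoint A) = A"
  by (simp add: cmat2_eq_iff)

lemma det_cadjoint: "det (cadjoint A) = cnj (det A)"
  by (simp add: det_2 mult.commute)

definition tr2 :: "cmat2 \<Rightarrow> complex" where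
  "tr2 A = A $ 1 $ 1 + A $ 2 $ 2"

lemma tr2_mult_commute: "tr2 (A ** B) = tr2 (B ** A)"
  by (simp add: tr2_def cmat2_mult_nth algebra_simps)

lemma tr2_cadjoint: "tr2 (cadjoint A) = cnj (tr2 A)"
  by (simp add: tr2_def)

lemma SU2_cadjoint_left: "u \<in> SU2 \<Longrightarrow> cadjoint u ** u = mat 1"
  by (simp add: SU2_def)

lemma SU2_cadjoint_right: "u \<in> SU2 \<Longrightarrow> u ** cadjoint u = mat 1"
  by (simp add: SU2_def matrix_left_right_inverse)

lemma SU2_matrix_inv:
  assumes "u \<in> SU2" shows "matrix_inv u = cadjoint u"
proof -
  have "u ** matrix_inv u = mat 1 \<and> matrix_inv u ** u = mat 1"
    unfolding matrix_inv_def
    by (rule someI[where x = "cadjoint u"]) (use assms SU2_cadjoint_left SU2_cadjoint_right in auto)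
  then have "cadjoint u ** u ** matrix_inv u = cadjoint u" by (simp add: matrix_mul_assoc[symmetric])
  then show ?thesis using SU2_cadjoint_left[OF assms] by simp
qed

lemma SU2_det: "u \<in> SU2 \<Longrightarrow> det u = 1"
  by (simp add: SU2_def)

lemma SU2_mult: "u \<in> SU2 \<Longrightarrow> v \<in> SU2 \<Longrightarrow> u ** v \<in> SU2"
  unfolding SU2_def mem_Collect_eq cadjoint_mult det_mul
  by (metis matrix_mul_assoc matrix_mul_lid mult_1)

text \<open>\<open>p\<close> stands for a form of degree \<open>n\<close> written with
  \<open>w = 1\<close>, and \<open>Z\<close>, \<open>W\<close> are substituted for its two
  variables. The degree is a separate argument because \<open>p\<close> itself may have a smaller
  one.\<close>

definition homogenize :: "nat \<Rightarrow> complex poly \<Rightarrow> complex poly \<Rightarrow> complex poly \<Rightarrow> complex poly" where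
  "homogenize n p Z W = (\<Sum>l\<le>n. smult (coeff p l) (Z ^ l * W ^ (n - l)))"

lemma homogenize_linear_mult:
  assumes "degree p \<le> n"
  shows "homogenize (Suc n) ([:c, a:] * p) Z W = (smult c W + smult a Z) * homogenize n p Z W"
proof -
  have top: "coeff p (Suc n) = 0" using assms by (simp add: coeff_eq_0)
  have co: "coeff ([:c, a:] * p) l = c * coeff p l + (if l = 0 then 0 else a * coeff p (l - 1))" for l
    by (cases l) simp_all
  have "homogenize (Suc n) ([:c, a:] * p) Z W =
      (\<Sum>l\<le>Suc n. smult (c * coeff p l) (Z ^ l * W ^ (Suc n - l))) +
      (\<Sum>l\<le>Suc n. smult (if l = 0 then 0 else a * coeff p (l - 1)) (Z ^ l * W ^ (Suc n - l)))"
    unfolding homogenize_def co smult_add_left sum.distrib ..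
  also have "(\<Sum>l\<le>Suc n. smult (c * coeff p l) (Z ^ l * W ^ (Suc n - l))) = smult c W * homogenize n p Z W"
    unfolding homogenize_def sum_distrib_left by (simp add: top Suc_diff_le mult_ac)
  also have "(\<Sum>l\<le>Suc n. smult (if l = 0 then 0 else a * coeff p (l - 1)) (Z ^ l * W ^ (Suc n - l))) = smult a Z * homogenize n p Z W"
    unfolding homogenize_def sum_distrib_left by (subst sum.atMost_Suc_shift) (simp add: mult_ac)
  finally show ?thesis by (simp add: algebra_simps)
qed

lemma degree_linear_power_mult_le: "degree p \<le> n \<Longrightarrow> degree ([:c, a:] ^ k * p) \<le> k + n"
proof -
  assume "degree p \<le> n"
  have "degree ([:c, a:] ^ k) \<le> 1 * k"
    by (rule order.trans[OF degree_power_le]) (simp add: mult_le_mono1)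
  then show ?thesis using degree_mult_le[of "[:c, a:] ^ k" p] \<open>degree p \<le> n\<close> by simp
qed

lemma homogenize_linear_power_mult:
  assumes "degree p \<le> n"
  shows "homogenize (k + n) ([:c, a:] ^ k * p) Z W = (smult c W + smult a Z) ^ k * homogenize n p Z W"
proof (induction k)
  case (Suc k)
  have "[:c, a:] ^ Suc k * p = [:c, a:] * ([:c, a:] ^ k * p)" by (simp only: power_Suc mult.assoc)
  then show ?case
    using homogenize_linear_mult[OF degree_linear_power_mult_le[OF assms, of c a k], of c a Z W] Suc
    by (simp only: power_Suc mult.assoc add_Suc)
qed simp

lemma homogenize_spin:
  assumes "k \<le> n"
  shows "homogenize n ([:c, a:] ^ k * [:d, b:] ^ (n - k)) Z W =
    (smult c W + smult a Z) ^ k * (smult d W + smult b Z) ^ (n - k)"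
proof -
  have "homogenize (n - k) ([:d, b:] ^ (n - k) * 1) Z W = (smult d W + smult b Z) ^ (n - k)"
    using homogenize_linear_power_mult[of 1 0 "n - k" d b Z W] by (simp add: homogenize_def)
  moreover have "degree ([:d, b:] ^ (n - k)) \<le> n - k"
    using degree_linear_power_mult_le[of 1 0 d b "n - k"] by simp
  ultimately show ?thesis
    using homogenize_linear_power_mult[of "[:d, b:] ^ (n - k)" "n - k" k c a Z W] assms by simp
qed

text \<open>A column of the matrix of \<open>h\<close> is a product of powers of two linear forms;
  substituting the linear forms of \<open>g\<close> into it gives the corresponding product for
  \<open>g ** h\<close>, and expanding the substitution in coefficients gives the matrix
  product.\<close>

lemma spin_rep_mult:
  assumes "k \<le> n"
  shows "spin_rep n (g ** h) m k = (\<Sum>l\<le>n. spin_rep n g m l * spin_rep n h l k)"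
proof -
  let ?P = "[:g $ 2 $ 1, g $ 1 $ 1:]" and ?Q = "[:g $ 2 $ 2, g $ 1 $ 2:]"
  have "spin_rep n (g ** h) m k = coeff ((smult (h $ 2 $ 1) ?Q + smult (h $ 1 $ 1) ?P) ^ k *
      (smult (h $ 2 $ 2) ?Q + smult (h $ 1 $ 2) ?P) ^ (n - k)) m"
    unfolding spin_rep_def cmat2_mult_nth by (simp add: algebra_simps)
  also have "\<dots> = (\<Sum>l\<le>n. spin_rep n g m l * spin_rep n h l k)"
    unfolding homogenize_spin[OF assms, symmetric] homogenize_def spin_rep_def
    by (simp add: coeff_sum mult.commute)
  finally show ?thesis .
qed

lemma spin_rep_one: "k \<le> n \<Longrightarrow> spin_rep n (mat 1) m k = (if m = k then 1 else 0)"
proof -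
  assume "k \<le> n"
  have "[:0, 1:] ^ k = monom (1 :: complex) k" by (simp add: monom_altdef)
  then show ?thesis by (simp add: spin_rep_def one_pCons[symmetric])
qed

lemma spin_char_mult_commute: "spin_char n (g ** h) = spin_char n (h ** g)"
proof -
  have "spin_char n (g ** h) = (\<Sum>k\<le>n. \<Sum>l\<le>n. spin_rep n g k l * spin_rep n h l k)"
    unfolding spin_char_def by (intro sum.cong refl spin_rep_mult) auto
  also have "\<dots> = (\<Sum>l\<le>n. \<Sum>k\<le>n. spin_rep n h l k * spin_rep n g k l)"
    by (subst sum.swap) (simp add: mult.commute)
  also have "\<dots> = spin_char n (h ** g)"
    unfolding spin_char_def by (intro sum.cong refl spin_rep_mult[symmetric]) auto
  finally show ?thesis .
qed

lemma spin_rep_upper_diag: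
  assumes "g $ 2 $ 1 = 0"
  shows "spin_rep n g k k = (g $ 1 $ 1) ^ k * (g $ 2 $ 2) ^ (n - k)"
proof -
  have "[:0, g $ 1 $ 1:] ^ k = monom ((g $ 1 $ 1) ^ k) k"
    using monom_power[of "g $ 1 $ 1" 1 k] by (simp add: monom_Suc monom_0)
  then show ?thesis using assms by (simp add: spin_rep_def coeff_monom_mult coeff_0_power)
qed

lemma char_value_minus: "char_value n (- z) = char_value n z"
  unfolding char_value_def
  by (rule sum.reindex_bij_witness[of _ "\<lambda>k. n - k" "\<lambda>k. n - k"]) (auto simp: of_nat_diff algebra_simps)

lemma char_value_power:
  assumes "a = exp z" "d = exp (- z)"
  shows "(\<Sum>k\<le>n. a ^ k * d ^ (n - k)) = char_value n z"
  unfolding char_value_def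
proof (intro sum.cong refl)
  fix k assume "k \<in> {..n}"
  then show "a ^ k * d ^ (n - k) = exp ((2 * of_nat k - of_nat n) * z)"
    unfolding assms exp_of_nat_mult[symmetric] exp_add[symmetric]
    by (intro arg_cong[of _ _ exp]) (simp add: of_nat_diff algebra_simps)
qed

lemma two_cosh: "2 * cosh z = exp z + exp (- z)" for z :: complex
  by (simp add: cosh_field_def)

lemma spin_char_upper:
  assumes "g $ 2 $ 1 = 0" "det g = 1" "tr2 g = 2 * cosh z"
  shows "spin_char n g = char_value n z"
proof -
  let ?a = "g $ 1 $ 1" and ?d = "g $ 2 $ 2"
  have ad: "?a * ?d = 1" using assms by (simp add: det_2)
  have tr: "?a + ?d = exp z + exp (- z)" using assms by (simp add: tr2_def two_cosh)
  have zz: "exp z * exp (- z) = 1" by (simp add: exp_minus)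
  have "(?a - exp z) * (?a - exp (- z)) = 0" using ad tr zz by algebra
  then consider "?a = exp z" | "?a = exp (- z)" by auto
  then have "(?a = exp z \<and> ?d = exp (- z)) \<or> (?a = exp (- z) \<and> ?d = exp z)" using tr by cases auto
  then have "(\<Sum>k\<le>n. ?a ^ k * ?d ^ (n - k)) = char_value n z"
    using char_value_power[of ?a z ?d n] char_value_power[of ?a "- z" ?d n] char_value_minus[of n z] by auto
  then show ?thesis using assms(1) by (simp add: spin_char_def spin_rep_upper_diag)
qed

text \<open>The character is invariant under conjugation by cyclicity, and a matrix of determinant 1
  is conjugate to an upper triangular one, whose diagonal entries are \<open>exp z\<close> and
  \<open>exp (- z)\<close> in some order.\<close>

lemma spin_char_eq:
  assumes "det g = 1" "tr2 g = 2 * cosh z"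
  shows "spin_char n g = char_value n z"
proof (cases "g $ 2 $ 1 = 0")
  case False
  define a b c d where "a = g $ 1 $ 1" and "b = g $ 1 $ 2" and "c = g $ 2 $ 1" and "d = g $ 2 $ 2"
  define l where "l = exp z"
  have l0: "l \<noteq> 0" by (simp add: l_def)
  have det: "a * d - b * c = 1" using assms by (simp add: det_2 a_def b_def c_def d_def)
  have tr: "a + d = l + 1 / l" using assms by (simp add: tr2_def a_def d_def l_def two_cosh exp_minus inverse_eq_divide)
  have c0: "c \<noteq> 0" using False by (simp add: c_def)
  have trl: "(a + d) * l = l * l + 1" unfolding tr using l0 by (simp add: field_simps)
  \<comment> \<open>The first column is an eigenvector of \<open>g\<close> for \<open>l\<close>, the
    second is the first unit vector, and \<open>T\<close> is the matrix of \<open>g\<close> in this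
    basis. Since \<open>c \<noteq> 0\<close>, it is a basis even if \<open>l = 1 / l\<close> and
    \<open>g\<close> is not diagonalizable.\<close>
  define P where "P = mat2 (l - d) 1 c 0"
  define P' where "P' = mat2 0 (1 / c) 1 (- (l - d) / c)"
  define T where "T = mat2 l 1 0 (1 / l)"
  have inv: "P' ** P = mat 1" using c0 by (simp add: cmat2_eq_iff cmat2_mult_nth P_def P'_def)
  have "g = P ** (T ** P')"
  proof -
    show ?thesis
      unfolding cmat2_eq_iff cmat2_mult_nth P_def P'_def T_def mat2_nth a_def[symmetric] b_def[symmetric] c_def[symmetric] d_def[symmetric]
    proof (intro conjI)
      show "a = (l - d) * (l * 0 + 1 * 1) + 1 * (0 * 0 + 1 / l * 1)" using tr by (simp add: algebra_simps)
      show "c = c * (l * 0 + 1 * 1) + 0 * (0 * 0 + 1 / l * 1)" by simp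
      show "d = c * (l * (1 / c) + 1 * (- (l - d) / c)) + 0 * (0 * (1 / c) + 1 / l * (- (l - d) / c))"
        using c0 by (simp add: field_simps)
      have "b * (l * c) = ((l - d) * d) * l - (l - d)" using trl det by algebra
      then have "b = (((l - d) * d) * l - (l - d)) / (l * c)" using c0 l0 by (simp add: eq_divide_eq)
      also have "\<dots> = (l - d) * (l * (1 / c) + 1 * (- (l - d) / c)) + 1 * (0 * (1 / c) + 1 / l * (- (l - d) / c))"
        using c0 l0 by (simp add: field_simps)
      finally show "b = (l - d) * (l * (1 / c) + 1 * (- (l - d) / c)) + 1 * (0 * (1 / c) + 1 / l * (- (l - d) / c))" .
    qed
  qed
  then have "spin_char n g = spin_char n (T ** P' ** P)" by (simp add: spin_char_mult_commute)
  also have "T ** P' ** P = T" using inv by (simp add: matrix_mul_assoc[symmetric])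
  also have "spin_char n T = char_value n z"
    by (rule spin_char_upper) (use l0 in \<open>simp_all add: T_def det_2 tr2_def cosh_field_def l_def exp_minus inverse_eq_divide\<close>)
  finally show ?thesis .
qed (use assms spin_char_upper in blast)

lemma ex_half_trace: "\<exists>z. tr2 g = 2 * cosh z"
  by (rule exI[of _ "\<i> * Arccos (tr2 g / 2)"]) (simp add: cosh_conv_cos mult.assoc[symmetric])

lemma char_value_cnj: "char_value n (cnj z) = cnj (char_value n z)"
  by (simp add: char_value_def exp_cnj)

text \<open>Passing to the adjoint conjugates the eigenvalues, hence the exponent \<open>z\<close>,
  and the character is a polynomial in \<open>exp z\<close> and \<open>exp (- z)\<close> with real
  coefficients.\<close>

lemma spin_char_cadjoint:
  assumes "det g = 1" shows "spin_char n (cadjoint g) = cnj (spin_char n g)"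
proof -
  obtain z where z: "tr2 g = 2 * cosh z" using ex_half_trace by blast
  have "tr2 (cadjoint g) = 2 * cosh (cnj z)"
    using z by (simp add: tr2_cadjoint two_cosh exp_cnj)
  then have "spin_char n (cadjoint g) = char_value n (cnj z)"
    using assms by (intro spin_char_eq) (simp_all add: det_cadjoint)
  then show ?thesis using spin_char_eq[OF assms z] by (simp add: char_value_cnj)
qed

text \<open>The larger of the two exponentials is at most \<open>2 * norm (cosh z)\<close> plus the
  smaller one, which is at most 1. It turns a bound on the trace into one on
  \<open>Re z\<close>.\<close>

lemma exp_abs_Re_le: "exp \<bar>Re z\<bar> \<le> 2 * norm (cosh z) + 1"
proof -
  have "norm (exp (w :: complex)) - norm (exp (- w)) \<le> 2 * norm (cosh w)" for w
    using norm_triangle_ineq4[of "exp w + exp (- w)" "exp (- w)"]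
      norm_triangle_ineq2[of "exp w" "- exp (- w)"]
    by (simp add: cosh_field_def norm_divide)
  from this[of z] this[of "- z"] have "exp (Re z) - exp (- Re z) \<le> 2 * norm (cosh z)" "exp (- Re z) - exp (Re z) \<le> 2 * norm (cosh z)"
    by simp_all
  moreover have "exp (- Re z) \<le> 1 \<or> exp (Re z) \<le> 1" by auto
  moreover have "exp \<bar>Re z\<bar> = exp (Re z) \<and> exp (- Re z) \<le> 1 \<or> exp \<bar>Re z\<bar> = exp (- Re z) \<and> exp (Re z) \<le> 1"
    by (auto simp: abs_if)
  ultimately show ?thesis by linarith
qed

section \<open>Continuity of matrix coefficients and boundedness on SU(2)\<close>

lemma continuous_on_coeff_mult:
  fixes p q :: "'a :: topological_space \<Rightarrow> complex poly"
  assumes "\<And>i. continuous_on S (\<lambda>x. coeff (p x) i)" "\<And>i. continuous_on S (\<lambda>x. coeff (q x) i)"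
  shows "continuous_on S (\<lambda>x. coeff (p x * q x) i)"
  unfolding coeff_mult by (intro continuous_intros assms)

lemma continuous_on_coeff_power:
  fixes p :: "'a :: topological_space \<Rightarrow> complex poly"
  assumes "\<And>i. continuous_on S (\<lambda>x. coeff (p x) i)"
  shows "continuous_on S (\<lambda>x. coeff (p x ^ k) i)"
proof (induction k arbitrary: i)
  case (Suc k)
  then show ?case unfolding power_Suc by (intro continuous_on_coeff_mult assms)
qed simp

lemma continuous_on_coeff_linear:
  assumes "continuous_on S c" "continuous_on S a"
  shows "continuous_on S (\<lambda>x. coeff [:c x, a x:] i)"
proof (cases i)
  case (Suc j)
  then show ?thesis using assms by (cases j) auto
qed (use assms in auto)

lemma continuous_on_spin_rep:
  fixes f :: "'a :: topological_space \<Rightarrow> cmat2"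
  assumes "\<And>i j. continuous_on S (\<lambda>x. f x $ i $ j)"
  shows "continuous_on S (\<lambda>x. spin_rep n (f x) a b)"
  unfolding spin_rep_def
  by (intro continuous_on_coeff_mult continuous_on_coeff_power continuous_on_coeff_linear assms)

lemma continuous_on_cmat2_nth: "continuous_on S (\<lambda>h :: cmat2. h $ i $ j)"
  by (intro continuous_intros)

lemma SU2_nth_le: "u \<in> SU2 \<Longrightarrow> norm (u $ i $ j) \<le> 1"
proof -
  assume u: "u \<in> SU2"
  have "(cadjoint u ** u) $ j $ j = 1" unfolding SU2_cadjoint_left[OF u] by (simp add: mat_def)
  then have "complex_of_real ((norm (u $ 1 $ j))\<^sup>2) + of_real ((norm (u $ 2 $ j))\<^sup>2) = 1"
    unfolding complex_norm_square by (simp add: cmat2_mult_nth mult.commute)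
  then have "of_real ((norm (u $ 1 $ j))\<^sup>2 + (norm (u $ 2 $ j))\<^sup>2) = (1 :: complex)"
    unfolding of_real_add .
  then have "(norm (u $ 1 $ j))\<^sup>2 + (norm (u $ 2 $ j))\<^sup>2 = 1" by (simp only: of_real_eq_1_iff)
  then have "(norm (u $ i $ j))\<^sup>2 \<le> 1\<^sup>2" using exhaust_2[of i] by (smt (verit) one_power2 zero_le_power2)
  then show ?thesis by (rule power2_le_imp_le) simp
qed

lemma SU2_subset_cball: "SU2 \<subseteq> cball 0 4"
proof
  fix u assume u: "u \<in> SU2"
  have "norm u \<le> (\<Sum>i\<in>UNIV. norm (u $ i))" unfolding norm_vec_def by (rule L2_set_le_sum) simp
  also have "\<dots> \<le> (\<Sum>i\<in>UNIV. \<Sum>j\<in>UNIV. norm (u $ i $ j))"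
    by (rule sum_mono, unfold norm_vec_def[of "u $ _"]) (rule L2_set_le_sum, simp)
  also have "\<dots> \<le> (\<Sum>i\<in>(UNIV :: 2 set). \<Sum>j\<in>(UNIV :: 2 set). 1)" by (intro sum_mono SU2_nth_le u)
  finally show "u \<in> cball 0 4" by simp
qed

lemma bounded_on_SU2:
  fixes f :: "cmat2 \<Rightarrow> complex"
  assumes "continuous_on UNIV f"
  obtains B where "\<And>u. u \<in> SU2 \<Longrightarrow> norm (f u) \<le> B"
proof -
  have "compact (f ` cball 0 4)"
    by (intro compact_continuous_image continuous_on_subset[OF assms]) auto
  then obtain B where "\<And>y. y \<in> f ` cball 0 4 \<Longrightarrow> norm y \<le> B"
    using compact_imp_bounded bounded_iff by metis
  then show ?thesis using that SU2_subset_cball by blast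
qed

definition torus :: "real \<Rightarrow> cmat2" where
  "torus x = mat2 (exp (\<i> * of_real x)) 0 0 (exp (- (\<i> * of_real x)))"

lemma torus_in_SU2: "torus x \<in> SU2"
  by (simp add: SU2_def torus_def cmat2_eq_iff cmat2_mult_nth det_2 exp_cnj exp_add[symmetric])

lemma spin_rep_torus:
  assumes "b \<le> n"
  shows "spin_rep n (torus x) a b = (if a = b then exp (\<i> * of_real (x * (2 * real b - real n))) else 0)"
proof -
  let ?e = "exp (\<i> * of_real x)" and ?f = "exp (- (\<i> * of_real x))"
  have "[:0, ?e:] ^ b = monom (?e ^ b) b"
    using monom_power[of ?e 1 b] by (simp add: monom_Suc monom_0)
  moreover have "[:?f, 0:] ^ (n - b) = [:?f ^ (n - b):]" by (simp add: poly_const_pow)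
  ultimately have "spin_rep n (torus x) a b = (if a = b then ?e ^ b * ?f ^ (n - b) else 0)"
    by (simp add: spin_rep_def torus_def mult.commute)
  also have "?e ^ b * ?f ^ (n - b) = exp (\<i> * of_real (x * (2 * real b - real n)))"
    unfolding exp_of_nat_mult[symmetric] exp_add[symmetric]
    by (rule arg_cong[of _ _ exp]) (use assms in \<open>simp add: of_nat_diff algebra_simps\<close>)
  finally show ?thesis .
qed

text \<open>The Pythagorean triple 3, 4, 5 gives a rotation without zero entries. Column 0 of its
  representation matrix consists of binomial coefficients times nonzero products of powers, row 0 of
  such products alone.\<close>

definition generic_rotation :: cmat2 where
  "generic_rotation = mat2 (3 / 5) (4 / 5) (- 4 / 5) (3 / 5)"

lemma generic_rotation_in_SU2: "generic_rotation \<in> SU2"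
  by (simp add: SU2_def generic_rotation_def cmat2_eq_iff cmat2_mult_nth det_2)

lemma generic_rotation_first_column: "a \<le> n \<Longrightarrow> spin_rep n generic_rotation a 0 \<noteq> 0"
  by (simp add: spin_rep_def generic_rotation_def coeff_linear_poly_power binomial_eq_0_iff)

lemma generic_rotation_first_row: "b \<le> n \<Longrightarrow> spin_rep n generic_rotation 0 b \<noteq> 0"
  by (simp add: spin_rep_def generic_rotation_def coeff_mult_0 coeff_0_power)

text \<open>Schur's lemma: the torus makes an intertwiner respect weights, and a single group element
  without zeros in the first row and column then does the rest.\<close>

lemma intertwiner_weight:
  assumes M: "\<And>u a e. u \<in> SU2 \<Longrightarrow> a \<le> m \<Longrightarrow> e \<le> n \<Longrightarrow>
      (\<Sum>d\<le>n. M a d * spin_rep n u d e) = (\<Sum>i\<le>m. spin_rep m u a i * M i e)"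
    and "a \<le> m" "e \<le> n" and ne: "2 * int e - int n \<noteq> 2 * int a - int m"
  shows "M a e = 0"
proof -
  define k where "k = (2 * real e - real n) - (2 * real a - real m)"
  have "k = of_int ((2 * int e - int n) - (2 * int a - int m))" by (simp add: k_def)
  then have k: "k \<noteq> 0" using ne by (simp del: of_int_diff)
  \<comment> \<open>Makes the two torus characters differ exactly by the factor
    \<open>exp \<i>\<close>, which is not 1.\<close>
  define x where "x = 1 / k"
  have "(\<Sum>d\<le>n. M a d * spin_rep n (torus x) d e) = M a e * exp (\<i> * of_real (x * (2 * real e - real n)))"
    using \<open>e \<le> n\<close> by (subst sum.remove[of _ e]) (auto simp: spin_rep_torus intro!: sum.neutral)
  moreover have "(\<Sum>i\<le>m. spin_rep m (torus x) a i * M i e) = exp (\<i> * of_real (x * (2 * real a - real m))) * M a e"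
    using \<open>a \<le> m\<close> by (subst sum.remove[of _ a]) (auto simp: spin_rep_torus intro!: sum.neutral)
  ultimately have "M a e * exp (\<i> * of_real (x * (2 * real e - real n))) = exp (\<i> * of_real (x * (2 * real a - real m))) * M a e"
    using M[OF torus_in_SU2 assms(2,3)] by metis
  moreover have "exp (\<i> * of_real (x * (2 * real e - real n))) = exp (\<i> * of_real (x * (2 * real a - real m))) * exp \<i>"
  proof -
    have "x * (2 * real e - real n) = x * (2 * real a - real m) + 1"
      using k by (simp add: x_def k_def field_simps)
    then show ?thesis unfolding exp_add[symmetric] by (simp add: distrib_left)
  qed
  ultimately have "M a e * (exp \<i> - 1) = 0" by (simp add: algebra_simps)
  moreover have "exp \<i> \<noteq> 1"
  proof
    assume "exp \<i> = 1"
    then have "Im (exp \<i>) = 0" by simp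
    then have "sin (1 :: real) = 0" by (simp add: Im_exp)
    moreover have "sin (1 :: real) > 0" by (rule sin_gt_zero) (use pi_gt3 in auto)
    ultimately show False by simp
  qed
  ultimately show ?thesis by simp
qed

text \<open>The lowest weight of the larger representation does not occur in the smaller one. In the
  relation for \<open>generic_rotation\<close> at that column or row, one side therefore vanishes,
  and on the other only the entry in question survives, with a nonzero coefficient.\<close>

lemma schur_orthogonal:
  assumes M: "\<And>u a e. u \<in> SU2 \<Longrightarrow> a \<le> m \<Longrightarrow> e \<le> n \<Longrightarrow>
      (\<Sum>d\<le>n. M a d * spin_rep n u d e) = (\<Sum>i\<le>m. spin_rep m u a i * M i e)"
    and "m \<noteq> n" "a \<le> m" "e \<le> n"
  shows "M a e = 0"
proof (cases "2 * int e - int n = 2 * int a - int m")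
  case False
  then show ?thesis using intertwiner_weight[of m n M a e] M assms(3,4) by blast
next
  case True
  have w: "M a' e' = 0" if "a' \<le> m" "e' \<le> n" "2 * int e' - int n \<noteq> 2 * int a' - int m" for a' e'
    using intertwiner_weight[of m n M a' e'] M that by blast
  show ?thesis
  proof (cases "m < n")
    case less: True
    have "(\<Sum>d\<le>n. M a d * spin_rep n generic_rotation d 0) = M a e * spin_rep n generic_rotation e 0"
      using \<open>e \<le> n\<close> \<open>a \<le> m\<close> True by (subst sum.remove[of _ e]) (auto intro!: sum.neutral w)
    moreover have "(\<Sum>i\<le>m. spin_rep m generic_rotation a i * M i 0) = 0"
      using less by (intro sum.neutral) (auto intro!: w)
    ultimately show ?thesis
      using M[OF generic_rotation_in_SU2 \<open>a \<le> m\<close>, of 0] generic_rotation_first_column[OF \<open>e \<le> n\<close>] by simp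
  next
    case False
    then have less: "n < m" using \<open>m \<noteq> n\<close> by simp
    have "(\<Sum>i\<le>m. spin_rep m generic_rotation 0 i * M i e) = spin_rep m generic_rotation 0 a * M a e"
      using \<open>e \<le> n\<close> \<open>a \<le> m\<close> True by (subst sum.remove[of _ a]) (auto intro!: sum.neutral w)
    moreover have "(\<Sum>d\<le>n. M 0 d * spin_rep n generic_rotation d e) = 0"
      using less by (intro sum.neutral) (auto intro!: w)
    ultimately show ?thesis
      using M[OF generic_rotation_in_SU2 _ \<open>e \<le> n\<close>, of 0] generic_rotation_first_row[OF \<open>a \<le> m\<close>] by simp
  qed
qed

text \<open>The weights of one representation are distinct, so \<open>M\<close> is diagonal; column
  0 of the relation for \<open>generic_rotation\<close> equates the diagonal entries, and the trace
  fixes their value.\<close>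

lemma schur_scalar:
  assumes M: "\<And>u a e. u \<in> SU2 \<Longrightarrow> a \<le> n \<Longrightarrow> e \<le> n \<Longrightarrow>
      (\<Sum>d\<le>n. M a d * spin_rep n u d e) = (\<Sum>i\<le>n. spin_rep n u a i * M i e)"
    and "a \<le> n" "e \<le> n"
  shows "M a e = (if a = e then (\<Sum>i\<le>n. M i i) / of_nat (n + 1) else 0)"
proof -
  have w: "M a' e' = 0" if "a' \<le> n" "e' \<le> n" "a' \<noteq> e'" for a' e'
    using intertwiner_weight[of n n M a' e'] M that by auto
  have diag: "M i i = M 0 0" if i: "i \<le> n" for i
  proof -
    have "(\<Sum>d\<le>n. M i d * spin_rep n generic_rotation d 0) = M i i * spin_rep n generic_rotation i 0"
      using i by (subst sum.remove[of _ i]) (auto intro!: sum.neutral w)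
    moreover have "(\<Sum>d\<le>n. spin_rep n generic_rotation i d * M d 0) = spin_rep n generic_rotation i 0 * M 0 0"
      by (subst sum.remove[of _ 0]) (auto intro!: sum.neutral w)
    ultimately show ?thesis
      using M[OF generic_rotation_in_SU2 i, of 0] generic_rotation_first_column[OF i] by simp
  qed
  have "(\<Sum>i\<le>n. M i i) = (\<Sum>i\<le>n. M 0 0)" by (rule sum.cong[OF refl], rule diag, simp)
  then have "(\<Sum>i\<le>n. M i i) = of_nat (n + 1) * M 0 0" by simp
  then show ?thesis using w[OF assms(2,3)] diag[OF assms(2)] by (cases "a = e") (simp_all del: of_nat_add of_nat_Suc)
qed

lemma continuous_spin_char_right: "continuous_on UNIV (\<lambda>h :: cmat2. spin_char n (h ** A))"
proof -
  have "continuous_on UNIV (\<lambda>h :: cmat2. (h ** A) $ i $ j)" for i j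
    unfolding cmat2_mult_nth by (intro continuous_intros)
  then have "continuous_on UNIV (\<lambda>h :: cmat2. spin_rep n (h ** A) k k)" for k by (rule continuous_on_spin_rep)
  then show ?thesis unfolding spin_char_def by (rule continuous_on_sum)
qed

lemma continuous_spin_char_cadjoint: "continuous_on UNIV (\<lambda>h. spin_char n (B ** cadjoint h))"
proof -
  have "continuous_on UNIV (\<lambda>h. (B ** cadjoint h) $ i $ j)" for i j
    unfolding cmat2_mult_nth cadjoint_nth by (intro continuous_intros)
  then have "continuous_on UNIV (\<lambda>h. spin_rep n (B ** cadjoint h) k k)" for k by (rule continuous_on_spin_rep)
  then show ?thesis unfolding spin_char_def by (rule continuous_on_sum)
qed

section \<open>Integration against Haar measure\<close>

context
  fixes \<mu> :: "cmat2 measure"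
  assumes haar: "normalized_haar_SU2 \<mu>"
begin

lemma haar_sets: "sets \<mu> = sets (restrict_space borel SU2)"
  using haar by (simp add: normalized_haar_SU2_def)

lemma haar_space: "space \<mu> = SU2"
  using sets_eq_imp_space_eq[OF haar_sets] by (simp add: space_restrict_space)

lemma haar_finite_measure: "finite_measure \<mu>"
  using haar haar_space by (intro finite_measureI) (simp add: normalized_haar_SU2_def)

lemma haar_measure_space: "measure \<mu> (space \<mu>) = 1"
  using haar haar_space by (simp add: normalized_haar_SU2_def measure_def)

lemma haar_measurable:
  assumes "continuous_on UNIV f" shows "f \<in> borel_measurable \<mu>"
proof -
  have "f \<in> borel_measurable (restrict_space borel SU2)"
    using assms by (intro measurable_restrict_space1 borel_measurable_continuous_onI)
  then show ?thesis using measurable_cong_sets[OF haar_sets refl] by blast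
qed

lemma haar_integrable:
  fixes f :: "cmat2 \<Rightarrow> complex"
  assumes "continuous_on UNIV f" shows "integrable \<mu> f"
proof -
  interpret finite_measure \<mu> by (rule haar_finite_measure)
  obtain B where "\<And>u. u \<in> SU2 \<Longrightarrow> norm (f u) \<le> B" using bounded_on_SU2[OF assms] by blast
  then show ?thesis by (intro integrable_const_bound[where B = B] haar_measurable assms AE_I2) (simp add: haar_space)
qed

lemma haar_left_invariant:
  fixes f :: "cmat2 \<Rightarrow> complex"
  assumes u: "u \<in> SU2" and f: "continuous_on UNIV f"
  shows "(LINT h|\<mu>. f (u ** h)) = (LINT h|\<mu>. f h)"
proof -
  have "continuous_on UNIV (\<lambda>h. u ** h)"
    unfolding matrix_matrix_mult_def by (intro continuous_intros)
  then have "(\<lambda>h. u ** h) \<in> \<mu> \<rightarrow>\<^sub>M borel" by (rule haar_measurable)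
  then have "(\<lambda>h. u ** h) \<in> \<mu> \<rightarrow>\<^sub>M restrict_space borel SU2"
    using u SU2_mult by (intro measurable_restrict_space2) (auto simp: haar_space)
  then have m: "(\<lambda>h. u ** h) \<in> \<mu> \<rightarrow>\<^sub>M \<mu>" using measurable_cong_sets[OF refl haar_sets] by blast
  have "distr \<mu> \<mu> (\<lambda>h. u ** h) = \<mu>" using haar u by (simp add: normalized_haar_SU2_def)
  then show ?thesis using integral_distr[OF m haar_measurable[OF f]] by simp
qed

text \<open>The second factor is the matrix of the inverse of \<open>h\<close>, so that the
  representation property applies to it; conjugated entries would be the same only in an orthonormal
  basis.\<close>

definition matrix_integral :: "nat \<Rightarrow> nat \<Rightarrow> nat \<Rightarrow> nat \<Rightarrow> nat \<Rightarrow> nat \<Rightarrow> complex" where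
  "matrix_integral m n a b c d = (LINT h|\<mu>. spin_rep m h a b * spin_rep n (cadjoint h) c d)"

lemma continuous_on_cadjoint_nth: "continuous_on S (\<lambda>h. cadjoint h $ i $ j)"
  unfolding cadjoint_nth by (intro continuous_intros)

lemma continuous_matrix_product:
  "continuous_on UNIV (\<lambda>h. spin_rep m h a b * spin_rep n (cadjoint h) c d)"
  by (intro continuous_on_mult continuous_on_spin_rep continuous_on_cadjoint_nth continuous_on_cmat2_nth)

text \<open>Replacing \<open>h\<close> by \<open>u ** h\<close> puts \<open>u\<close> to the left of
  the first factor and its inverse to the right of the second, where multiplication by the matrix of
  \<open>u\<close> cancels it. For fixed \<open>b\<close> and \<open>c\<close> the integrals thus
  form an intertwiner in the outer indices.\<close>

lemma matrix_integral_intertwines: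
  assumes u: "u \<in> SU2" and le: "a \<le> m" "b \<le> m" "c \<le> n" "e \<le> n"
  shows "(\<Sum>d\<le>n. matrix_integral m n a b c d * spin_rep n u d e) =
    (\<Sum>i\<le>m. spin_rep m u a i * matrix_integral m n i b c e)"
proof -
  have "matrix_integral m n a b c d = (LINT h|\<mu>. spin_rep m (u ** h) a b * spin_rep n (cadjoint (u ** h)) c d)" for d
    unfolding matrix_integral_def by (rule haar_left_invariant[OF u continuous_matrix_product, symmetric])
  then have "(\<Sum>d\<le>n. matrix_integral m n a b c d * spin_rep n u d e) =
     (\<Sum>d\<le>n. (LINT h|\<mu>. spin_rep m (u ** h) a b * spin_rep n (cadjoint (u ** h)) c d * spin_rep n u d e))"
    by simp
  also have "\<dots> = (LINT h|\<mu>. (\<Sum>d\<le>n. spin_rep m (u ** h) a b * spin_rep n (cadjoint (u ** h)) c d * spin_rep n u d e))"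
  proof (rule Bochner_Integration.integral_sum[symmetric])
    have "continuous_on UNIV (\<lambda>h. (u ** h) $ i $ j)" "continuous_on UNIV (\<lambda>h. cadjoint (u ** h) $ i $ j)" for i j
      unfolding cadjoint_nth cmat2_mult_nth by (intro continuous_intros)+
    then show "integrable \<mu> (\<lambda>h. spin_rep m (u ** h) a b * spin_rep n (cadjoint (u ** h)) c d * spin_rep n u d e)" for d
      by (intro haar_integrable continuous_on_mult continuous_on_spin_rep continuous_on_const)
  qed
  also have "\<dots> = (LINT h|\<mu>. (\<Sum>i\<le>m. spin_rep m u a i * (spin_rep m h i b * spin_rep n (cadjoint h) c e)))"
  proof (intro Bochner_Integration.integral_cong refl)
    fix h
    have "(\<Sum>d\<le>n. spin_rep n (cadjoint (u ** h)) c d * spin_rep n u d e) = spin_rep n (cadjoint (u ** h) ** u) c e"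
      using spin_rep_mult[OF le(4)] by simp
    also have "cadjoint (u ** h) ** u = cadjoint h"
      by (simp add: cadjoint_mult matrix_mul_assoc[symmetric] SU2_cadjoint_left[OF u])
    finally have 1: "(\<Sum>d\<le>n. spin_rep n (cadjoint (u ** h)) c d * spin_rep n u d e) = spin_rep n (cadjoint h) c e" .
    have "(\<Sum>d\<le>n. spin_rep m (u ** h) a b * spin_rep n (cadjoint (u ** h)) c d * spin_rep n u d e)
       = spin_rep m (u ** h) a b * spin_rep n (cadjoint h) c e"
      unfolding 1[symmetric] sum_distrib_left by (simp add: mult.assoc)
    also have "\<dots> = (\<Sum>i\<le>m. spin_rep m u a i * (spin_rep m h i b * spin_rep n (cadjoint h) c e))"
      unfolding spin_rep_mult[OF le(2)] sum_distrib_right by (simp add: mult.assoc)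
    finally show "(\<Sum>d\<le>n. spin_rep m (u ** h) a b * spin_rep n (cadjoint (u ** h)) c d * spin_rep n u d e)
       = (\<Sum>i\<le>m. spin_rep m u a i * (spin_rep m h i b * spin_rep n (cadjoint h) c e))" .
  qed
  also have "\<dots> = (\<Sum>i\<le>m. (LINT h|\<mu>. spin_rep m u a i * (spin_rep m h i b * spin_rep n (cadjoint h) c e)))"
    by (intro Bochner_Integration.integral_sum integrable_mult_right haar_integrable continuous_matrix_product)
  also have "\<dots> = (\<Sum>i\<le>m. spin_rep m u a i * matrix_integral m n i b c e)"
    by (simp add: matrix_integral_def)
  finally show ?thesis .
qed

text \<open>For equal spins the scalar of Schur's lemma is found from the trace over the outer
  indices, in which \<open>cadjoint h\<close> and \<open>h\<close> multiply to the identity under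
  the integral.\<close>

lemma matrix_integral_eq:
  assumes le: "a \<le> m" "b \<le> m" "c \<le> n" "d \<le> n"
  shows "matrix_integral m n a b c d = (if m = n \<and> a = d \<and> b = c then 1 / of_nat (n + 1) else 0)"
proof (cases "m = n")
  case False
  then show ?thesis
    using schur_orthogonal[of m n "\<lambda>a d. matrix_integral m n a b c d" a d] matrix_integral_intertwines le by auto
next
  case True
  have "(\<Sum>i\<le>n. matrix_integral n n i b c i) = (LINT h|\<mu>. (\<Sum>i\<le>n. spin_rep n (cadjoint h) c i * spin_rep n h i b))"
    unfolding matrix_integral_def
    by (subst Bochner_Integration.integral_sum) (auto simp: mult.commute intro!: haar_integrable continuous_matrix_product)
  also have "\<dots> = (LINT h|\<mu>. spin_rep n (mat 1) c b)"
  proof (intro Bochner_Integration.integral_cong refl)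
    fix h assume "h \<in> space \<mu>"
    then have "cadjoint h ** h = mat 1" using SU2_cadjoint_left by (simp add: haar_space)
    then show "(\<Sum>i\<le>n. spin_rep n (cadjoint h) c i * spin_rep n h i b) = spin_rep n (mat 1) c b"
      using spin_rep_mult[of b n "cadjoint h" h c] le True by simp
  qed
  also have "\<dots> = (if b = c then 1 else 0)"
    using le True haar_measure_space by (simp add: spin_rep_one)
  finally have "(\<Sum>i\<le>n. matrix_integral n n i b c i) = (if b = c then 1 else 0)" .
  then show ?thesis
    using schur_scalar[of n "\<lambda>a d. matrix_integral n n a b c d" a d] matrix_integral_intertwines[of _ _ n b c n] le True by auto
qed

text \<open>Only \<open>h\<close> has to be unitary. Splitting the characters before integrating
  leaves \<open>A\<close> and \<open>B\<close> arbitrary, as the non-unitary labels of coherent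
  states require.\<close>

lemma spin_char_convolution:
  "(LINT h|\<mu>. spin_char m (h ** A) * spin_char n (B ** cadjoint h)) =
    (if m = n then spin_char n (A ** B) / of_nat (n + 1) else 0)"
proof -
  have "spin_char m (h ** A) * spin_char n (B ** cadjoint h) =
      (\<Sum>a\<le>m. \<Sum>b\<le>m. \<Sum>d\<le>n. \<Sum>c\<le>n. (spin_rep m A b a * spin_rep n B d c) * (spin_rep m h a b * spin_rep n (cadjoint h) c d))" for h
  proof -
    have 1: "spin_char m (h ** A) = (\<Sum>a\<le>m. \<Sum>b\<le>m. spin_rep m h a b * spin_rep m A b a)"
      unfolding spin_char_def by (intro sum.cong refl spin_rep_mult) auto
    have 2: "spin_char n (B ** cadjoint h) = (\<Sum>d\<le>n. \<Sum>c\<le>n. spin_rep n B d c * spin_rep n (cadjoint h) c d)"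
      unfolding spin_char_def by (intro sum.cong refl spin_rep_mult) auto
    show ?thesis unfolding 1 unfolding sum_distrib_right unfolding 2 unfolding sum_distrib_left by (simp only: mult_ac)
  qed
  then have "(LINT h|\<mu>. spin_char m (h ** A) * spin_char n (B ** cadjoint h)) =
      (\<Sum>a\<le>m. \<Sum>b\<le>m. \<Sum>d\<le>n. \<Sum>c\<le>n. (spin_rep m A b a * spin_rep n B d c) * matrix_integral m n a b c d)"
    unfolding matrix_integral_def
    by (simp add: Bochner_Integration.integral_sum haar_integrable continuous_matrix_product)
  also have "\<dots> = (if m = n then spin_char n (A ** B) / of_nat (n + 1) else 0)"
  proof (cases "m = n")
    case True
    have "(\<Sum>d\<le>n. \<Sum>c\<le>n. (spin_rep n A b a * spin_rep n B d c) * matrix_integral n n a b c d) =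
        spin_rep n A b a * spin_rep n B a b / of_nat (n + 1)" if "a \<le> n" "b \<le> n" for a b
    proof -
      have "(\<Sum>d\<le>n. \<Sum>c\<le>n. (spin_rep n A b a * spin_rep n B d c) * matrix_integral n n a b c d)
         = (\<Sum>d\<le>n. \<Sum>c\<le>n. if c = b then (if d = a then spin_rep n A b a * spin_rep n B d c / of_nat (n + 1) else 0) else 0)"
        using that by (intro sum.cong refl) (auto simp: matrix_integral_eq)
      also have "\<dots> = spin_rep n A b a * spin_rep n B a b / of_nat (n + 1)" using that by (simp add: sum.delta)
      finally show ?thesis .
    qed
    then have "(\<Sum>a\<le>n. \<Sum>b\<le>n. \<Sum>d\<le>n. \<Sum>c\<le>n. (spin_rep n A b a * spin_rep n B d c) * matrix_integral n n a b c d)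
       = (\<Sum>a\<le>n. \<Sum>b\<le>n. spin_rep n A b a * spin_rep n B a b / of_nat (n + 1))"
      by (intro sum.cong refl) auto
    also have "\<dots> = (\<Sum>b\<le>n. \<Sum>a\<le>n. spin_rep n A b a * spin_rep n B a b / of_nat (n + 1))" by (rule sum.swap)
    also have "\<dots> = spin_char n (A ** B) / of_nat (n + 1)"
      unfolding spin_char_def sum_divide_distrib by (intro sum.cong refl) (simp add: spin_rep_mult sum_divide_distrib)
    finally show ?thesis using True by simp
  next
    case False
    then show ?thesis by (simp add: matrix_integral_eq)
  qed
  finally show ?thesis .
qed

end

section \<open>Inner products of coherent states\<close>

lemma integral_dominated_series:
  fixes f :: "nat \<Rightarrow> 'a \<Rightarrow> complex"
  assumes "finite_measure M" and meas: "\<And>n. f n \<in> borel_measurable M"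
    and le: "\<And>n x. x \<in> space M \<Longrightarrow> norm (f n x) \<le> B n" and B: "summable B"
  shows "(\<lambda>n. LINT x|M. f n x) sums (LINT x|M. (\<Sum>n. f n x))"
proof -
  interpret finite_measure M by fact
  have int: "integrable M (f n)" for n
    by (rule integrable_const_bound[where B = "B n"]) (use le meas in auto)
  show ?thesis
  proof (rule sums_integral[OF int])
    show "AE x in M. summable (\<lambda>n. norm (f n x))"
      by (rule AE_I2, rule summable_comparison_test'[OF B, of 0]) (simp add: le)
    show "summable (\<lambda>n. LINT x|M. norm (f n x))"
    proof (rule summable_comparison_test'[OF summable_mult2[OF B, of "measure M (space M)"], of 0])
      fix n
      have "(LINT x|M. norm (f n x)) \<le> (LINT x|M. B n)"
        by (intro integral_mono integrable_norm int integrable_const) (rule le)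
      then show "norm (LINT x|M. norm (f n x)) \<le> B n * measure M (space M)"
        by (simp add: mult.commute)
    qed
  qed
qed

text \<open>Written as the coefficient of \<open>char_series\<close> at \<open>t / 2\<close>, so
  that the bounds for that series apply to the states.\<close>

definition coherent_coeff :: "real \<Rightarrow> nat \<Rightarrow> real" where
  "coherent_coeff t n = real (n + 1) * exp (- ((t / 2) / 4) * (real n * real (n + 2)))"

lemma coherent_state_eq:
  assumes "h \<in> SU2"
  shows "coherent_state t g h = (\<Sum>n. of_real (coherent_coeff t n) * spin_char n (g ** cadjoint h))"
  unfolding coherent_state_def SU2_matrix_inv[OF assms] Let_def
  by (rule arg_cong[of _ _ suminf], rule ext) (simp add: coherent_coeff_def field_simps)

text \<open>Entries of elements of SU(2) have modulus at most 1, so the trace of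
  \<open>g ** cadjoint h\<close>, and with it \<open>Re z\<close>, is bounded uniformly in
  \<open>h\<close>.\<close>

lemma coherent_term_bound:
  assumes t: "t > 0" and g: "det g = 1"
  obtains B where "summable B"
    "\<And>n h. h \<in> SU2 \<Longrightarrow> norm (of_real (coherent_coeff t n) * spin_char n (g ** cadjoint h)) \<le> B n"
proof -
  define G where "G = norm (g $ 1 $ 1) + norm (g $ 1 $ 2) + norm (g $ 2 $ 1) + norm (g $ 2 $ 2)"
  have G: "G \<ge> 0" by (simp add: G_def)
  define R where "R = ln (G + 1)"
  have "norm (of_real (coherent_coeff t n) * spin_char n (g ** cadjoint h))
      \<le> exp (- ((t / 2) / 4) * (real n)\<^sup>2 + (R + 2) * real n)" if h: "h \<in> SU2" for n h
  proof -
    obtain z where z: "tr2 (g ** cadjoint h) = 2 * cosh z" using ex_half_trace by blast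
    have le: "norm (g $ i $ j * cnj (h $ k $ l)) \<le> norm (g $ i $ j)" for i j k l
      using SU2_nth_le[OF h] by (simp add: norm_mult mult_left_le)
    have "2 * norm (cosh z) = norm (tr2 (g ** cadjoint h))" unfolding z by (simp add: norm_mult)
    also have "\<dots> \<le> G"
      unfolding tr2_def cmat2_mult_nth cadjoint_nth G_def add.assoc
      by (intro norm_triangle_mono le)
    finally have "exp \<bar>Re z\<bar> \<le> G + 1" using exp_abs_Re_le[of z] by linarith
    then have "ln (exp \<bar>Re z\<bar>) \<le> R" unfolding R_def using G by (subst ln_le_cancel_iff) auto
    then have R: "\<bar>Re z\<bar> \<le> R" by simp
    have "det (g ** cadjoint h) = 1" by (simp add: det_mul g det_cadjoint SU2_det[OF h])
    then have "spin_char n (g ** cadjoint h) = char_value n z" using z by (rule spin_char_eq)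
    then show ?thesis unfolding coherent_coeff_def
      using norm_char_series_term_le[of "t / 2" z R n] t R by simp
  qed
  then show ?thesis using that summable_gauss[of "t / 2" "R + 2"] t by simp
qed

text \<open>The double series is integrated one index at a time by dominated convergence. For fixed
  \<open>n\<close>, orthogonality keeps only \<open>m = n\<close>, and the product of the two
  coefficients over \<open>n + 1\<close> is the weight in \<open>char_series\<close>.\<close>

lemma L2_inner_coherent_state:
  assumes haar: "normalized_haar_SU2 \<mu>" and t: "t > 0" and g: "det g = 1" "det g' = 1"
    and z: "tr2 (cadjoint g ** g') = 2 * cosh z"
  shows "L2_inner \<mu> (coherent_state t g) (coherent_state t g') = char_series t z"
proof -
  let ?c = "\<lambda>n. complex_of_real (coherent_coeff t n)"
  define a where "a n h = ?c n * spin_char n (h ** cadjoint g)" for n h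
  define b where "b n h = ?c n * spin_char n (g' ** cadjoint h)" for n h
  have fin: "finite_measure \<mu>" by (rule haar_finite_measure[OF haar])
  have space: "space \<mu> = SU2" by (rule haar_space[OF haar])
  have am: "a n \<in> borel_measurable \<mu>" for n
    unfolding a_def[abs_def] by (intro haar_measurable[OF haar] continuous_on_mult continuous_on_const continuous_spin_char_right)
  have bm: "b n \<in> borel_measurable \<mu>" for n
    unfolding b_def[abs_def] by (intro haar_measurable[OF haar] continuous_on_mult continuous_on_const continuous_spin_char_cadjoint)
  have acnj: "a n h = cnj (?c n * spin_char n (g ** cadjoint h))" if h: "h \<in> SU2" for n h
  proof -
    have "det (g ** cadjoint h) = 1" by (simp add: det_mul g det_cadjoint SU2_det[OF h])
    from spin_char_cadjoint[OF this, of n] show ?thesis by (simp add: a_def cadjoint_mult)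
  qed
  obtain A where A: "summable A" "\<And>n h. h \<in> SU2 \<Longrightarrow> norm (a n h) \<le> A n"
    using coherent_term_bound[OF t g(1)] acnj complex_mod_cnj by metis
  obtain B where B: "summable B" "\<And>n h. h \<in> SU2 \<Longrightarrow> norm (b n h) \<le> B n"
    using coherent_term_bound[OF t g(2)] unfolding b_def by metis
  have one: "mat 1 \<in> SU2" by (simp add: SU2_def cmat2_eq_iff cmat2_mult_nth det_2)
  have A0: "A n \<ge> 0" for n using A(2)[OF one, of n] norm_ge_zero order_trans by blast
  have B0: "B n \<ge> 0" for n using B(2)[OF one, of n] norm_ge_zero order_trans by blast
  have as: "summable (\<lambda>n. a n h)" if "h \<in> SU2" for h
    by (rule summable_comparison_test'[OF A(1), of 0]) (use A(2) that in auto)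
  have bs: "summable (\<lambda>n. b n h)" if "h \<in> SU2" for h
    by (rule summable_comparison_test'[OF B(1), of 0]) (use B(2) that in auto)
  define F where "F h = (\<Sum>n. a n h)" for h
  have Fm: "F \<in> borel_measurable \<mu>" unfolding F_def[abs_def] using am by measurable
  have Fle: "norm (F h) \<le> suminf A" if "h \<in> SU2" for h
    unfolding F_def by (rule norm_suminf_le) (use A that in auto)
  have F_eq: "cnj (coherent_state t g h) = F h" if h: "h \<in> SU2" for h
  proof -
    have "(\<lambda>n. cnj (a n h)) sums cnj (F h)"
      unfolding F_def sums_cnj by (rule summable_sums[OF as[OF h]])
    then have "(\<lambda>n. ?c n * spin_char n (g ** cadjoint h)) sums cnj (F h)" by (simp add: acnj[OF h])
    then show ?thesis unfolding coherent_state_eq[OF h] by (simp add: sums_iff)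
  qed
  have "L2_inner \<mu> (coherent_state t g) (coherent_state t g') = (LINT h|\<mu>. (\<Sum>n. F h * b n h))"
    unfolding L2_inner_def
  proof (rule Bochner_Integration.integral_cong[OF refl])
    fix h assume "h \<in> space \<mu>"
    then have h: "h \<in> SU2" by (simp add: space)
    show "cnj (coherent_state t g h) * coherent_state t g' h = (\<Sum>n. F h * b n h)"
      unfolding F_eq[OF h] unfolding coherent_state_eq[OF h] b_def[symmetric] using suminf_mult[OF bs[OF h]] by simp
  qed
  moreover have "(\<lambda>n. LINT h|\<mu>. F h * b n h) sums (LINT h|\<mu>. (\<Sum>n. F h * b n h))"
  proof (rule integral_dominated_series[OF fin])
    show "(\<lambda>h. F h * b n h) \<in> borel_measurable \<mu>" for n using Fm bm by measurable
    show "norm (F h * b n h) \<le> suminf A * B n" if "h \<in> space \<mu>" for n h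
      using that Fle B(2) A0 unfolding norm_mult space by (intro mult_mono suminf_nonneg A(1)) auto
    show "summable (\<lambda>n. suminf A * B n)" by (intro summable_mult B(1))
  qed
  moreover have "(LINT h|\<mu>. F h * b n h) = of_real (real (n + 1) * exp (- (t / 4) * (real n * real (n + 2)))) * char_value n z" for n
  proof -
    have "(\<lambda>m. LINT h|\<mu>. a m h * b n h) sums (LINT h|\<mu>. (\<Sum>m. a m h * b n h))"
    proof (rule integral_dominated_series[OF fin])
      show "(\<lambda>h. a m h * b n h) \<in> borel_measurable \<mu>" for m using am bm by measurable
      show "norm (a m h * b n h) \<le> A m * B n" if "h \<in> space \<mu>" for m h
        using that A(2) B(2) A0 unfolding norm_mult space by (intro mult_mono) auto
      show "summable (\<lambda>m. A m * B n)" by (intro summable_mult2 A(1))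
    qed
    moreover have "(LINT h|\<mu>. (\<Sum>m. a m h * b n h)) = (LINT h|\<mu>. F h * b n h)"
      by (rule Bochner_Integration.integral_cong[OF refl]) (simp add: space F_def suminf_mult2[OF as])
    moreover have "(LINT h|\<mu>. a m h * b n h) = (if m = n then ?c n * ?c n * spin_char n (cadjoint g ** g') / of_nat (n + 1) else 0)" for m
    proof -
      have "(LINT h|\<mu>. a m h * b n h) = (LINT h|\<mu>. (?c m * ?c n) * (spin_char m (h ** cadjoint g) * spin_char n (g' ** cadjoint h)))"
        by (rule Bochner_Integration.integral_cong[OF refl]) (simp add: a_def b_def mult_ac)
      also have "\<dots> = (?c m * ?c n) * (LINT h|\<mu>. spin_char m (h ** cadjoint g) * spin_char n (g' ** cadjoint h))"
        by (rule integral_mult_right_zero)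
      finally show ?thesis unfolding spin_char_convolution[OF haar] by auto
    qed
    ultimately have "(\<lambda>m. if m = n then ?c n * ?c n * spin_char n (cadjoint g ** g') / of_nat (n + 1) else 0) sums (LINT h|\<mu>. F h * b n h)"
      by simp
    then have "(LINT h|\<mu>. F h * b n h) = ?c n * ?c n * spin_char n (cadjoint g ** g') / of_nat (n + 1)"
      using sums_unique2[OF _ sums_single] by fast
    also have "spin_char n (cadjoint g ** g') = char_value n z"
      by (rule spin_char_eq[OF _ z]) (simp add: det_mul det_cadjoint g)
    also have "?c n * ?c n * char_value n z / of_nat (n + 1) = of_real (coherent_coeff t n * coherent_coeff t n / real (n + 1)) * char_value n z"
      by simp
    also have "coherent_coeff t n * coherent_coeff t n / real (n + 1) = real (n + 1) * exp (- (t / 4) * (real n * real (n + 2)))"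
    proof -
      define e where "e = exp (- ((t / 2) / 4) * (real n * real (n + 2)))"
      have "exp (- (t / 4) * (real n * real (n + 2))) = e * e"
        unfolding e_def exp_add[symmetric] by (rule arg_cong[of _ _ exp]) (simp add: field_simps)
      moreover have "r * e * (r * e) / r = r * (e * e)" if "r \<noteq> 0" for r using that by simp
      moreover have "real (n + 1) \<noteq> 0" by simp
      ultimately show ?thesis unfolding coherent_coeff_def e_def[symmetric] by metis
    qed
    finally show ?thesis .
  qed
  ultimately show ?thesis unfolding char_series_def by (simp add: sums_iff)
qed

lemma L2_norm_square: "(L2_norm \<mu> f)\<^sup>2 = norm (L2_inner \<mu> f f)"
proof -
  have "L2_inner \<mu> f f = (LINT h|\<mu>. complex_of_real ((cmod (f h))\<^sup>2))"
    unfolding L2_inner_def complex_norm_square by (simp only: mult.commute)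
  also have "\<dots> = of_real (LINT h|\<mu>. (cmod (f h))\<^sup>2)" by (rule integral_complex_of_real)
  finally have "L2_inner \<mu> f f = of_real (LINT h|\<mu>. (cmod (f h))\<^sup>2)" .
  moreover have "(LINT h|\<mu>. (cmod (f h))\<^sup>2) \<ge> 0" by (rule Bochner_Integration.integral_nonneg) simp
  ultimately show ?thesis by (simp only: L2_norm_def norm_of_real abs_of_nonneg real_sqrt_pow2)
qed

lemma char_series_cnj: "t > 0 \<Longrightarrow> char_series t (cnj z) = cnj (char_series t z)"
proof -
  assume "t > 0"
  from summable_sums[OF summable_char_series[OF this, of z]]
  have "(\<lambda>n. cnj (of_real (real (n + 1) * exp (- (t / 4) * (real n * real (n + 2)))) * char_value n z)) sums cnj (char_series t z)"
    unfolding char_series_def sums_cnj .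
  then show ?thesis unfolding char_series_def[of t "cnj z"] char_value_cnj
    by (simp only: complex_cnj_mult complex_cnj_complex_of_real sums_iff)
qed

section \<open>Matrix exponentials in Pauli coordinates and their traces\<close>

lemma cscale_nth [simp]: "cscale c A $ i $ j = c * A $ i $ j"
  by (simp add: cscale_def map_matrix_def)

lemma cscale_sums: "f sums z \<Longrightarrow> (\<lambda>n. cscale (f n) A) sums cscale z A"
proof -
  assume f: "f sums z"
  have "linear (\<lambda>z. cscale z A)" by (rule linearI) (simp_all add: cmat2_eq_iff algebra_simps)
  then have "bounded_linear (\<lambda>z. cscale z A)" by (rule linear_conv_bounded_linear[THEN iffD1])
  then show ?thesis using bounded_linear.sums f by blast
qed

text \<open>Even powers are multiples of the identity and odd ones of \<open>E\<close>; the
  exponential series splits into those of \<open>cosh\<close> and \<open>sinh\<close>.\<close>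

lemma mexp_involution:
  assumes E: "E ** E = mat 1"
  shows "mexp (cscale c E) = cscale (cosh c) (mat 1) + cscale (sinh c) E"
proof -
  have m1: "cscale c E ** cscale d (mat 1) = cscale (c * d) E" for d
    by (simp add: cmat2_eq_iff cmat2_mult_nth)
  have m2: "cscale c E ** cscale d E = cscale (c * d) (mat 1)" for d
    unfolding E[symmetric] by (simp add: cmat2_eq_iff cmat2_mult_nth algebra_simps)
  have pow: "((**) (cscale c E) ^^ n) (mat 1) = (if even n then cscale (c ^ n) (mat 1) else cscale (c ^ n) E)" for n
  proof (induction n)
    case 0 then show ?case by (simp add: cmat2_eq_iff)
  next
    case (Suc n) then show ?case by (simp add: m1 m2)
  qed
  have "(1 / fact n) *\<^sub>R ((**) (cscale c E) ^^ n) (mat 1) =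
      cscale (if even n then c ^ n /\<^sub>R fact n else 0) (mat 1) + cscale (if even n then 0 else c ^ n /\<^sub>R fact n) E" for n
    unfolding pow by (simp add: cmat2_eq_iff divide_inverse)
  then have "(\<lambda>n. (1 / fact n) *\<^sub>R ((**) (cscale c E) ^^ n) (mat 1)) sums (cscale (cosh c) (mat 1) + cscale (sinh c) E)"
    using sums_add[OF cscale_sums[OF cosh_converges[of c], of "mat 1"] cscale_sums[OF sinh_converges[of c], of E]] by simp
  then show ?thesis unfolding mexp_def by (simp only: sums_iff)
qed

text \<open>The Hermitian matrix \<open>v . sigma\<close>. Its square is the squared length of
  \<open>v\<close> times the identity, so unit vectors give the involutions to which
  \<open>mexp_involution\<close> applies.\<close>

definition bloch :: "real^3 \<Rightarrow> cmat2" where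
  "bloch v = mat2 (of_real (v $ 3)) (Complex (v $ 1) (- v $ 2)) (Complex (v $ 1) (v $ 2)) (- of_real (v $ 3))"

lemma inner_real3: "v \<bullet> w = v $ 1 * w $ 1 + v $ 2 * w $ 2 + v $ 3 * w $ 3" for v w :: "real^3"
  by (simp add: inner_vec_def sum_3)

lemma tau_sum_bloch: "tau_sum v = cscale (- \<i>) (bloch v)"
  unfolding tau_sum_def sum_3
  by (simp add: cmat2_eq_iff tau_def pauli_def bloch_def vector_2 complex_eq_iff)

lemma bloch_scaleR: "bloch (r *\<^sub>R v) = cscale (of_real r) (bloch v)"
  by (simp add: cmat2_eq_iff bloch_def complex_eq_iff)

lemma bloch_square: "bloch v ** bloch v = cscale (of_real (v \<bullet> v)) (mat 1)"
  by (simp add: cmat2_eq_iff cmat2_mult_nth bloch_def inner_real3 complex_eq_iff algebra_simps)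

lemma mexp_tau_sum:
  "mexp (cscale a (tau_sum v)) =
    cscale (cosh (a * \<i> * of_real (norm v))) (mat 1) - cscale (sinh (a * \<i> * of_real (norm v))) (bloch (sgn v))"
proof (cases "v = 0")
  case True
  have "cscale a (tau_sum v) = cscale 0 (mat 1)"
    by (simp add: True tau_sum_bloch cmat2_eq_iff bloch_def complex_eq_iff)
  then have "mexp (cscale a (tau_sum v)) = mexp (cscale 0 (mat 1))" by (simp only:)
  also have "mexp (cscale 0 (mat 1)) = cscale (cosh 0) (mat 1) + cscale (sinh 0) (mat 1)"
    by (rule mexp_involution) simp
  finally show ?thesis by (simp only:) (simp add: True cmat2_eq_iff)
next
  case False
  have "bloch (sgn v) ** bloch (sgn v) = mat 1"
    using False by (simp add: bloch_square norm_sgn dot_square_norm cmat2_eq_iff)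
  from mexp_involution[OF this, of "- (a * \<i> * of_real (norm v))"]
  have e: "mexp (cscale (- (a * \<i> * of_real (norm v))) (bloch (sgn v))) =
    cscale (cosh (a * \<i> * of_real (norm v))) (mat 1) + cscale (- sinh (a * \<i> * of_real (norm v))) (bloch (sgn v))"
    by simp
  have "v = norm v *\<^sub>R sgn v" using False by (simp add: sgn_div_norm)
  then have "tau_sum v = cscale (- \<i>) (cscale (of_real (norm v)) (bloch (sgn v)))"
    unfolding tau_sum_bloch bloch_scaleR[symmetric] by simp
  then have "cscale a (tau_sum v) = cscale (- (a * \<i> * of_real (norm v))) (bloch (sgn v))"
    by (simp add: cmat2_eq_iff)
  then show ?thesis by (simp only: e) (simp add: cmat2_eq_iff)
qed

lemma tr2_bloch_product:
  "tr2 ((cscale c (mat 1) - cscale s (bloch v)) ** (cscale c' (mat 1) - cscale s' (bloch w))) =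
    2 * (c * c' + s * s' * of_real (v \<bullet> w))"
  by (simp add: tr2_def cmat2_mult_nth bloch_def inner_real3 complex_eq_iff algebra_simps)

lemma mexp_boost: "mexp (cscale (- \<i> / 2) (tau_sum v)) =
    cscale (of_real (cosh (norm v / 2))) (mat 1) - cscale (of_real (sinh (norm v / 2))) (bloch (sgn v))"
proof -
  have "- \<i> / 2 * \<i> * of_real (norm v) = complex_of_real (norm v / 2)" by simp
  moreover have "cosh (complex_of_real r) = of_real (cosh r)" "sinh (complex_of_real r) = of_real (sinh r)" for r
    by (simp_all add: sinh_field_def cosh_field_def exp_of_real[symmetric])
  ultimately show ?thesis unfolding mexp_tau_sum by (simp only:)
qed

lemma cadjoint_mexp_rotation: "cadjoint (mexp (tau_sum v)) =
    cscale (of_real (cos (norm v))) (mat 1) - cscale (- \<i> * of_real (sin (norm v))) (bloch (sgn v))"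
proof -
  have "tau_sum v = cscale 1 (tau_sum v)" by (simp add: cmat2_eq_iff)
  then have "mexp (tau_sum v) = cscale (cosh (1 * \<i> * of_real (norm v))) (mat 1) - cscale (sinh (1 * \<i> * of_real (norm v))) (bloch (sgn v))"
    by (metis mexp_tau_sum)
  moreover have "cosh (1 * \<i> * of_real r) = complex_of_real (cos r)" "sinh (1 * \<i> * of_real r) = \<i> * complex_of_real (sin r)" for r
    by (simp_all add: cosh_conv_cos sinh_conv_sin cos_of_real sin_of_real mult.assoc[symmetric])
  ultimately show ?thesis by (simp add: cmat2_eq_iff bloch_def complex_eq_iff)
qed

lemma tr2_boost_square:
  assumes "H = mexp (cscale (- \<i> / 2) (tau_sum v))"
  shows "tr2 (H ** H) = 2 * cosh (complex_of_real (norm v))"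
proof -
  have "cosh (norm v) = cosh (norm v / 2) * cosh (norm v / 2) + sinh (norm v / 2) * sinh (norm v / 2) * (sgn v \<bullet> sgn v)"
  proof (cases "v = 0")
    case False
    then show ?thesis using cosh_add[of "norm v / 2" "norm v / 2"] by (simp add: norm_sgn dot_square_norm)
  qed simp
  moreover have "cosh (complex_of_real r) = of_real (cosh r)" for r
    by (simp add: cosh_field_def exp_of_real[symmetric])
  ultimately show ?thesis unfolding assms mexp_boost tr2_bloch_product by simp
qed

section \<open>The overlap bound\<close>

text \<open>These are the distances of \<open>cosh z\<close> from the foci -1 and 1 of the confocal
  ellipses and hyperbolas that are the images of the coordinate lines.\<close>

lemma cosh_complex_polar:
  "norm (cosh z - 1) = cosh (Re z) - cos (Im z)" "norm (cosh z + 1) = cosh (Re z) + cos (Im z)"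
  "Re (cosh z) = cosh (Re z) * cos (Im z)"
proof -
  let ?s = "Re z" and ?p = "Im z"
  have re: "Re (cosh z) = cosh ?s * cos ?p" and im: "Im (cosh z) = sinh ?s * sin ?p"
    by (simp_all add: cosh_field_def cosh_def sinh_def Re_exp Im_exp field_simps)
  show "Re (cosh z) = cosh ?s * cos ?p" by (rule re)
  have id: "(cosh ?s)\<^sup>2 - (sinh ?s)\<^sup>2 = 1" "(sin ?p)\<^sup>2 + (cos ?p)\<^sup>2 = 1"
    by (simp_all add: cosh_square_eq)
  have "(cosh ?s * cos ?p - 1)\<^sup>2 + (sinh ?s * sin ?p)\<^sup>2 = (cosh ?s - cos ?p)\<^sup>2"
    "(cosh ?s * cos ?p + 1)\<^sup>2 + (sinh ?s * sin ?p)\<^sup>2 = (cosh ?s + cos ?p)\<^sup>2"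
    using id by algebra+
  then have "norm (cosh z - 1) = \<bar>cosh ?s - cos ?p\<bar>" "norm (cosh z + 1) = \<bar>cosh ?s + cos ?p\<bar>"
    by (simp_all add: cmod_def re im)
  then show "norm (cosh z - 1) = cosh ?s - cos ?p" "norm (cosh z + 1) = cosh ?s + cos ?p"
    using cosh_real_ge_1[of ?s] cos_le_one[of ?p] cos_ge_minus_one[of ?p] by simp_all
qed

section \<open>The branch of the inverse hyperbolic cosine at its branch points\<close>

lemma is_arcosh_arcosh_br: "is_arcosh x (arcosh_br x)"
  unfolding arcosh_br_def by (rule theI'[OF ex1_is_arcosh])

lemma arcosh_br_props: "cosh (arcosh_br x) = x" "0 \<le> Im (arcosh_br x)" "Im (arcosh_br x) \<le> pi"
  using is_arcosh_arcosh_br[of x] by (simp_all add: is_arcosh_def)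

text \<open>Half the sum and half the difference of the focal distances are \<open>cosh s\<close>
  and \<open>cos \<phi>\<close>, continuous in \<open>x\<close>. The branch itself jumps across the
  real rays \<open>\<bar>x\<bar> > 1\<close>, but only in the sign of \<open>s\<close>, which is
  harmless where \<open>s\<close> tends to 0.\<close>

lemma arcosh_br_tendsto:
  assumes "x = 1 \<and> w = 0 \<or> x = - 1 \<and> w = \<i> * of_real pi"
  shows "(arcosh_br \<longlongrightarrow> w) (at x)"
proof -
  define c where "c y = (norm (y + 1) + norm (y - 1)) / 2" for y :: complex
  define d where "d y = (norm (y + 1) - norm (y - 1)) / 2" for y :: complex
  have cd: "cosh (Re (arcosh_br y)) = c y" "cos (Im (arcosh_br y)) = d y" for y
    using cosh_complex_polar(1,2)[of "arcosh_br y"] by (simp_all add: arcosh_br_props c_def d_def)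
  have "(c \<longlongrightarrow> c x) (at x)" "(d \<longlongrightarrow> d x) (at x)"
    unfolding c_def[abs_def] d_def[abs_def] by (intro tendsto_intros; simp)+
  moreover have cx: "c x = 1" and dx: "d x = (if x = 1 then 1 else - 1)" using assms by (auto simp: c_def d_def)
  ultimately have lim: "(c \<longlongrightarrow> 1) (at x)" "(d \<longlongrightarrow> d x) (at x)" by simp_all
  have "((\<lambda>y. arcosh (c y)) \<longlongrightarrow> arcosh 1) (at x)"
    by (rule continuous_on_tendsto_compose[OF continuous_on_arcosh[of "{1..}"] lim(1)])
      (auto simp: cd(1)[symmetric] cosh_real_ge_1)
  moreover have "arcosh (c y) = \<bar>Re (arcosh_br y)\<bar>" for y
  proof -
    have "cosh (Re (arcosh_br y)) = cosh \<bar>Re (arcosh_br y)\<bar>" by (simp add: abs_if)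
    then show ?thesis unfolding cd(1)[symmetric] by (simp only: arcosh_cosh_real abs_ge_zero)
  qed
  ultimately have "((\<lambda>y. \<bar>Re (arcosh_br y)\<bar>) \<longlongrightarrow> 0) (at x)" by simp
  then have re: "((\<lambda>y. Re (arcosh_br y)) \<longlongrightarrow> 0) (at x)" by (simp add: tendsto_rabs_zero_iff)
  have "((\<lambda>y. arccos (d y)) \<longlongrightarrow> arccos (d x)) (at x)"
    by (rule continuous_on_tendsto_compose[OF continuous_on_arccos' lim(2)])
      (auto simp: cd(2)[symmetric] dx)
  moreover have "arccos (d y) = Im (arcosh_br y)" for y
    unfolding cd(2)[symmetric] by (intro arccos_cos arcosh_br_props)
  ultimately have "((\<lambda>y. Im (arcosh_br y)) \<longlongrightarrow> Im w) (at x)" using assms dx by auto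
  moreover have "Re w = 0" using assms by auto
  ultimately show ?thesis using re by (intro tendsto_complex_iff[THEN iffD2]) simp
qed

lemma norm_sinh_square: "(norm (sinh z))\<^sup>2 = norm ((cosh z)\<^sup>2 - 1)" for z :: complex
  by (simp add: cosh_square_eq norm_power)

lemma sinh_minus_i_pi: "sinh (z - \<i> * of_real pi) = - sinh z"
  by (simp add: sinh_field_def exp_diff exp_minus exp_add field_simps)

text \<open>Since \<open>x^2 - 1\<close> is the square of \<open>sinh (arcosh_br x)\<close> and
  subtracting \<open>\<i> * pi\<close> only changes the sign of \<open>sinh\<close>, the limit is
  that of \<open>norm v / norm (sinh v)\<close> at \<open>v = 0\<close>.\<close>

lemma Lim_arcosh_ratio:
  assumes "x = 1 \<and> w = 0 \<or> x = - 1 \<and> w = \<i> * of_real pi"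
  shows "Lim (at x) (\<lambda>y. (cmod (arcosh_br y - w))\<^sup>2 / cmod (y\<^sup>2 - 1)) = 1"
proof (rule tendsto_Lim[OF trivial_limit_at])
  have e: "(cmod (arcosh_br y - w))\<^sup>2 / cmod (y\<^sup>2 - 1) = (norm (arcosh_br y - w) / norm (sinh (arcosh_br y - w)))\<^sup>2" for y
  proof -
    have "norm (sinh (arcosh_br y - w)) = norm (sinh (arcosh_br y))" using assms by (auto simp: sinh_minus_i_pi)
    then show ?thesis using norm_sinh_square[of "arcosh_br y"] by (simp add: arcosh_br_props power_divide)
  qed
  have "((\<lambda>y. arcosh_br y - w) \<longlongrightarrow> w - w) (at x)" by (intro tendsto_diff arcosh_br_tendsto assms tendsto_const)
  moreover have "\<forall>\<^sub>F y in at x. arcosh_br y - w \<noteq> 0"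
  proof (rule eventually_at_topological[THEN iffD2], intro exI[of _ UNIV] conjI ballI impI)
    fix y assume "y \<noteq> x"
    have "cosh w = x" using assms by (auto simp: cosh_conv_cos mult.assoc[symmetric])
    then show "arcosh_br y - w \<noteq> 0" using arcosh_br_props(1)[of y] \<open>y \<noteq> x\<close> by auto
  qed auto
  ultimately have "filterlim (\<lambda>y. arcosh_br y - w) (at 0) (at x)" by (auto simp: filterlim_at)
  from filterlim_compose[OF tendsto_norm_over_sinh this]
  have "((\<lambda>y. norm (arcosh_br y - w) / norm (sinh (arcosh_br y - w))) \<longlongrightarrow> 1) (at x)" .
  then have "((\<lambda>y. (norm (arcosh_br y - w) / norm (sinh (arcosh_br y - w)))\<^sup>2) \<longlongrightarrow> 1\<^sup>2) (at x)"
    by (rule tendsto_power)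
  then show "((\<lambda>y. (cmod (arcosh_br y - w))\<^sup>2 / cmod (y\<^sup>2 - 1)) \<longlongrightarrow> 1) (at x)" by (simp add: e)
qed

text \<open>The condition on the imaginary part excludes the branch point at which the ratio would
  have no finite limit: -1 if \<open>w = 0\<close>, and 1 if \<open>w = \<i> * pi\<close>.\<close>

lemma ext_pm1_ratio:
  assumes "w = 0 \<and> Im (arcosh_br x) < pi \<or> w = \<i> * of_real pi \<and> 0 < Im (arcosh_br x)"
  shows "ext_pm1 (\<lambda>y. (cmod (arcosh_br y - w))\<^sup>2 / cmod (y\<^sup>2 - 1)) x = (ratio_sinh (arcosh_br x - w) (arcosh_br x))\<^sup>2"
proof (cases "x = 1 \<or> x = - 1")
  case True
  have sq: "(norm (sinh (arcosh_br x)))\<^sup>2 = norm (x\<^sup>2 - 1)" using norm_sinh_square[of "arcosh_br x"] by (simp add: arcosh_br_props)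
  then have s0: "sinh (arcosh_br x) = 0" using True by auto
  have "x = 1 \<and> w = 0 \<or> x = - 1 \<and> w = \<i> * of_real pi"
  proof (cases "w = 0")
    case w0: True
    then have "arcosh_br x = 0" using assms arcosh_br_props(2) by (intro sinh_eq_0_near[OF s0]) auto
    then have "x = 1" using arcosh_br_props(1)[of x] by simp
    then show ?thesis using w0 by simp
  next
    case False
    then have "arcosh_br x = \<i> * of_real pi" using assms arcosh_br_props(3) by (intro sinh_eq_0_far[OF s0]) auto
    then have "x = - 1" using arcosh_br_props(1)[of x] by (simp add: cosh_conv_cos mult.assoc[symmetric])
    then show ?thesis using False assms by auto
  qed
  then show ?thesis using True s0 Lim_arcosh_ratio by (simp add: ext_pm1_def ratio_sinh_def)
next
  case False
  have sq: "(norm (sinh (arcosh_br x)))\<^sup>2 = norm (x\<^sup>2 - 1)" using norm_sinh_square[of "arcosh_br x"] by (simp add: arcosh_br_props)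
  have "x\<^sup>2 - 1 \<noteq> 0" using False by (simp add: power2_eq_1_iff)
  then have "sinh (arcosh_br x) \<noteq> 0" using sq by auto
  then show ?thesis using False sq by (simp add: ext_pm1_def ratio_sinh_def power_divide)
qed

lemma exp_decaying_decay:
  assumes "c > 0" shows "exp_decaying (\<lambda>t. c * decay t)"
  unfolding exp_decaying_def
proof (intro conjI allI impI exI)
  show "0 < c * decay t" for t using assms by (simp add: decay_def)
  show "0 < c * 500" "0 < (1 / 2 :: real)" "0 < (1 :: real)" using assms by auto
  show "c * decay t \<le> c * 500 * exp (- (1 / 2) / t)" if "0 < t \<and> t < 1" for t
    by (simp add: decay_def)
qed

text \<open>The constant \<kappa> cancels. If it is 0, then \<open>I = 0\<close> and the bound is
  trivial, so the constant of the theta transformation never has to be shown nonzero.\<close>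

lemma quotient_bound:
  fixes \<kappa> :: real
  assumes "\<kappa> \<ge> 0" "R \<ge> 0" "F \<ge> 0" "q > 0" "q' > 0" "D > 0"
    and I: "0 \<le> I" "I \<le> \<kappa> * R * exp a * F"
    and n: "\<kappa> * q * exp b * D \<le> n" "\<kappa> * q' * exp b' * D \<le> n'"
  shows "I\<^sup>2 / (n * n') \<le> (R\<^sup>2 * exp (2 * a - b - b') * F\<^sup>2) / (q * D * (q' * D))"
proof (cases "\<kappa> = 0")
  case True
  then have "I = 0" using I by simp
  then show ?thesis using assms(2-6) by (simp add: zero_le_divide_iff)
next
  case False
  then have k: "\<kappa> > 0" using assms by simp
  have pos: "0 < \<kappa> * q * exp b * D" "0 < \<kappa> * q' * exp b' * D" using k assms by simp_all
  have "I\<^sup>2 \<le> (\<kappa> * R * exp a * F)\<^sup>2" using I by (intro power_mono) auto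
  moreover have "(\<kappa> * q * exp b * D) * (\<kappa> * q' * exp b' * D) \<le> n * n'"
    using n pos by (intro mult_mono) auto
  ultimately have "I\<^sup>2 / (n * n') \<le> (\<kappa> * R * exp a * F)\<^sup>2 / ((\<kappa> * q * exp b * D) * (\<kappa> * q' * exp b' * D))"
    using pos by (intro frac_le) auto
  also have "\<dots> = (R\<^sup>2 * (exp a * exp a / (exp b * exp b')) * F\<^sup>2) / (q * D * (q' * D))"
    using k assms by (simp add: power2_eq_square field_simps)
  also have "exp a * exp a / (exp b * exp b') = exp (2 * a - b - b')"
    by (simp add: exp_add[symmetric] exp_diff[symmetric] algebra_simps)
  finally show ?thesis .
qed

lemma x_over_sinh_pos: "p \<ge> 0 \<Longrightarrow> x_over_sinh p > 0"
  by (auto simp: x_over_sinh_def)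

text \<open>By cyclicity the unitary factor drops out of the trace, which leaves that of
  \<open>H ** H\<close>.\<close>

lemma norm_coherent_state_polar:
  assumes haar: "normalized_haar_SU2 \<mu>" and t: "t > 0"
    and g: "g \<in> SL2C" "polar_decomposition g H u" "H = mexp (cscale (- \<i> / 2) (tau_sum pv))"
  shows "(L2_norm \<mu> (coherent_state t g))\<^sup>2 = norm (char_series t (of_real (norm pv)))"
proof -
  have H: "cadjoint H = H" "u \<in> SU2" "g = H ** u"
    using g(2) by (simp_all add: polar_decomposition_def pos_def_hermitian_def)
  have e: "cadjoint g ** g = cadjoint u ** (H ** H ** u)"
    unfolding H(3) cadjoint_mult H(1) by (simp add: matrix_mul_assoc)
  have "tr2 (cadjoint g ** g) = tr2 (H ** H ** u ** cadjoint u)"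
    unfolding e by (rule tr2_mult_commute)
  also have "H ** H ** u ** cadjoint u = H ** H"
    using SU2_cadjoint_right[OF H(2)] by (simp add: matrix_mul_assoc[symmetric])
  also have "tr2 (H ** H) = 2 * cosh (complex_of_real (norm pv))" by (rule tr2_boost_square[OF g(3)])
  finally have tr: "tr2 (cadjoint g ** g) = 2 * cosh (complex_of_real (norm pv))" .
  have "det g = 1" using g(1) by (simp add: SL2C_def)
  then show ?thesis
    unfolding L2_norm_square using L2_inner_coherent_state[OF haar t _ _ tr] by simp
qed

text \<open>The trace of \<open>cadjoint g ** g'\<close> equals that of \<open>Ht\<close> times the
  inverse of the rotation by \<theta>. The inverse flips the sign of the sine term, so the trace is
  twice the conjugate of \<open>cosh z\<close>; moduli of the series do not see the
  conjugation.\<close>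

lemma inner_coherent_states_polar:
  assumes haar: "normalized_haar_SU2 \<mu>" and t: "t > 0"
    and g: "g \<in> SL2C" "g' \<in> SL2C" "polar_decomposition g H u" "polar_decomposition g' H' u'"
      "polar_decomposition (H ** H') Ht ut" "Ht = mexp (cscale (- \<i> / 2) (tau_sum ptv))"
    and h: "u ** matrix_inv u' ** matrix_inv ut = mexp (tau_sum \<theta>v)"
    and \<alpha>: "ptv \<noteq> 0 \<and> \<theta>v \<noteq> 0 \<longrightarrow> cos \<alpha> = (ptv \<bullet> \<theta>v) / (norm ptv * norm \<theta>v)"
    and z: "cosh z = Complex (cosh (norm ptv / 2) * cos (norm \<theta>v)) (sinh (norm ptv / 2) * sin (norm \<theta>v) * cos \<alpha>)"
  shows "cmod (L2_inner \<mu> (coherent_state t g) (coherent_state t g')) = norm (char_series t z)"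
proof -
  have H: "cadjoint H = H" "u \<in> SU2" "g = H ** u" "u' \<in> SU2" "g' = H' ** u'" "ut \<in> SU2" "H ** H' = Ht ** ut"
    using g(3-5) by (simp_all add: polar_decomposition_def pos_def_hermitian_def)
  have e: "cadjoint g ** g' = cadjoint u ** (H ** H' ** u')"
    unfolding H(3,5) cadjoint_mult H(1) by (simp add: matrix_mul_assoc)
  have "tr2 (cadjoint g ** g') = tr2 (H ** H' ** u' ** cadjoint u)"
    unfolding e by (rule tr2_mult_commute)
  also have "H ** H' ** u' ** cadjoint u = Ht ** cadjoint (u ** cadjoint u' ** cadjoint ut)"
    unfolding H(7) by (simp add: cadjoint_mult matrix_mul_assoc)
  also have "u ** cadjoint u' ** cadjoint ut = mexp (tau_sum \<theta>v)"
    using h by (simp add: SU2_matrix_inv H)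
  also have "tr2 (Ht ** cadjoint (mexp (tau_sum \<theta>v))) =
     2 * (of_real (cosh (norm ptv / 2)) * of_real (cos (norm \<theta>v)) +
      of_real (sinh (norm ptv / 2)) * (- \<i> * of_real (sin (norm \<theta>v))) * of_real (sgn ptv \<bullet> sgn \<theta>v))"
    unfolding g(6) mexp_boost cadjoint_mexp_rotation by (rule tr2_bloch_product)
  also have "\<dots> = 2 * cnj (cosh z)"
  proof -
    have "sinh (norm ptv / 2) * sin (norm \<theta>v) * (sgn ptv \<bullet> sgn \<theta>v) = sinh (norm ptv / 2) * sin (norm \<theta>v) * cos \<alpha>"
    \<comment> \<open>In the degenerate case \<alpha> is arbitrary, but then \<open>sinh 0\<close>
      or \<open>sin 0\<close> annihilates both sides.\<close>
    proof (cases "ptv = 0 \<or> \<theta>v = 0")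
      case True
      then show ?thesis by (elim disjE) simp_all
    next
      case False
      have "sgn ptv \<bullet> sgn \<theta>v = (ptv \<bullet> \<theta>v) / (norm ptv * norm \<theta>v)"
        unfolding sgn_div_norm inner_scaleR_left inner_scaleR_right by (simp only: divide_inverse inverse_mult_distrib mult_ac)
      then show ?thesis using \<alpha> False by simp
    qed
    then show ?thesis unfolding z by (simp add: complex_eq_iff)
  qed
  also have "2 * cnj (cosh z) = 2 * cosh (cnj z)" by (simp add: cosh_field_def exp_cnj)
  finally have tr: "tr2 (cadjoint g ** g') = 2 * cosh (cnj z)" .
  have "det g = 1" "det g' = 1" using g(1,2) by (simp_all add: SL2C_def)
  from L2_inner_coherent_state[OF haar t this tr] show ?thesis by (simp add: char_series_cnj[OF t])
qed

section \<open>The overlap estimate in the two cases\<close>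

context
  fixes \<mu> :: "cmat2 measure" and t p p' pt \<theta> :: real and g g' :: cmat2 and z :: complex
  assumes t: "t > 0" "decay t < 1"
    and p: "p \<ge> 0" "p' \<ge> 0"
    and norms: "(L2_norm \<mu> (coherent_state t g))\<^sup>2 = norm (char_series t (of_real p))"
      "(L2_norm \<mu> (coherent_state t g'))\<^sup>2 = norm (char_series t (of_real p'))"
    and inner: "cmod (L2_inner \<mu> (coherent_state t g) (coherent_state t g')) = norm (char_series t z)"
    and z: "0 \<le> Im z" "Im z \<le> pi"
begin

lemma overlap_near:
  assumes "Im z \<le> 31 * pi / 32"
  shows "overlap \<mu> t g g' \<le>
    ((ratio_sinh z z)\<^sup>2 * exp (2 * (((Re z)\<^sup>2 - (Im z)\<^sup>2) / t) - p\<^sup>2 / t - p'\<^sup>2 / t) * (1 + 3 * decay t)) /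
    (x_over_sinh p * (1 - decay t) * (x_over_sinh p' * (1 - decay t)))"
proof -
  obtain \<kappa> where k: "\<kappa> \<ge> 0"
    and lower: "\<And>p. p \<ge> 0 \<Longrightarrow> \<kappa> * x_over_sinh p * exp (p\<^sup>2 / t) * (1 - decay t) \<le> norm (char_series t (of_real p))"
    and upper: "\<And>z. 0 \<le> Im z \<Longrightarrow> Im z \<le> 31 * pi / 32 \<Longrightarrow>
      norm (char_series t z) \<le> \<kappa> * ratio_sinh z z * exp (((Re z)\<^sup>2 - (Im z)\<^sup>2) / t) * (1 + decay t)"
    by (rule char_series_bounds[OF t]) blast
  have d: "0 < decay t" by (simp add: decay_def)
  have q: "x_over_sinh p > 0" "x_over_sinh p' > 0" using p by (simp_all add: x_over_sinh_pos)
  have "overlap \<mu> t g g' \<le> ((ratio_sinh z z)\<^sup>2 * exp (2 * (((Re z)\<^sup>2 - (Im z)\<^sup>2) / t) - p\<^sup>2 / t - p'\<^sup>2 / t) * (1 + decay t)\<^sup>2) /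
    (x_over_sinh p * (1 - decay t) * (x_over_sinh p' * (1 - decay t)))"
    unfolding overlap_def norms inner
    by (rule quotient_bound[OF k _ _ q _ _ upper[OF z(1) assms] lower[OF p(1)] lower[OF p(2)]])
      (use t d in \<open>auto simp: ratio_sinh_def\<close>)
  also have "\<dots> \<le> ((ratio_sinh z z)\<^sup>2 * exp (2 * (((Re z)\<^sup>2 - (Im z)\<^sup>2) / t) - p\<^sup>2 / t - p'\<^sup>2 / t) * (1 + 3 * decay t)) /
    (x_over_sinh p * (1 - decay t) * (x_over_sinh p' * (1 - decay t)))"
  proof (intro divide_right_mono mult_left_mono)
    have "decay t * decay t \<le> 1 * decay t" using t d by (intro mult_right_mono) auto
    then show "(1 + decay t)\<^sup>2 \<le> 1 + 3 * decay t" by (simp add: power2_eq_square algebra_simps)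
    show "0 \<le> x_over_sinh p * (1 - decay t) * (x_over_sinh p' * (1 - decay t))"
      using q t by (intro mult_nonneg_nonneg) auto
  qed auto
  finally show ?thesis .
qed

lemma overlap_far:
  assumes "31 * pi / 32 \<le> Im z" and \<theta>: "2 \<le> \<theta>\<^sup>2"
  shows "overlap \<mu> t g g' \<le>
    ((ratio_sinh (z - \<i> * of_real pi) z)\<^sup>2 * exp (2 * (((Re z)\<^sup>2 - (Im z)\<^sup>2) / t) - p\<^sup>2 / t - p'\<^sup>2 / t + \<theta>\<^sup>2 / t) * (1 + decay t)) /
    (x_over_sinh p * (1 - decay t) * (x_over_sinh p' * (1 - decay t)))"
proof -
  obtain \<kappa> where k: "\<kappa> \<ge> 0"
    and lower: "\<And>p. p \<ge> 0 \<Longrightarrow> \<kappa> * x_over_sinh p * exp (p\<^sup>2 / t) * (1 - decay t) \<le> norm (char_series t (of_real p))"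
    and upper: "\<And>z. 31 * pi / 32 \<le> Im z \<Longrightarrow> Im z \<le> pi \<Longrightarrow>
      norm (char_series t z) \<le> \<kappa> * ratio_sinh (z - \<i> * of_real pi) z *
        exp (((Re z)\<^sup>2 - (Im z)\<^sup>2) / t) * exp (1 / t) * decay t"
    by (rule char_series_bounds[OF t]) blast
  define A where "A = ((Re z)\<^sup>2 - (Im z)\<^sup>2) / t"
  define R where "R = ratio_sinh (z - \<i> * of_real pi) z"
  have d: "0 < decay t" by (simp add: decay_def)
  have q: "x_over_sinh p > 0" "x_over_sinh p' > 0" using p by (simp_all add: x_over_sinh_pos)
  have up: "norm (char_series t z) \<le> \<kappa> * R * exp A * (exp (1 / t) * decay t)"
    using upper[OF assms(1) z(2)] by (simp only: A_def R_def mult.assoc)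
  have "overlap \<mu> t g g' \<le> (R\<^sup>2 * exp (2 * A - p\<^sup>2 / t - p'\<^sup>2 / t) * (exp (1 / t) * decay t)\<^sup>2) /
    (x_over_sinh p * (1 - decay t) * (x_over_sinh p' * (1 - decay t)))"
    unfolding overlap_def norms inner
    by (rule quotient_bound[OF k _ _ q _ _ up lower[OF p(1)] lower[OF p(2)]])
      (use t d in \<open>auto simp: ratio_sinh_def R_def\<close>)
  also have "\<dots> \<le> (R\<^sup>2 * exp (2 * A - p\<^sup>2 / t - p'\<^sup>2 / t + \<theta>\<^sup>2 / t) * (1 + decay t)) /
    (x_over_sinh p * (1 - decay t) * (x_over_sinh p' * (1 - decay t)))"
  proof (rule divide_right_mono)
    have "decay t * decay t \<le> 1 * 1" using t d by (intro mult_mono) auto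
    then have 1: "(decay t)\<^sup>2 \<le> 1 + decay t" using d unfolding power2_eq_square by linarith
    \<comment> \<open>The exponent of case (ii) subtracts one \<theta>^2 less than that of case (i),
      which leaves exactly the room needed for this factor.\<close>
    have "(exp (1 / t))\<^sup>2 = exp (2 / t)" by (simp add: exp_of_nat_mult[symmetric])
    also have "\<dots> \<le> exp (\<theta>\<^sup>2 / t)" unfolding exp_le_cancel_iff using \<theta> t by (intro divide_right_mono) auto
    finally have "(exp (1 / t) * decay t)\<^sup>2 \<le> exp (\<theta>\<^sup>2 / t) * (1 + decay t)"
      unfolding power_mult_distrib using 1 by (intro mult_mono) auto
    then have "R\<^sup>2 * exp (2 * A - p\<^sup>2 / t - p'\<^sup>2 / t) * (exp (1 / t) * decay t)\<^sup>2 \<le>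
        R\<^sup>2 * exp (2 * A - p\<^sup>2 / t - p'\<^sup>2 / t) * (exp (\<theta>\<^sup>2 / t) * (1 + decay t))"
      by (intro mult_left_mono) auto
    then show "R\<^sup>2 * exp (2 * A - p\<^sup>2 / t - p'\<^sup>2 / t) * (exp (1 / t) * decay t)\<^sup>2 \<le>
        R\<^sup>2 * exp (2 * A - p\<^sup>2 / t - p'\<^sup>2 / t + \<theta>\<^sup>2 / t) * (1 + decay t)"
      by (simp only: exp_add[of _ "\<theta>\<^sup>2 / t"] mult.assoc)
    show "0 \<le> x_over_sinh p * (1 - decay t) * (x_over_sinh p' * (1 - decay t))"
      using q t by (intro mult_nonneg_nonneg) auto
  qed
  finally show ?thesis unfolding A_def R_def .
qed

end

text \<open>Both \<open>cosh s * cos \<phi>\<close> and \<open>cosh r * cos \<theta>\<close> are the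
  real part of \<open>x\<close>, so the cosines have the same sign. For \<phi> close to
  \<open>pi\<close> it is negative, which forces \<open>\<theta> \<ge> pi / 2 \<ge> 3 / 2\<close>,
  and 9/4 exceeds 2.\<close>

lemma angle_ge_half_pi:
  assumes x: "Re (cosh z) = cosh r * cos \<theta>" and z: "31 * pi / 32 \<le> Im z" "Im z \<le> pi"
    and \<theta>: "0 \<le> \<theta>"
  shows "2 \<le> \<theta>\<^sup>2"
proof -
  have "cos (Im z) < 0"
  proof -
    have "cos (Im z) < cos (pi / 2)" using z pi_gt_zero by (intro cos_monotone_0_pi) linarith+
    then show ?thesis by simp
  qed
  then have "cosh r * cos \<theta> < 0"
    unfolding x[symmetric] cosh_complex_polar(3) by (intro mult_pos_neg) auto
  then have "cos \<theta> < 0" using cosh_real_pos[of r] by (simp add: mult_less_0_iff)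
  have "pi / 2 \<le> \<theta>"
  proof (rule ccontr)
    assume "\<not> pi / 2 \<le> \<theta>"
    then have "0 \<le> cos \<theta>" using \<theta> by (intro cos_ge_zero) auto
    with \<open>cos \<theta> < 0\<close> show False by simp
  qed
  then have "3 / 2 \<le> \<theta>" using pi_gt3 by linarith
  then have "(3 / 2) * (3 / 2) \<le> \<theta> * \<theta>" by (intro mult_mono) auto
  then show ?thesis by (simp add: power2_eq_square)
qed

theorem theorem4p4:
  fixes \<mu> :: "cmat2 measure"
  assumes "normalized_haar_SU2 \<mu>"
  shows "\<exists>K K' K'' :: real \<Rightarrow> real.
    exp_decaying K \<and> exp_decaying K' \<and> exp_decaying K'' \<and>
    (\<forall>t>0. K t < 1 \<longrightarrow>
      (\<forall>(g :: cmat2) (g' :: cmat2) (H :: cmat2) (H' :: cmat2) (Ht :: cmat2)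
        (u :: cmat2) (u' :: cmat2) (ut :: cmat2)
        (pv :: real^3) (pv' :: real^3) (ptv :: real^3) (\<theta>v :: real^3) (\<alpha> :: real).
        g \<in> SL2C \<longrightarrow> g' \<in> SL2C \<longrightarrow>
        polar_decomposition g H u \<longrightarrow>
        polar_decomposition g' H' u' \<longrightarrow>
        polar_decomposition (H ** H') Ht ut \<longrightarrow>
        H = mexp (cscale (- \<i> / 2) (tau_sum pv)) \<longrightarrow>
        H' = mexp (cscale (- \<i> / 2) (tau_sum pv')) \<longrightarrow>
        Ht = mexp (cscale (- \<i> / 2) (tau_sum ptv)) \<longrightarrow>
        u ** matrix_inv u' ** matrix_inv ut = mexp (tau_sum \<theta>v) \<longrightarrow>
        norm \<theta>v \<le> pi \<longrightarrow>
        0 \<le> \<alpha> \<longrightarrow> \<alpha> \<le> pi \<longrightarrow>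
        (ptv \<noteq> 0 \<and> \<theta>v \<noteq> 0 \<longrightarrow> cos \<alpha> = (ptv \<bullet> \<theta>v) / (norm ptv * norm \<theta>v)) \<longrightarrow>
        (let p = norm pv; p' = norm pv'; pt = norm ptv; \<theta> = norm \<theta>v;
             x = Complex (cosh (pt / 2) * cos \<theta>) (sinh (pt / 2) * sin \<theta> * cos \<alpha>);
             s = Re (arcosh_br x); \<phi> = Im (arcosh_br x);
             \<Delta>2 = p\<^sup>2 + p'\<^sup>2 - pt\<^sup>2 / 2;
             \<delta>2 = pt\<^sup>2 / 4 - s\<^sup>2 + \<phi>\<^sup>2 - \<theta>\<^sup>2
         in
          (0 \<le> \<phi> \<and> \<phi> \<le> 31 * pi / 32 \<longrightarrow>
            overlap \<mu> t g g' \<le>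
              (ext_pm1 (\<lambda>y. (cmod (arcosh_br y))\<^sup>2 / cmod (y\<^sup>2 - 1)) x
                 * exp (- ((\<Delta>2 + 2 * \<theta>\<^sup>2 + 2 * \<delta>2) / t)) * (1 + K' t)) /
              (x_over_sinh p * (1 - K t) * (x_over_sinh p' * (1 - K t)))) \<and>
          (31 * pi / 32 \<le> \<phi> \<and> \<phi> \<le> pi \<longrightarrow>
            overlap \<mu> t g g' \<le>
              (ext_pm1 (\<lambda>y. (cmod (arcosh_br y - \<i> * of_real pi))\<^sup>2 / cmod (y\<^sup>2 - 1)) x
                 * exp (- ((\<Delta>2 + \<theta>\<^sup>2 + 2 * \<delta>2) / t)) * (1 + K'' t)) /
              (x_over_sinh p * (1 - K t) * (x_over_sinh p' * (1 - K t)))))))"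
proof (intro exI conjI allI impI)
  \<comment> \<open>The middle function carries the factor 3 because
    \<open>(1 + d)^2 \<le> 1 + 3 * d\<close> for \<open>0 < d < 1\<close>; the square comes from the
    squared inner product.\<close>
  show "exp_decaying (\<lambda>t. 1 * decay t)" "exp_decaying (\<lambda>t. 3 * decay t)" "exp_decaying (\<lambda>t. 1 * decay t)"
    by (intro exp_decaying_decay; simp)+
  fix t :: real and g g' H H' Ht u u' ut :: cmat2 and pv pv' ptv \<theta>v :: "real^3" and \<alpha> :: real
  assume t: "0 < t" "1 * decay t < 1"
    and g: "g \<in> SL2C" "g' \<in> SL2C"
    and polar: "polar_decomposition g H u" "polar_decomposition g' H' u'" "polar_decomposition (H ** H') Ht ut"
    and boost: "H = mexp (cscale (- \<i> / 2) (tau_sum pv))" "H' = mexp (cscale (- \<i> / 2) (tau_sum pv'))"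
      "Ht = mexp (cscale (- \<i> / 2) (tau_sum ptv))"
    and rot: "u ** matrix_inv u' ** matrix_inv ut = mexp (tau_sum \<theta>v)"
    and \<alpha>: "ptv \<noteq> 0 \<and> \<theta>v \<noteq> 0 \<longrightarrow> cos \<alpha> = (ptv \<bullet> \<theta>v) / (norm ptv * norm \<theta>v)"
  define p p' pt \<theta> where "p = norm pv" and "p' = norm pv'" and "pt = norm ptv" and "\<theta> = norm \<theta>v"
  define x where "x = Complex (cosh (pt / 2) * cos \<theta>) (sinh (pt / 2) * sin \<theta> * cos \<alpha>)"
  define z where "z = arcosh_br x"
  have dt: "decay t < 1" using t(2) by simp
  have z: "cosh z = x" "0 \<le> Im z" "Im z \<le> pi" by (simp_all add: z_def arcosh_br_props)
  have np: "(L2_norm \<mu> (coherent_state t g))\<^sup>2 = norm (char_series t (of_real p))"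
    "(L2_norm \<mu> (coherent_state t g'))\<^sup>2 = norm (char_series t (of_real p'))"
    unfolding p_def p'_def
    by (rule norm_coherent_state_polar[OF assms t(1)]; fact)+
  have ip: "cmod (L2_inner \<mu> (coherent_state t g) (coherent_state t g')) = norm (char_series t z)"
    by (rule inner_coherent_states_polar[OF assms t(1) g polar boost(3) rot \<alpha>])
      (simp add: z(1) x_def pt_def \<theta>_def)
  have p0: "p \<ge> 0" "p' \<ge> 0" "\<theta> \<ge> 0" by (simp_all add: p_def p'_def \<theta>_def)
  have near: "overlap \<mu> t g g' \<le>
      (ext_pm1 (\<lambda>y. (cmod (arcosh_br y))\<^sup>2 / cmod (y\<^sup>2 - 1)) x
         * exp (- ((p\<^sup>2 + p'\<^sup>2 - pt\<^sup>2 / 2 + 2 * \<theta>\<^sup>2 + 2 * (pt\<^sup>2 / 4 - (Re z)\<^sup>2 + (Im z)\<^sup>2 - \<theta>\<^sup>2)) / t)) * (1 + 3 * decay t)) /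
      (x_over_sinh p * (1 - decay t) * (x_over_sinh p' * (1 - decay t)))" if "Im z \<le> 31 * pi / 32"
  proof -
    have "Im z < pi" using that pi_gt_zero by linarith
    then have r: "ext_pm1 (\<lambda>y. (cmod (arcosh_br y))\<^sup>2 / cmod (y\<^sup>2 - 1)) x = (ratio_sinh z z)\<^sup>2"
      using ext_pm1_ratio[of 0 x] by (simp add: z_def)
    \<comment> \<open>The terms in \<open>pt\<close> and \<theta> cancel: the exponent of case (i)
      is just \<open>p^2 + p'^2 - 2 * s^2 + 2 * \<phi>^2\<close>, and that of case (ii) is smaller
      by \<theta>^2.\<close>
    have e: "- ((p\<^sup>2 + p'\<^sup>2 - pt\<^sup>2 / 2 + 2 * \<theta>\<^sup>2 + 2 * (pt\<^sup>2 / 4 - (Re z)\<^sup>2 + (Im z)\<^sup>2 - \<theta>\<^sup>2)) / t)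
        = 2 * (((Re z)\<^sup>2 - (Im z)\<^sup>2) / t) - p\<^sup>2 / t - p'\<^sup>2 / t"
      using t by (simp add: field_simps)
    show ?thesis unfolding r e by (rule overlap_near[OF t(1) dt p0(1,2) np ip z(2,3) that])
  qed
  have far: "overlap \<mu> t g g' \<le>
      (ext_pm1 (\<lambda>y. (cmod (arcosh_br y - \<i> * of_real pi))\<^sup>2 / cmod (y\<^sup>2 - 1)) x
         * exp (- ((p\<^sup>2 + p'\<^sup>2 - pt\<^sup>2 / 2 + \<theta>\<^sup>2 + 2 * (pt\<^sup>2 / 4 - (Re z)\<^sup>2 + (Im z)\<^sup>2 - \<theta>\<^sup>2)) / t)) * (1 + decay t)) /
      (x_over_sinh p * (1 - decay t) * (x_over_sinh p' * (1 - decay t)))" if "31 * pi / 32 \<le> Im z"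
  proof -
    have "0 < Im z" using that pi_gt_zero by linarith
    then have r: "ext_pm1 (\<lambda>y. (cmod (arcosh_br y - \<i> * of_real pi))\<^sup>2 / cmod (y\<^sup>2 - 1)) x = (ratio_sinh (z - \<i> * of_real pi) z)\<^sup>2"
      using ext_pm1_ratio[of "\<i> * of_real pi" x] by (simp add: z_def)
    have e: "- ((p\<^sup>2 + p'\<^sup>2 - pt\<^sup>2 / 2 + \<theta>\<^sup>2 + 2 * (pt\<^sup>2 / 4 - (Re z)\<^sup>2 + (Im z)\<^sup>2 - \<theta>\<^sup>2)) / t)
        = 2 * (((Re z)\<^sup>2 - (Im z)\<^sup>2) / t) - p\<^sup>2 / t - p'\<^sup>2 / t + \<theta>\<^sup>2 / t"
      using t by (simp add: field_simps)
    have "Re (cosh z) = cosh (pt / 2) * cos \<theta>" unfolding z(1) x_def by simp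
    from angle_ge_half_pi[OF this that z(3) p0(3)]
    show ?thesis unfolding r e by (rule overlap_far[OF t(1) dt p0(1,2) np ip z(2,3) that])
  qed
  show "(let p = norm pv; p' = norm pv'; pt = norm ptv; \<theta> = norm \<theta>v;
         x = Complex (cosh (pt / 2) * cos \<theta>) (sinh (pt / 2) * sin \<theta> * cos \<alpha>);
         s = Re (arcosh_br x); \<phi> = Im (arcosh_br x);
         \<Delta>2 = p\<^sup>2 + p'\<^sup>2 - pt\<^sup>2 / 2;
         \<delta>2 = pt\<^sup>2 / 4 - s\<^sup>2 + \<phi>\<^sup>2 - \<theta>\<^sup>2
     in
      (0 \<le> \<phi> \<and> \<phi> \<le> 31 * pi / 32 \<longrightarrow>
        overlap \<mu> t g g' \<le>
          (ext_pm1 (\<lambda>y. (cmod (arcosh_br y))\<^sup>2 / cmod (y\<^sup>2 - 1)) x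
             * exp (- ((\<Delta>2 + 2 * \<theta>\<^sup>2 + 2 * \<delta>2) / t)) * (1 + (3 * decay t))) /
          (x_over_sinh p * (1 - (1 * decay t)) * (x_over_sinh p' * (1 - (1 * decay t))))) \<and>
      (31 * pi / 32 \<le> \<phi> \<and> \<phi> \<le> pi \<longrightarrow>
        overlap \<mu> t g g' \<le>
          (ext_pm1 (\<lambda>y. (cmod (arcosh_br y - \<i> * of_real pi))\<^sup>2 / cmod (y\<^sup>2 - 1)) x
             * exp (- ((\<Delta>2 + \<theta>\<^sup>2 + 2 * \<delta>2) / t)) * (1 + (1 * decay t))) /
          (x_over_sinh p * (1 - (1 * decay t)) * (x_over_sinh p' * (1 - (1 * decay t))))))"
    using near far unfolding Let_def p_def[symmetric] p'_def[symmetric] pt_def[symmetric] \<theta>_def[symmetric]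
      x_def[symmetric] z_def[symmetric] by simp
qed

end
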